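(* Let $R$ be an extended CIR process with parameters $\kappa>0$, $\theta(\cdot)$ and initial value $R_0\ge0$ (as defined in the context). For $\lambda\ge0$, $\gamma>0$, $t\ge0$ with $\lambda>\sqrt{\kappa^2+2\gamma}-\kappa$ we have $$\mathbb{E}\,e^{-\lambda R_t-\gamma\int_0^tR_u\,du}=e^{-R_0f(t)-\kappa\int_0^t\theta(s)f(s)\,ds},$$ where $$f(t)=\frac{\kappa+\sqrt{\kappa^2+2\gamma}+c\,e^{\sqrt{\kappa^2+2\gamma}\,t}\big(\sqrt{\kappa^2+2\gamma}-\kappa\big)}{c\,e^{\sqrt{\kappa^2+2\gamma}\,t}-1},\qquad c=\frac{\lambda+\kappa+\sqrt{\kappa^2+2\gamma}}{\lambda+\kappa-\sqrt{\kappa^2+2\gamma}}>1.$$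
   Context: An extended CIR process is the nonnegative process $R$ given by $$dR_t=\kappa(\theta(t)-R_t)\,dt+\sqrt{R_t}\,dZ_t,$$ where $Z$ is a standard Brownian motion, $\kappa$ is a positive constant, $\theta:[0,\infty)\to[0,\infty)$ is a continuous function and $R_0\ge0$ is a constant.
   Formalization: The time integral in the exponent is corrected from ∫₀ᵗ θ(s)f(s)ds to ∫₀ᵗ θ(s)f(t−s)ds; the printed formula fails for non-constant θ, e.g. θ(s)=s, R₀=0, t>0, because f is strictly decreasing, and the two agree for constant θ. *)

theory Defs
  imports "HOL-Probability.Probability"
begin

text \<open>
  Stochastic processes are curried functions of type real => 'a => real (time first); only times
  t >= 0 matter. The filtration locale of the library is indexed by all of real; a filtration on
  the half line is extended by F t = F 0 for t < 0. No completeness or right continuity of the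
  filtration is required.
\<close>

definition filtered_prob_space :: "'a measure \<Rightarrow> (real \<Rightarrow> 'a measure) \<Rightarrow> bool" where
  "filtered_prob_space M F \<longleftrightarrow>
     prob_space M \<and> filtration (space M) F \<and> (\<forall>t. subalgebra M (F t))"

definition adapted :: "(real \<Rightarrow> 'a measure) \<Rightarrow> (real \<Rightarrow> 'a \<Rightarrow> real) \<Rightarrow> bool" where
  "adapted F X \<longleftrightarrow> (\<forall>t\<ge>0. X t \<in> borel_measurable (F t))"

definition progressively_measurable ::
    "(real \<Rightarrow> 'a measure) \<Rightarrow> (real \<Rightarrow> 'a \<Rightarrow> real) \<Rightarrow> bool" where
  "progressively_measurable F X \<longleftrightarrow>
     (\<forall>t\<ge>0. (\<lambda>(s, \<omega>). X s \<omega>) \<in> borel_measurable (restrict_space borel {0..t} \<Otimes>\<^sub>M F t))"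

definition standard_brownian_motion ::
    "'a measure \<Rightarrow> (real \<Rightarrow> 'a measure) \<Rightarrow> (real \<Rightarrow> 'a \<Rightarrow> real) \<Rightarrow> bool" where
  "standard_brownian_motion M F Z \<longleftrightarrow>
     adapted F Z \<and>
     (AE \<omega> in M. Z 0 \<omega> = 0) \<and>
     (AE \<omega> in M. continuous_on {0..} (\<lambda>t. Z t \<omega>)) \<and>
     (\<forall>s t. 0 \<le> s \<longrightarrow> s < t \<longrightarrow>
        distributed M lborel (\<lambda>\<omega>. Z t \<omega> - Z s \<omega>) (normal_density 0 (sqrt (t - s))) \<and>
        prob_space.indep_set M (sets (F s))
          {(\<lambda>\<omega>. Z t \<omega> - Z s \<omega>) -` B \<inter> space M | B. B \<in> sets borel})"

definition tendsto_in_prob ::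
    "'a measure \<Rightarrow> (nat \<Rightarrow> 'a \<Rightarrow> real) \<Rightarrow> ('a \<Rightarrow> real) \<Rightarrow> bool" where
  "tendsto_in_prob M X Y \<longleftrightarrow>
     (\<forall>n. X n \<in> borel_measurable M) \<and> Y \<in> borel_measurable M \<and>
     (\<forall>\<epsilon>>0. (\<lambda>n. measure M {\<omega> \<in> space M. \<epsilon> < \<bar>X n \<omega> - Y \<omega>\<bar>}) \<longlonglongrightarrow> 0)"

text \<open>
  A simple integrand with n steps is given by grid points p 0 <= ... <= p n and bounded weights
  \<xi> i, known at time p i, on the step (p i, p (i + 1)].
\<close>

definition simple_integrand ::
    "'a measure \<Rightarrow> (real \<Rightarrow> 'a measure) \<Rightarrow> nat \<Rightarrow> (nat \<Rightarrow> real) \<Rightarrow> (nat \<Rightarrow> 'a \<Rightarrow> real) \<Rightarrow> bool" where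
  "simple_integrand M F n p \<xi> \<longleftrightarrow>
     0 \<le> p 0 \<and> (\<forall>i<n. p i \<le> p (Suc i)) \<and>
     (\<forall>i<n. \<xi> i \<in> borel_measurable (F (p i)) \<and> (\<exists>C. \<forall>\<omega>\<in>space M. \<bar>\<xi> i \<omega>\<bar> \<le> C))"

definition simple_process ::
    "nat \<Rightarrow> (nat \<Rightarrow> real) \<Rightarrow> (nat \<Rightarrow> 'a \<Rightarrow> real) \<Rightarrow> real \<Rightarrow> 'a \<Rightarrow> real" where
  "simple_process n p \<xi> s \<omega> = (\<Sum>i<n. \<xi> i \<omega> * indicator {p i<..p (Suc i)} s)"

definition simple_ito_integral ::
    "(real \<Rightarrow> 'a \<Rightarrow> real) \<Rightarrow> nat \<Rightarrow> (nat \<Rightarrow> real) \<Rightarrow> (nat \<Rightarrow> 'a \<Rightarrow> real) \<Rightarrow> real \<Rightarrow> 'a \<Rightarrow> real" where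
  "simple_ito_integral Z n p \<xi> t \<omega> =
     (\<Sum>i<n. \<xi> i \<omega> * (Z (min (p (Suc i)) t) \<omega> - Z (min (p i) t) \<omega>))"

text \<open>
  The random variable Y is (a version of) the Ito integral of H against the Brownian motion Z over
  [0,t], for progressively measurable H with almost surely square integrable paths: Y is the limit
  in probability of the integrals of simple integrands that approximate H in L2[0,t] in probability.
\<close>

definition has_ito_integral ::
    "'a measure \<Rightarrow> (real \<Rightarrow> 'a measure) \<Rightarrow> (real \<Rightarrow> 'a \<Rightarrow> real) \<Rightarrow> (real \<Rightarrow> 'a \<Rightarrow> real) \<Rightarrow>
     real \<Rightarrow> ('a \<Rightarrow> real) \<Rightarrow> bool" where
  "has_ito_integral M F Z H t Y \<longleftrightarrow>
     progressively_measurable F H \<and>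
     (AE \<omega> in M. set_integrable lborel {0..t} (\<lambda>s. (H s \<omega>)\<^sup>2)) \<and>
     (\<exists>n p \<xi>.
        (\<forall>k. simple_integrand M F (n k) (p k) (\<xi> k)) \<and>
        tendsto_in_prob M
          (\<lambda>k \<omega>. LBINT s:{0..t}. (simple_process (n k) (p k) (\<xi> k) s \<omega> - H s \<omega>)\<^sup>2) (\<lambda>\<omega>. 0) \<and>
        tendsto_in_prob M (\<lambda>k. simple_ito_integral Z (n k) (p k) (\<xi> k) t) Y)"

text \<open>
  The last clause is the integrated form of dR = \<kappa> (\<theta> t - R) dt + sqrt R dZ. All paths of R are
  required to be continuous, not just almost all, so that the pathwise integral of R is a random
  variable although the probability space need not be complete.
\<close>

definition extended_CIR ::
    "'a measure \<Rightarrow> (real \<Rightarrow> 'a measure) \<Rightarrow> (real \<Rightarrow> 'a \<Rightarrow> real) \<Rightarrow> real \<Rightarrow> (real \<Rightarrow> real) \<Rightarrow> real \<Rightarrow>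
     (real \<Rightarrow> 'a \<Rightarrow> real) \<Rightarrow> bool" where
  "extended_CIR M F Z \<kappa> \<theta> R\<^sub>0 R \<longleftrightarrow>
     0 < \<kappa> \<and> continuous_on {0..} \<theta> \<and> (\<forall>t\<ge>0. 0 \<le> \<theta> t) \<and> 0 \<le> R\<^sub>0 \<and>
     filtered_prob_space M F \<and> standard_brownian_motion M F Z \<and>
     adapted F R \<and>
     (\<forall>\<omega>\<in>space M. continuous_on {0..} (\<lambda>t. R t \<omega>)) \<and>
     (AE \<omega> in M. R 0 \<omega> = R\<^sub>0) \<and>
     (AE \<omega> in M. \<forall>t\<ge>0. 0 \<le> R t \<omega>) \<and>
     (\<forall>t\<ge>0. has_ito_integral M F Z (\<lambda>s \<omega>. sqrt (R s \<omega>)) t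
        (\<lambda>\<omega>. R t \<omega> - R\<^sub>0 - (LBINT s:{0..t}. \<kappa> * (\<theta> s - R s \<omega>))))"

definition CIR_c :: "real \<Rightarrow> real \<Rightarrow> real \<Rightarrow> real" where
  "CIR_c \<kappa> lam \<gamma> =
     (lam + \<kappa> + sqrt (\<kappa>\<^sup>2 + 2 * \<gamma>)) / (lam + \<kappa> - sqrt (\<kappa>\<^sup>2 + 2 * \<gamma>))"

text \<open>
  As a function of t this is the solution of f' = \<gamma> - \<kappa> f - f^2/2 with f 0 = lam. Hence, with T fixed,
  s \<mapsto> exp (- R s * f (T - s) - ...) is a martingale only if the drift \<kappa> \<theta> s is weighted with
  f (T - s): the time integral in the transform is a convolution of \<theta> and f. Printed versions with
  the weight f s agree with it for constant \<theta>, but are wrong for general \<theta>.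
\<close>

definition CIR_f :: "real \<Rightarrow> real \<Rightarrow> real \<Rightarrow> real \<Rightarrow> real" where
  "CIR_f \<kappa> lam \<gamma> t =
     (let d = sqrt (\<kappa>\<^sup>2 + 2 * \<gamma>); c = CIR_c \<kappa> lam \<gamma> in
      (\<kappa> + d + c * exp (d * t) * (d - \<kappa>)) / (c * exp (d * t) - 1))"

end

theory Submission
  imports Defs
begin

text \<open>
  Put a u = f (t - u), which solves the Riccati equation a' = \<kappa> a + a^2 / 2 - \<gamma>, and let W u be the
  exponential of - a u R u minus \<gamma> times the integral of R over [0,u] and minus \<kappa> times the
  integral of a \<theta> over [u,t]. Then W is a stochastic exponential, and it suffices to show that the
  expectation of W is constant.

  No Ito formula is needed. For simple integrands the exponentials exp (S - V / 2) have
  expectation one by the Gaussian moment generating function. By Fatou, the constant integrand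
  2 \<kappa> gives a bound on the expectation of exp (2 \<kappa> R u), because for this constant the mean
  reversion of R exactly compensates the quadratic variation. Hence all exponential moments of
  integrals of R over sufficiently short intervals are bounded, which yields the uniform
  integrability needed to pass from simple integrands to b sqrt R for constant b on a short interval.
  Replacing a by a step function on a fine grid, the product of these exact identities differs from
  W t / W s by a factor that tends to one pathwise, and the same exponential moments justify
  exchanging this limit with the expectation when t - s is small.
\<close>

subsection \<open>Convergence in probability and uniform integrability\<close>

text \<open>The obstacle is integrability. Moments of \<open>exp (c * IR s t)\<close> are controlled
  only for \<open>c * (t - s) \<le> 2 * \<kappa>\<close>, so equalities survive a limit only on
  short intervals, whose admissible length must not depend on their position in [0,T]; then finitely
  many of them can be chained. Every such limit rests on a uniform second moment. The square of a
  stochastic exponential splits as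
  \<open>exp (2 * S - V) = exp (2 * S - 4 * V) * exp (3 * V)\<close>. Squaring the first factor
  gives the stochastic exponential of \<open>4 * S\<close>, of expectation one; squaring the second
  gives \<open>exp (6 * V)\<close>. This is the 6 that recurs below. There is no circularity: the
  moments of R come from a Fatou inequality, which asks for no second moment. A second difficulty is
  that the Ito integral is specified at each time separately, by approximating sequences that need
  not be related. An increment over [s,t] becomes a limit of simple integrals of one sequence only
  after the sequence for t has been shown to converge at s as well.\<close>

lemma (in prob_space) tendsto_in_prob_AE_subseq:
  assumes "tendsto_in_prob M X Y"
  shows "\<exists>r::nat \<Rightarrow> nat. strict_mono r \<and> (AE \<omega> in M. (\<lambda>k. X (r k) \<omega>) \<longlonglongrightarrow> Y \<omega>)"
proof -
  have X[measurable]: "\<And>n. X n \<in> borel_measurable M" and Y[measurable]: "Y \<in> borel_measurable M"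
    and lim: "\<And>\<epsilon>. \<epsilon> > 0 \<Longrightarrow> (\<lambda>n. prob {\<omega> \<in> space M. \<epsilon> < \<bar>X n \<omega> - Y \<omega>\<bar>}) \<longlonglongrightarrow> 0"
    using assms unfolding tendsto_in_prob_def by auto
  \<comment> \<open>Truncation at 1 turns convergence in probability into convergence in L1, where
    almost surely convergent subsequences are available. Pathwise the truncation is eventually
    inactive.\<close>
  define u where "u n \<omega> = min 1 \<bar>X n \<omega> - Y \<omega>\<bar>" for n \<omega>
  have [measurable]: "\<And>n. u n \<in> borel_measurable M" unfolding u_def by measurable
  have int: "integrable M (u n)" for n
    by (rule integrable_const_bound[where B = 1]) (auto simp: u_def)
  have "(\<lambda>n. expectation (\<lambda>\<omega>. norm (u n \<omega>))) \<longlonglongrightarrow> 0"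
  proof (rule LIMSEQ_I)
    fix e :: real assume e: "e > 0"
    have "\<forall>\<^sub>F n in sequentially. prob {\<omega> \<in> space M. e/2 < \<bar>X n \<omega> - Y \<omega>\<bar>} < e/2"
      using lim[of "e/2"] e by (intro order_tendstoD(2)) auto
    then obtain N where N: "\<And>n. n \<ge> N \<Longrightarrow> prob {\<omega> \<in> space M. e/2 < \<bar>X n \<omega> - Y \<omega>\<bar>} < e/2"
      unfolding eventually_sequentially by blast
    have "expectation (\<lambda>\<omega>. norm (u n \<omega>)) < e" if n: "n \<ge> N" for n
    proof -
      let ?A = "{\<omega> \<in> space M. e/2 < \<bar>X n \<omega> - Y \<omega>\<bar>}"
      have "expectation (\<lambda>\<omega>. norm (u n \<omega>)) \<le> expectation (\<lambda>\<omega>. e/2 + indicator ?A \<omega>)"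
      proof (rule integral_mono)
        show "integrable M (\<lambda>\<omega>. e/2 + indicator ?A \<omega> :: real)"
          by (intro integrable_const_bound[where B = "e/2 + 1"]) (auto simp: indicator_def e less_imp_le)
        show "integrable M (\<lambda>\<omega>. norm (u n \<omega>))" using int by auto
      qed (use e in \<open>auto simp: u_def indicator_def min_def\<close>)
      also have "\<dots> = e/2 + prob ?A"
      proof -
        have "integrable M (\<lambda>\<omega>. indicator ?A \<omega> :: real)"
          by (intro integrable_const_bound[where B = 1]) auto
        from Bochner_Integration.integral_add[OF integrable_const[of "e/2"] this]
        show ?thesis by (simp add: prob_space)
      qed
      finally show ?thesis using N[OF n] by simp
    qed
    moreover have "0 \<le> expectation (\<lambda>\<omega>. norm (u n \<omega>))" for n by simp
    ultimately show "\<exists>N. \<forall>n\<ge>N. norm (expectation (\<lambda>\<omega>. norm (u n \<omega>)) - 0) < e"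
      by (intro exI[of _ N]) auto
  qed
  from tendsto_L1_AE_subseq[OF int this] obtain r where r: "strict_mono r"
    and ae: "AE \<omega> in M. (\<lambda>n. u (r n) \<omega>) \<longlonglongrightarrow> 0" by blast
  have "AE \<omega> in M. (\<lambda>k. X (r k) \<omega>) \<longlonglongrightarrow> Y \<omega>"
    using ae
  proof eventually_elim
    case (elim \<omega>)
    have "\<forall>\<^sub>F n in sequentially. u (r n) \<omega> < 1"
      using elim by (rule order_tendstoD(2)) simp
    then have "\<forall>\<^sub>F n in sequentially. u (r n) \<omega> = \<bar>X (r n) \<omega> - Y \<omega>\<bar>"
      by eventually_elim (auto simp: u_def)
    then have "(\<lambda>n. \<bar>X (r n) \<omega> - Y \<omega>\<bar>) \<longlonglongrightarrow> 0"
      using elim by (rule Lim_transform_eventually[rotated])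
    then show ?case by (subst LIM_zero_iff[symmetric]) (simp add: tendsto_rabs_zero_iff)
  qed
  with r show ?thesis by blast
qed

lemma tendsto_in_prob_subseq:
  assumes "tendsto_in_prob M X Y" "strict_mono (r::nat \<Rightarrow> nat)"
  shows "tendsto_in_prob M (\<lambda>k. X (r k)) Y"
  using assms LIMSEQ_subseq_LIMSEQ[OF _ assms(2)] unfolding tendsto_in_prob_def comp_def by blast

lemma AE_lim_subseq:
  assumes "AE \<omega> in M. (\<lambda>k. X k \<omega>) \<longlonglongrightarrow> Y \<omega>" "strict_mono (r::nat \<Rightarrow> nat)"
  shows "AE \<omega> in M. (\<lambda>k. X (r k) \<omega>) \<longlonglongrightarrow> Y \<omega>"
  using assms(1) by eventually_elim (use LIMSEQ_subseq_LIMSEQ[OF _ assms(2)] in \<open>auto simp: comp_def\<close>)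

text \<open>Fatou gives one inequality. For the other,
  \<open>x \<le> min x m + x\<^sup>2 / m\<close> for nonnegative x, so truncation at level m loses
  at most a constant over m, uniformly in k, while the truncated variables converge by domination.
  Uniform integrability is phrased as a second moment bound because that is what the exponential
  estimates deliver.\<close>

lemma (in prob_space) nn_integral_lim_of_L2_bound:
  fixes X :: "nat \<Rightarrow> 'a \<Rightarrow> real"
  assumes [measurable]: "\<And>k. X k \<in> borel_measurable M" "Y \<in> borel_measurable M"
    and nonneg: "\<And>k \<omega>. 0 \<le> X k \<omega>"
    and lim: "AE \<omega> in M. (\<lambda>k. X k \<omega>) \<longlonglongrightarrow> Y \<omega>"
    and L: "\<And>k. (\<integral>\<^sup>+\<omega>. X k \<omega> \<partial>M) = L"
    and B: "\<And>k. (\<integral>\<^sup>+\<omega>. ennreal ((X k \<omega>)\<^sup>2) \<partial>M) \<le> ennreal B"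
  shows "(\<integral>\<^sup>+\<omega>. Y \<omega> \<partial>M) = L"
proof (rule antisym)
  have lim': "AE \<omega> in M. (\<lambda>k. ennreal (X k \<omega>)) \<longlonglongrightarrow> ennreal (Y \<omega>)"
    using lim by eventually_elim (rule tendsto_ennrealI)
  have "(\<integral>\<^sup>+\<omega>. Y \<omega> \<partial>M) = (\<integral>\<^sup>+\<omega>. liminf (\<lambda>k. ennreal (X k \<omega>)) \<partial>M)"
    by (rule nn_integral_cong_AE) (use lim' in eventually_elim, simp add: lim_imp_Liminf)
  also have "\<dots> \<le> liminf (\<lambda>k. \<integral>\<^sup>+\<omega>. ennreal (X k \<omega>) \<partial>M)" by (rule nn_integral_liminf) simp
  also have "\<dots> = L" by (simp add: L Liminf_const)
  finally show "(\<integral>\<^sup>+\<omega>. Y \<omega> \<partial>M) \<le> L" .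
  \<comment> \<open>\<open>ennreal\<close> maps negative reals to 0, so this is the same bound, now
    with a nonnegative real that can be divided by m.\<close>
  define C where "C = max B 0"
  have C: "0 \<le> C" "\<And>k. (\<integral>\<^sup>+\<omega>. ennreal ((X k \<omega>)\<^sup>2) \<partial>M) \<le> ennreal C"
    using B by (auto simp: C_def intro!: order_trans[OF B] ennreal_leI)
  have "L \<le> (\<integral>\<^sup>+\<omega>. Y \<omega> \<partial>M) + ennreal (C / m)" if m: "m > 0" for m :: real
  proof -
    have "(\<lambda>k. \<integral>\<^sup>+\<omega>. ennreal (min (X k \<omega>) m) \<partial>M) \<longlonglongrightarrow> (\<integral>\<^sup>+\<omega>. ennreal (min (Y \<omega>) m) \<partial>M)"
    proof (rule nn_integral_dominated_convergence[where w = "\<lambda>_. ennreal m"])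
      show "AE \<omega> in M. (\<lambda>k. ennreal (min (X k \<omega>) m)) \<longlonglongrightarrow> ennreal (min (Y \<omega>) m)"
        using lim by eventually_elim (intro tendsto_ennrealI tendsto_min tendsto_const)
      show "\<And>k. AE \<omega> in M. ennreal (min (X k \<omega>) m) \<le> ennreal m" by (auto intro!: AE_I2 ennreal_leI)
    qed (auto simp: emeasure_space_1)
    then have "(\<lambda>k. (\<integral>\<^sup>+\<omega>. ennreal (min (X k \<omega>) m) \<partial>M) + ennreal (C/m))
        \<longlonglongrightarrow> (\<integral>\<^sup>+\<omega>. ennreal (min (Y \<omega>) m) \<partial>M) + ennreal (C/m)"
      by (intro tendsto_add tendsto_const)
    moreover have "L \<le> (\<integral>\<^sup>+\<omega>. ennreal (min (X k \<omega>) m) \<partial>M) + ennreal (C/m)" for k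
    proof -
      have pt: "x \<le> min x m + x\<^sup>2 / m" if "x \<ge> 0" for x
      proof (cases "x \<le> m")
        case False
        then have "x * m \<le> x\<^sup>2" using that m by (simp add: power2_eq_square mult_left_mono)
        then have "x \<le> x\<^sup>2 / m" using m by (simp add: field_simps)
        then show ?thesis using False m by simp
      qed (use m in simp)
      have "L = (\<integral>\<^sup>+\<omega>. X k \<omega> \<partial>M)" by (simp add: L)
      also have "\<dots> \<le> (\<integral>\<^sup>+\<omega>. ennreal (min (X k \<omega>) m) + ennreal (1/m) * ennreal ((X k \<omega>)\<^sup>2) \<partial>M)"
        by (intro nn_integral_mono) (use m nonneg pt in \<open>auto simp flip: ennreal_plus ennreal_mult intro!: ennreal_leI\<close>)
      also have "\<dots> = (\<integral>\<^sup>+\<omega>. ennreal (min (X k \<omega>) m) \<partial>M) + ennreal (1/m) * (\<integral>\<^sup>+\<omega>. ennreal ((X k \<omega>)\<^sup>2) \<partial>M)"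
        by (subst nn_integral_add) (auto simp: nn_integral_cmult)
      also have "\<dots> \<le> (\<integral>\<^sup>+\<omega>. ennreal (min (X k \<omega>) m) \<partial>M) + ennreal (1/m) * ennreal C"
        by (intro add_left_mono mult_left_mono C) simp
      also have "ennreal (1/m) * ennreal C = ennreal (C/m)"
        using m C(1) by (subst ennreal_mult[symmetric]) auto
      finally show ?thesis .
    qed
    ultimately have "L \<le> (\<integral>\<^sup>+\<omega>. ennreal (min (Y \<omega>) m) \<partial>M) + ennreal (C/m)"
      by (intro LIMSEQ_le_const) auto
    also have "\<dots> \<le> (\<integral>\<^sup>+\<omega>. Y \<omega> \<partial>M) + ennreal (C/m)"
      by (intro add_right_mono nn_integral_mono ennreal_leI) auto
    finally show ?thesis .
  qed
  note * = this
  have "L \<le> (\<integral>\<^sup>+\<omega>. Y \<omega> \<partial>M) + ennreal e" if "e > 0" for e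
  proof (cases "C = 0")
    case True
    with *[of 1] show ?thesis by (simp add: add_increasing2)
  next
    case False
    with C that *[of "C/e"] show ?thesis by simp
  qed
  then show "L \<le> (\<integral>\<^sup>+\<omega>. Y \<omega> \<partial>M)" by (blast intro: ennreal_le_epsilon)
qed

subsection \<open>Stochastic exponentials of simple integrands\<close>

text \<open>Completing the square: the exponential weight tilts the centred normal density of
  variance v into the one with mean \<open>\<eta> * v\<close> and the same variance.\<close>

lemma nn_integral_exp_shifted_normal:
  assumes "0 < v"
  shows "(\<integral>\<^sup>+x. ennreal (exp (\<eta> * x - \<eta>\<^sup>2 * v / 2)) * ennreal (normal_density 0 (sqrt v) x) \<partial>lborel) = 1"
proof -
  have "exp (\<eta> * x - \<eta>\<^sup>2 * v / 2) * normal_density 0 (sqrt v) x = normal_density (\<eta> * v) (sqrt v) x" for x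
  proof -
    have "\<eta> * x - \<eta>\<^sup>2 * v / 2 + - x\<^sup>2 / (2 * v) = - (x - \<eta> * v)\<^sup>2 / (2 * v)"
      using assms by (simp add: field_simps power2_eq_square)
    then show ?thesis
      using assms unfolding normal_density_def mult.left_commute[of "exp _"] exp_add[symmetric] by simp
  qed
  then have "(\<integral>\<^sup>+x. ennreal (exp (\<eta> * x - \<eta>\<^sup>2 * v / 2)) * ennreal (normal_density 0 (sqrt v) x) \<partial>lborel)
      = (\<integral>\<^sup>+x. ennreal (normal_density (\<eta> * v) (sqrt v) x) \<partial>lborel)"
    by (simp flip: ennreal_mult)
  also have "\<dots> = 1" using assms by (simp add: nn_integral_eq_integral)
  finally show ?thesis .
qed

locale brownian_space =
  fixes M :: "'a measure" and F :: "real \<Rightarrow> 'a measure" and Z :: "real \<Rightarrow> 'a \<Rightarrow> real"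
  assumes filtered: "filtered_prob_space M F"
    and brownian: "standard_brownian_motion M F Z"

sublocale brownian_space \<subseteq> prob_space M
  using filtered unfolding filtered_prob_space_def by blast

context brownian_space
begin

lemma space_F [simp]: "space (F t) = space M"
  using filtered unfolding filtered_prob_space_def subalgebra_def by blast

lemma measurable_F: "f \<in> measurable (F t) N \<Longrightarrow> f \<in> measurable M N"
  using filtered unfolding filtered_prob_space_def by (blast intro: measurable_from_subalg)

lemma F_mono:
  assumes "s \<le> t" "f \<in> measurable (F s) N" shows "f \<in> measurable (F t) N"
proof -
  have "subalgebra (F t) (F s)"
    using filtered assms(1) filtration.sets_F_mono[of "space M" F s t]
    unfolding subalgebra_def filtered_prob_space_def by auto
  then show ?thesis using assms(2) by (rule measurable_from_subalg)
qed

lemma Z_measurable: "0 \<le> t \<Longrightarrow> Z t \<in> borel_measurable (F t)"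
  using brownian unfolding standard_brownian_motion_def adapted_def by blast

text \<open>Independence as a product law, with the identity map into \<open>F s\<close> as the
  random element that carries all information up to time s. In this form functions of the past and
  of the increment can be integrated by Tonelli.\<close>

lemma increment_indep:
  assumes "0 \<le> s" "s < t"
  shows "distr M (F s) (\<lambda>\<omega>. \<omega>) \<Otimes>\<^sub>M distr M borel (\<lambda>\<omega>. Z t \<omega> - Z s \<omega>)
    = distr M (F s \<Otimes>\<^sub>M borel) (\<lambda>\<omega>. (\<omega>, Z t \<omega> - Z s \<omega>))"
proof -
  let ?X = "\<lambda>\<omega>. Z t \<omega> - Z s \<omega>"
  have d: "distributed M lborel ?X (normal_density 0 (sqrt (t - s)))"
    and i: "indep_set (sets (F s)) {?X -` B \<inter> space M | B. B \<in> sets borel}"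
    using brownian assms unfolding standard_brownian_motion_def by blast+
  have rv [measurable]: "random_variable borel ?X" using distributed_measurable[OF d] by simp
  have id [measurable]: "(\<lambda>\<omega>. \<omega>) \<in> measurable M (F s)" by (rule measurable_F[of _ s]) simp
  interpret X: prob_space "distr M borel ?X" by (rule prob_space_distr) simp
  interpret I: prob_space "distr M (F s) (\<lambda>\<omega>. \<omega>)" by (rule prob_space_distr) simp
  show ?thesis
  proof (rule pair_measure_eqI)
    fix A B assume "A \<in> sets (distr M (F s) (\<lambda>\<omega>. \<omega>))" "B \<in> sets (distr M borel ?X)"
    then have A [measurable]: "A \<in> sets (F s)" and B [measurable]: "B \<in> sets borel" by auto
    have A': "A \<subseteq> space M" using sets.sets_into_space[OF A] by simp
    have "prob (A \<inter> (?X -` B \<inter> space M)) = prob A * prob (?X -` B \<inter> space M)"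
      using B by (intro indep_setD[OF i A]) blast
    then have "emeasure M (A \<inter> (?X -` B \<inter> space M)) = emeasure M A * emeasure M (?X -` B \<inter> space M)"
      by (simp add: emeasure_eq_measure ennreal_mult)
    moreover have "(\<lambda>\<omega>. (\<omega>, ?X \<omega>)) -` (A \<times> B) \<inter> space M = A \<inter> (?X -` B \<inter> space M)" using A' by auto
    ultimately show "emeasure (distr M (F s) (\<lambda>\<omega>. \<omega>)) A * emeasure (distr M borel ?X) B
        = emeasure (distr M (F s \<Otimes>\<^sub>M borel) (\<lambda>\<omega>. (\<omega>, ?X \<omega>))) (A \<times> B)"
      using A' by (simp add: emeasure_distr Int_absorb2)
  qed (auto intro: X.sigma_finite_measure_axioms I.sigma_finite_measure_axioms)
qed

text \<open>By \<open>increment_indep\<close> and Tonelli the increment is integrated out with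
  \<omega> frozen in \<open>W\<close> and \<open>\<eta>\<close>, and the inner Gaussian integral
  equals 1. The weight \<open>W\<close> holds whatever has been accumulated up to s, which makes the
  lemma iterable.\<close>

lemma exp_step:
  assumes st: "0 \<le> s" "s < t" and [measurable]: "W \<in> borel_measurable (F s)" "\<eta> \<in> borel_measurable (F s)"
  shows "(\<integral>\<^sup>+\<omega>. W \<omega> * ennreal (exp (\<eta> \<omega> * (Z t \<omega> - Z s \<omega>) - (\<eta> \<omega>)\<^sup>2 * (t - s) / 2)) \<partial>M)
    = (\<integral>\<^sup>+\<omega>. W \<omega> \<partial>M)"
proof -
  let ?X = "\<lambda>\<omega>. Z t \<omega> - Z s \<omega>"
  let ?h = "\<lambda>(w, x). W w * ennreal (exp (\<eta> w * x - (\<eta> w)\<^sup>2 * (t - s) / 2))"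
  have d: "distributed M lborel ?X (normal_density 0 (sqrt (t - s)))"
    using brownian st unfolding standard_brownian_motion_def by blast
  have rv [measurable]: "random_variable borel ?X" using distributed_measurable[OF d] by simp
  have id [measurable]: "(\<lambda>\<omega>. \<omega>) \<in> measurable M (F s)" by (rule measurable_F[of _ s]) simp
  have pr: "distr M (F s) (\<lambda>\<omega>. \<omega>) \<Otimes>\<^sub>M distr M borel ?X = distr M (F s \<Otimes>\<^sub>M borel) (\<lambda>\<omega>. (\<omega>, ?X \<omega>))"
    by (rule increment_indep[OF st])
  have dX: "distr M borel ?X = density lborel (normal_density 0 (sqrt (t - s)))"
  proof -
    have "distr M borel ?X = distr M lborel ?X" by (rule distr_cong) auto
    then show ?thesis using distributed_distr_eq_density[OF d] by simp
  qed
  interpret X: prob_space "distr M borel ?X" by (rule prob_space_distr) simp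
  interpret I: prob_space "distr M (F s) (\<lambda>\<omega>. \<omega>)" by (rule prob_space_distr) simp
  have "(\<integral>\<^sup>+\<omega>. W \<omega> * ennreal (exp (\<eta> \<omega> * ?X \<omega> - (\<eta> \<omega>)\<^sup>2 * (t - s) / 2)) \<partial>M)
      = (\<integral>\<^sup>+z. ?h z \<partial>distr M (F s \<Otimes>\<^sub>M borel) (\<lambda>\<omega>. (\<omega>, ?X \<omega>)))"
    by (subst nn_integral_distr) auto
  also have "\<dots> = (\<integral>\<^sup>+w. \<integral>\<^sup>+x. ?h (w, x) \<partial>distr M borel ?X \<partial>distr M (F s) (\<lambda>\<omega>. \<omega>))"
    unfolding pr[symmetric] by (subst X.nn_integral_fst[symmetric]) auto
  also have "\<dots> = (\<integral>\<^sup>+w. W w \<partial>distr M (F s) (\<lambda>\<omega>. \<omega>))"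
  proof (rule nn_integral_cong)
    fix w
    have "(\<integral>\<^sup>+x. ?h (w, x) \<partial>distr M borel ?X)
      = (\<integral>\<^sup>+x. W w * (ennreal (exp (\<eta> w * x - (\<eta> w)\<^sup>2 * (t - s) / 2)) * ennreal (normal_density 0 (sqrt (t - s)) x)) \<partial>lborel)"
      unfolding dX by (subst nn_integral_density) (auto simp: ac_simps)
    also have "\<dots> = W w" using st by (subst nn_integral_cmult) (auto simp: nn_integral_exp_shifted_normal)
    finally show "(\<integral>\<^sup>+x. ?h (w, x) \<partial>distr M borel ?X) = W w" .
  qed
  also have "\<dots> = (\<integral>\<^sup>+\<omega>. W \<omega> \<partial>M)" by (subst nn_integral_distr) auto
  finally show ?thesis .
qed

text \<open>\<open>S\<close> is the stochastic integral over [s,t] of a step process whose value on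
  a cell is known at its left end, and \<open>V\<close> is its quadratic variation. Only the pair of
  random variables is recorded, so the integrand may be rescaled, stopped or combined with another
  one behind it. The grid is strict because \<open>exp_step\<close> needs an increment of positive
  variance.\<close>

definition elementary :: "real \<Rightarrow> real \<Rightarrow> ('a \<Rightarrow> real) \<Rightarrow> ('a \<Rightarrow> real) \<Rightarrow> bool" where
  "elementary s t S V \<longleftrightarrow> 0 \<le> s \<and> (\<exists>n q \<eta>. q 0 = s \<and> q n = t \<and> (\<forall>j<n. q j < q (Suc j)) \<and>
     (\<forall>j<n. \<eta> j \<in> borel_measurable (F (q j))) \<and>
     S = (\<lambda>\<omega>. \<Sum>j<n. \<eta> j \<omega> * (Z (q (Suc j)) \<omega> - Z (q j) \<omega>)) \<and>
     V = (\<lambda>\<omega>. \<Sum>j<n. (\<eta> j \<omega>)\<^sup>2 * (q (Suc j) - q j)))"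

lemma grid_ge:
  assumes "\<forall>j<n. q j < q (Suc j)" "i \<le> j" "j \<le> n"
  shows "q i \<le> (q j :: real)"
  using assms(2,3)
proof (induction j rule: dec_induct)
  case (step k) with assms(1) show ?case by (smt (verit) Suc_le_lessD less_imp_le_nat)
qed simp

lemma grid_sums_measurable:
  assumes q: "0 \<le> q 0" "\<forall>j<n. q j < q (Suc j)" and \<eta>: "\<forall>j<n. \<eta> j \<in> borel_measurable (F (q j))" and m: "m \<le> n"
  shows "(\<lambda>\<omega>. \<Sum>j<m. \<eta> j \<omega> * (Z (q (Suc j)) \<omega> - Z (q j) \<omega>)) \<in> borel_measurable (F (q m))"
    "(\<lambda>\<omega>. \<Sum>j<m. (\<eta> j \<omega>)\<^sup>2 * (q (Suc j) - q j)) \<in> borel_measurable (F (q m))"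
proof -
  have a: "\<eta> j \<in> borel_measurable (F (q m))" if "j < m" for j
    using that m \<eta> grid_ge[OF q(2), of j m] by (intro F_mono[of "q j" "q m"]) auto
  have b: "Z (q j) \<in> borel_measurable (F (q m))" if "j \<le> m" for j
    using that m grid_ge[OF q(2), of j m] grid_ge[OF q(2), of 0 j] q(1)
    by (intro F_mono[of "q j" "q m"] Z_measurable) auto
  show "(\<lambda>\<omega>. \<Sum>j<m. \<eta> j \<omega> * (Z (q (Suc j)) \<omega> - Z (q j) \<omega>)) \<in> borel_measurable (F (q m))"
    by (intro borel_measurable_sum borel_measurable_times borel_measurable_diff a b) auto
  show "(\<lambda>\<omega>. \<Sum>j<m. (\<eta> j \<omega>)\<^sup>2 * (q (Suc j) - q j)) \<in> borel_measurable (F (q m))"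
    by (intro borel_measurable_sum borel_measurable_times borel_measurable_power a) auto
qed

lemma elementary_measurable:
  assumes "elementary s t S V"
  shows "S \<in> borel_measurable M" "V \<in> borel_measurable M"
  using assms grid_sums_measurable unfolding elementary_def by (blast intro: measurable_F)+

lemma elementary_nonneg: "elementary s t S V \<Longrightarrow> 0 \<le> V \<omega>"
  unfolding elementary_def by (auto intro!: sum_nonneg mult_nonneg_nonneg simp: less_imp_le)

lemma elementary_scale:
  assumes "elementary s t S V" shows "elementary s t (\<lambda>\<omega>. b * S \<omega>) (\<lambda>\<omega>. b\<^sup>2 * V \<omega>)"
proof -
  from assms obtain n q \<eta> where *: "0 \<le> s" "q 0 = s" "q n = t" "\<forall>j<n. q j < q (Suc j)"
    "\<forall>j<n. \<eta> j \<in> borel_measurable (F (q j))"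
    "S = (\<lambda>\<omega>. \<Sum>j<n. \<eta> j \<omega> * (Z (q (Suc j)) \<omega> - Z (q j) \<omega>))"
    "V = (\<lambda>\<omega>. \<Sum>j<n. (\<eta> j \<omega>)\<^sup>2 * (q (Suc j) - q j))"
    unfolding elementary_def by auto
  show ?thesis
    unfolding elementary_def
    by (intro conjI exI[of _ n] exI[of _ q] exI[of _ "\<lambda>j \<omega>. b * \<eta> j \<omega>"])
      (use * in \<open>auto simp: sum_distrib_left power_mult_distrib mult.assoc\<close>)
qed

text \<open>The last step is peeled off with \<open>exp_step\<close>: \<open>Y\<close> times the
  exponential of the earlier steps is known at the left end of that step and serves as its
  weight.\<close>

lemma elementary_exp:
  assumes "elementary s t S V" and Y: "Y \<in> borel_measurable (F s)"
  shows "(\<integral>\<^sup>+\<omega>. Y \<omega> * ennreal (exp (S \<omega> - V \<omega> / 2)) \<partial>M) = (\<integral>\<^sup>+\<omega>. Y \<omega> \<partial>M)"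
proof -
  from assms(1) obtain n q \<eta> where *: "0 \<le> s" "q 0 = s" "q n = t" "\<forall>j<n. q j < q (Suc j)"
    "\<forall>j<n. \<eta> j \<in> borel_measurable (F (q j))"
    "S = (\<lambda>\<omega>. \<Sum>j<n. \<eta> j \<omega> * (Z (q (Suc j)) \<omega> - Z (q j) \<omega>))"
    "V = (\<lambda>\<omega>. \<Sum>j<n. (\<eta> j \<omega>)\<^sup>2 * (q (Suc j) - q j))"
    unfolding elementary_def by auto
  define S' where "S' m \<omega> = (\<Sum>j<m. \<eta> j \<omega> * (Z (q (Suc j)) \<omega> - Z (q j) \<omega>))" for m \<omega>
  define V' where "V' m \<omega> = (\<Sum>j<m. (\<eta> j \<omega>)\<^sup>2 * (q (Suc j) - q j))" for m \<omega>
  have "(\<integral>\<^sup>+\<omega>. Y \<omega> * ennreal (exp (S' m \<omega> - V' m \<omega> / 2)) \<partial>M) = (\<integral>\<^sup>+\<omega>. Y \<omega> \<partial>M)" if "m \<le> n" for m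
    using that
  proof (induction m)
    case 0 show ?case by (simp add: S'_def V'_def)
  next
    case (Suc m)
    have [measurable]: "S' m \<in> borel_measurable (F (q m))" "V' m \<in> borel_measurable (F (q m))"
      using grid_sums_measurable[of q n \<eta> m] * Suc.prems unfolding S'_def V'_def by auto
    have [measurable]: "\<eta> m \<in> borel_measurable (F (q m))" using * Suc.prems by auto
    have [measurable]: "Y \<in> borel_measurable (F (q m))"
      using * Suc.prems Y grid_ge[OF *(4), of 0 m] by (intro F_mono[of s "q m"]) auto
    have "exp (S' (Suc m) \<omega> - V' (Suc m) \<omega> / 2) = exp (S' m \<omega> - V' m \<omega> / 2) *
        exp (\<eta> m \<omega> * (Z (q (Suc m)) \<omega> - Z (q m) \<omega>) - (\<eta> m \<omega>)\<^sup>2 * (q (Suc m) - q m) / 2)" for \<omega>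
      by (simp add: S'_def V'_def exp_add[symmetric] algebra_simps add_divide_distrib diff_divide_distrib)
    then have "(\<integral>\<^sup>+\<omega>. Y \<omega> * ennreal (exp (S' (Suc m) \<omega> - V' (Suc m) \<omega> / 2)) \<partial>M) =
       (\<integral>\<^sup>+\<omega>. (Y \<omega> * ennreal (exp (S' m \<omega> - V' m \<omega> / 2))) *
        ennreal (exp (\<eta> m \<omega> * (Z (q (Suc m)) \<omega> - Z (q m) \<omega>) - (\<eta> m \<omega>)\<^sup>2 * (q (Suc m) - q m) / 2)) \<partial>M)"
      by (simp add: ennreal_mult mult.assoc)
    also have "\<dots> = (\<integral>\<^sup>+\<omega>. Y \<omega> * ennreal (exp (S' m \<omega> - V' m \<omega> / 2)) \<partial>M)"
      using * Suc.prems grid_ge[OF *(4), of 0 m] by (intro exp_step) auto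
    finally show ?case using Suc by simp
  qed
  from this[of n] show ?thesis by (simp add: * S'_def V'_def)
qed

text \<open>The growth of V over a step is known at the left end of the step, so stopping just before V
  would exceed c is adapted and bounds V by c without overshoot.\<close>

lemma elementary_truncate:
  assumes "elementary s t S V" and c: "0 \<le> c"
  shows "\<exists>S' V'. elementary s t S' V' \<and> (\<forall>\<omega>. V' \<omega> \<le> c \<and> V' \<omega> \<le> V \<omega> \<and> (V \<omega> \<le> c \<longrightarrow> S' \<omega> = S \<omega> \<and> V' \<omega> = V \<omega>))"
proof -
  from assms(1) obtain n q \<eta> where *: "0 \<le> s" "q 0 = s" "q n = t" "\<forall>j<n. q j < q (Suc j)"
    "\<forall>j<n. \<eta> j \<in> borel_measurable (F (q j))"
    "S = (\<lambda>\<omega>. \<Sum>j<n. \<eta> j \<omega> * (Z (q (Suc j)) \<omega> - Z (q j) \<omega>))"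
    "V = (\<lambda>\<omega>. \<Sum>j<n. (\<eta> j \<omega>)\<^sup>2 * (q (Suc j) - q j))"
    unfolding elementary_def by auto
  define W where "W m \<omega> = (\<Sum>j<m. (\<eta> j \<omega>)\<^sup>2 * (q (Suc j) - q j))" for m \<omega>
  define \<zeta> where "\<zeta> j \<omega> = (if W (Suc j) \<omega> \<le> c then \<eta> j \<omega> else 0)" for j \<omega>
  define V' where "V' m \<omega> = (\<Sum>j<m. (\<zeta> j \<omega>)\<^sup>2 * (q (Suc j) - q j))" for m \<omega>
  have W_mono: "W i \<omega> \<le> W j \<omega>" if "i \<le> j" "j \<le> n" for i j \<omega>
    unfolding W_def using that *(4) by (intro sum_mono2) (auto intro!: mult_nonneg_nonneg simp: less_imp_le)
  have meas: "\<zeta> j \<in> borel_measurable (F (q j))" if "j < n" for j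
  proof -
    have [measurable]: "W j \<in> borel_measurable (F (q j))" "\<eta> j \<in> borel_measurable (F (q j))"
      using grid_sums_measurable[of q n \<eta> j] * that unfolding W_def by auto
    have "W (Suc j) = (\<lambda>\<omega>. W j \<omega> + (\<eta> j \<omega>)\<^sup>2 * (q (Suc j) - q j))" by (auto simp: W_def)
    then have [measurable]: "W (Suc j) \<in> borel_measurable (F (q j))" by simp
    show ?thesis unfolding \<zeta>_def[abs_def] by measurable
  qed
  have le: "(W m \<omega> \<le> c \<longrightarrow> V' m \<omega> = W m \<omega>) \<and> V' m \<omega> \<le> c" if "m \<le> n" for m \<omega>
    using that
  proof (induction m)
    case 0 show ?case using c by (simp add: V'_def W_def)
  next
    case (Suc m)
    have V: "V' (Suc m) \<omega> = V' m \<omega> + (\<zeta> m \<omega>)\<^sup>2 * (q (Suc m) - q m)" by (simp add: V'_def)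
    have W: "W (Suc m) \<omega> = W m \<omega> + (\<eta> m \<omega>)\<^sup>2 * (q (Suc m) - q m)" by (simp add: W_def)
    show ?case
    proof (cases "W (Suc m) \<omega> \<le> c")
      case True
      with W_mono[of m "Suc m" \<omega>] Suc have "V' m \<omega> = W m \<omega>" by auto
      with True show ?thesis by (simp add: V W \<zeta>_def)
    next
      case False with Suc show ?thesis by (simp add: V \<zeta>_def)
    qed
  qed
  have "V' n \<omega> \<le> V \<omega>" for \<omega>
    unfolding V'_def *(7) \<zeta>_def using *(4) by (intro sum_mono) (auto intro!: mult_right_mono mult_nonneg_nonneg simp: less_imp_le)
  moreover have "(\<Sum>j<n. \<zeta> j \<omega> * (Z (q (Suc j)) \<omega> - Z (q j) \<omega>)) = S \<omega>" if "V \<omega> \<le> c" for \<omega>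
  proof -
    have "W (Suc j) \<omega> \<le> c" if "j < n" for j
      using W_mono[of "Suc j" n \<omega>] that \<open>V \<omega> \<le> c\<close> by (simp add: *(7) W_def[of n])
    then show ?thesis unfolding *(6) \<zeta>_def by (intro sum.cong) auto
  qed
  moreover have "elementary s t (\<lambda>\<omega>. \<Sum>j<n. \<zeta> j \<omega> * (Z (q (Suc j)) \<omega> - Z (q j) \<omega>)) (V' n)"
    unfolding elementary_def
    by (intro conjI exI[of _ n] exI[of _ q] exI[of _ \<zeta>]) (use * meas in \<open>auto simp: V'_def\<close>)
  moreover have "W n = V" by (simp add: W_def[abs_def] *(7))
  ultimately show ?thesis
    using le[of n] by (intro exI[of _ "\<lambda>\<omega>. \<Sum>j<n. \<zeta> j \<omega> * (Z (q (Suc j)) \<omega> - Z (q j) \<omega>)"] exI[of _ "V' n"]) auto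
qed

end

section \<open>Common refinements of the partitions of simple integrands\<close>

lemma exists_grid:
  fixes s t :: real
  assumes "finite C" "s < t"
  shows "\<exists>n q. q 0 = s \<and> q n = t \<and> (\<forall>j<n. q j < q (Suc j)) \<and> C \<inter> {s..t} \<subseteq> q ` {..n}"
proof -
  define P where "P = insert s (insert t (C \<inter> {s..t}))"
  define xs where "xs = sorted_list_of_set P"
  have fin: "finite P" using assms by (simp add: P_def)
  have set: "set xs = P" and srt: "sorted_wrt (<) xs"
    using fin unfolding xs_def by simp_all
  have ne: "xs \<noteq> []" using set by (auto simp: P_def)
  define n where "n = length xs - 1"
  have len: "length xs = Suc n" using ne by (simp add: n_def)
  have lt: "xs ! i < xs ! j" if "i < j" "j \<le> n" for i j
    using sorted_wrt_nth_less[OF srt] that len by auto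
  have mem: "xs ! i \<in> P" if "i \<le> n" for i using set len that nth_mem[of i xs] by auto
  have bd: "s \<le> x" "x \<le> t" if "x \<in> P" for x using that assms by (auto simp: P_def)
  have ex: "\<exists>i\<le>n. xs ! i = x" if "x \<in> P" for x
    using that set len by (metis in_set_conv_nth less_Suc_eq_le)
  obtain i where i: "i \<le> n" "xs ! i = s" using ex[of s] by (auto simp: P_def)
  have "xs ! 0 = s"
    using lt[of 0 i] i bd(1)[OF mem[of 0]] by (cases "i = 0") auto
  moreover obtain k where k: "k \<le> n" "xs ! k = t" using ex[of t] by (auto simp: P_def)
  have "xs ! n = t"
    using lt[of k n] k bd(2)[OF mem[of n]] by (cases "k = n") auto
  moreover have "C \<inter> {s..t} \<subseteq> (\<lambda>i. xs ! i) ` {..n}"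
    using ex unfolding P_def by (fastforce simp: image_iff)
  ultimately show ?thesis using lt by (intro exI[of _ n] exI[of _ "\<lambda>i. xs ! i"]) auto
qed

lemma grid_less:
  assumes "\<forall>j<n. q j < q (Suc j)" "i < j" "j \<le> n"
  shows "q i < (q j :: real)"
  using assms(2,3)
proof (induction j)
  case 0 then show ?case by simp
next
  case (Suc k)
  with assms(1) have "q k < q (Suc k)" by auto
  with Suc show ?case by (cases "i = k") auto
qed

text \<open>A breakpoint within the range of the grid is a grid point, hence not interior to a cell;
  a breakpoint outside the range lies on one side of every cell.\<close>

lemma grid_dichotomy:
  fixes q :: "nat \<Rightarrow> real"
  assumes q: "\<forall>j<n. q j < q (Suc j)" and x: "x \<in> {q 0..q n} \<Longrightarrow> x \<in> q ` {..n}" and j: "j < n"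
  shows "x \<le> q j \<or> q (Suc j) \<le> x"
proof (rule ccontr)
  assume "\<not> ?thesis"
  then have a: "q j < x" "x < q (Suc j)" by auto
  have "q 0 \<le> q j" "q (Suc j) \<le> q n" using grid_less[OF q, of 0 j] grid_less[OF q, of "Suc j" n] j
    by (cases "j = 0"; cases "Suc j = n"; auto)+
  with a x obtain i where i: "i \<le> n" "x = q i" by fastforce
  show False
  proof (cases "i \<le> j")
    case True then show ?thesis using grid_less[OF q, of i j] a i j by (cases "i = j") auto
  next
    case False then show ?thesis using grid_less[OF q, of "Suc j" i] a i by (cases "i = Suc j") auto
  qed
qed

text \<open>Cutting off at r on the fine grid reproduces the clipped values
  \<open>Z (min r t)\<close> that occur in \<open>simple_ito_integral\<close>. The cases r beyond
  the grid, before it and on it correspond to a full, an empty and a partial telescope.\<close>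

lemma grid_telescope:
  fixes q :: "nat \<Rightarrow> real" and z :: "real \<Rightarrow> real"
  assumes q: "\<forall>j<n. q j < q (Suc j)" and r: "r \<in> {q 0..q n} \<Longrightarrow> r \<in> q ` {..n}"
  shows "(\<Sum>j<n. if q (Suc j) \<le> r then z (q (Suc j)) - z (q j) else 0) = z (min r (q n)) - z (min r (q 0))"
proof -
  have le: "q i \<le> q j" if "i \<le> j" "j \<le> n" for i j
    using grid_less[OF q, of i j] that by (cases "i = j") auto
  consider "r > q n" | "r < q 0" | "r \<in> {q 0..q n}" by fastforce
  then show ?thesis
  proof cases
    case 1
    have "(\<Sum>j<n. if q (Suc j) \<le> r then z (q (Suc j)) - z (q j) else 0) = (\<Sum>j<n. z (q (Suc j)) - z (q j))"
    proof (intro sum.cong refl)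
      fix j assume "j \<in> {..<n}"
      then show "(if q (Suc j) \<le> r then z (q (Suc j)) - z (q j) else 0) = z (q (Suc j)) - z (q j)"
        using 1 le[of "Suc j" n] by auto
    qed
    also have "\<dots> = z (q n) - z (q 0)" by (rule sum_lessThan_telescope)
    finally show ?thesis using 1 le[of 0 n] by (simp add: min_def)
  next
    case 2
    have "(\<Sum>j<n. if q (Suc j) \<le> r then z (q (Suc j)) - z (q j) else 0) = 0"
    proof (intro sum.neutral ballI)
      fix j assume "j \<in> {..<n}"
      then show "(if q (Suc j) \<le> r then z (q (Suc j)) - z (q j) else 0) = 0"
        using 2 le[of 0 "Suc j"] by auto
    qed
    then show ?thesis using 2 le[of 0 n] by (simp add: min_def)
  next
    case 3
    then obtain m where m: "m \<le> n" "r = q m" using r by auto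
    have *: "q (Suc j) \<le> q m \<longleftrightarrow> j < m" if "j < n" for j
      using le[of "Suc j" m] grid_less[OF q, of m "Suc j"] that m by (cases "j < m") auto
    have "(\<Sum>j<n. if q (Suc j) \<le> r then z (q (Suc j)) - z (q j) else 0)
        = (\<Sum>j<n. if j < m then z (q (Suc j)) - z (q j) else 0)"
      using * m by (intro sum.cong) auto
    also have "\<dots> = (\<Sum>j | j < n \<and> j < m. z (q (Suc j)) - z (q j))"
      by (subst sum.inter_filter[symmetric]) auto
    also have "{j. j < n \<and> j < m} = {..<m}" using m by auto
    also have "(\<Sum>j<m. z (q (Suc j)) - z (q j)) = z (q m) - z (q 0)" by (rule sum_lessThan_telescope)
    finally show ?thesis using 3 m by (simp add: min_absorb1 min_absorb2)
  qed
qed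

lemma step_integral:
  fixes q :: "nat \<Rightarrow> real" and x :: "real \<Rightarrow> real"
  assumes q: "\<forall>j<n. q j < q (Suc j)" and x: "\<And>j u. j < n \<Longrightarrow> q j < u \<Longrightarrow> u \<le> q (Suc j) \<Longrightarrow> x u = y j"
    and [measurable]: "x \<in> borel_measurable borel"
  shows "(LBINT u:{q 0..q n}. x u) = (\<Sum>j<n. y j * (q (Suc j) - q j))"
proof -
  have le: "q 0 \<le> q m" if "m \<le> n" for m
    using grid_less[OF q, of 0 m] that by (cases "m = 0") auto
  have eq: "(\<Sum>j<m. y j * indicator {q j<..q (Suc j)} u) = indicator {q 0<..q m} u * x u" if "m \<le> n" for m u
    using that
  proof (induction m)
    case (Suc m)
    have "q m < q (Suc m)" "q 0 \<le> q m" using q Suc.prems le[of m] by auto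
    then show ?case using Suc x[of m u] by (auto simp: indicator_def)
  qed simp
  have int: "has_bochner_integral lborel (\<lambda>u. y j * indicator {q j<..q (Suc j)} u) (y j * (q (Suc j) - q j))" if "j < n" for j
    using q that by (intro has_bochner_integral_mult_right has_bochner_integral_real_indicator[THEN has_bochner_integral_cong[THEN iffD1, rotated -1]])
      (auto simp: measure_def less_imp_le)
  have "has_bochner_integral lborel (\<lambda>u. \<Sum>j<n. y j * indicator {q j<..q (Suc j)} u) (\<Sum>j<n. y j * (q (Suc j) - q j))"
    by (intro has_bochner_integral_sum int) auto
  then have "(\<integral>u. indicator {q 0<..q n} u * x u \<partial>lborel) = (\<Sum>j<n. y j * (q (Suc j) - q j))"
    using eq[of n] by (simp add: has_bochner_integral_integral_eq)
  moreover have "(LBINT u:{q 0..q n}. x u) = (\<integral>u. indicator {q 0<..q n} u * x u \<partial>lborel)"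
    unfolding set_lebesgue_integral_def
  proof (rule integral_cong_AE)
    \<comment> \<open>Cells are open on the left, so the closed interval has one extra point, a null
      set.\<close>
    have "AE u in lborel. u \<noteq> q 0" by (rule AE_lborel_singleton)
    then show "AE u in lborel. indicat_real {q 0..q n} u *\<^sub>R x u = indicat_real {q 0<..q n} u * x u"
      by eventually_elim (auto simp: indicator_def)
  qed auto
  ultimately show ?thesis by simp
qed

lemma simple_process_measurable [measurable]:
  "(\<lambda>u. simple_process m p \<xi> u \<omega>) \<in> borel_measurable borel"
  unfolding simple_process_def by measurable

text \<open>Since \<open>simple_process\<close> lives on half-open intervals that are closed on the
  right, the right end of a cell represents the whole cell once no breakpoint is interior to
  it.\<close>

lemma simple_process_grid:
  fixes q :: "nat \<Rightarrow> real"
  assumes q: "\<forall>j<n. q j < q (Suc j)" and p: "p ` {..m} \<inter> {q 0..q n} \<subseteq> q ` {..n}"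
    and j: "j < n" and u: "q j < u" "u \<le> q (Suc j)"
  shows "simple_process m p \<xi> u \<omega> = simple_process m p \<xi> (q (Suc j)) \<omega>"
proof -
  have "p i \<le> q j \<or> q (Suc j) \<le> p i" if "i \<le> m" for i
    by (rule grid_dichotomy[OF q _ j]) (use p that in auto)
  then have "p i < u \<longleftrightarrow> p i < q (Suc j)" "u \<le> p i \<longleftrightarrow> q (Suc j) \<le> p i" if "i \<le> m" for i
    using that u by (smt (verit))+
  then show ?thesis unfolding simple_process_def
    by (intro sum.cong refl arg_cong2[where f = "(*)"]) (auto simp: indicator_def)
qed

lemma simple_ito_integral_grid:
  fixes q :: "nat \<Rightarrow> real"
  assumes q: "\<forall>j<n. q j < q (Suc j)" and p: "p ` {..m} \<inter> {q 0..q n} \<subseteq> q ` {..n}"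
    and mono: "\<forall>i<m. p i \<le> p (Suc i)"
  shows "simple_ito_integral Z m p \<xi> (q n) \<omega> - simple_ito_integral Z m p \<xi> (q 0) \<omega> =
    (\<Sum>j<n. simple_process m p \<xi> (q (Suc j)) \<omega> * (Z (q (Suc j)) \<omega> - Z (q j) \<omega>))"
proof -
  let ?z = "\<lambda>u. Z u \<omega>"
  have tel: "(\<Sum>j<n. if q (Suc j) \<le> p i then ?z (q (Suc j)) - ?z (q j) else 0) = ?z (min (p i) (q n)) - ?z (min (p i) (q 0))"
    if "i \<le> m" for i
    by (rule grid_telescope[OF q]) (use p that in auto)
  have "(\<Sum>j<n. simple_process m p \<xi> (q (Suc j)) \<omega> * (?z (q (Suc j)) - ?z (q j)))
      = (\<Sum>i<m. \<xi> i \<omega> * (\<Sum>j<n. indicator {p i<..p (Suc i)} (q (Suc j)) * (?z (q (Suc j)) - ?z (q j))))"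
    unfolding simple_process_def sum_distrib_right sum_distrib_left mult.assoc by (rule sum.swap)
  also have "\<dots> = (\<Sum>i<m. \<xi> i \<omega> * ((?z (min (p (Suc i)) (q n)) - ?z (min (p (Suc i)) (q 0))) -
      (?z (min (p i) (q n)) - ?z (min (p i) (q 0)))))"
  proof (intro sum.cong refl arg_cong2[where f = "(*)"])
    fix i assume "i \<in> {..<m}"
    then have i: "i < m" by simp
    \<comment> \<open>The indicator of a half-open interval is the difference of the cutoffs at its
      two ends, and \<open>grid_telescope\<close> evaluates each of them.\<close>
    have "(\<Sum>j<n. indicator {p i<..p (Suc i)} (q (Suc j)) * (?z (q (Suc j)) - ?z (q j)))
      = (\<Sum>j<n. (if q (Suc j) \<le> p (Suc i) then ?z (q (Suc j)) - ?z (q j) else 0) -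
          (if q (Suc j) \<le> p i then ?z (q (Suc j)) - ?z (q j) else 0))"
      using mono i by (intro sum.cong refl) (force simp: indicator_def)
    also have "\<dots> = (?z (min (p (Suc i)) (q n)) - ?z (min (p (Suc i)) (q 0))) -
      (?z (min (p i) (q n)) - ?z (min (p i) (q 0)))"
      unfolding sum_subtractf using i by (simp add: tel)
    finally show "(\<Sum>j<n. indicator {p i<..p (Suc i)} (q (Suc j)) * (?z (q (Suc j)) - ?z (q j))) = \<dots>" .
  qed
  also have "\<dots> = simple_ito_integral Z m p \<xi> (q n) \<omega> - simple_ito_integral Z m p \<xi> (q 0) \<omega>"
    unfolding simple_ito_integral_def sum_subtractf[symmetric] by (intro sum.cong refl) (simp add: algebra_simps)
  finally show ?thesis by simp
qed

lemma simple_ito_integral_0: "simple_integrand M F m p \<xi> \<Longrightarrow> simple_ito_integral Z m p \<xi> 0 \<omega> = 0"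
proof -
  assume *: "simple_integrand M F m p \<xi>"
  have "0 \<le> p i" if "i \<le> m" for i
    using that
  proof (induction i)
    case 0 then show ?case using * by (simp add: simple_integrand_def)
  next
    case (Suc i)
    then have "p i \<le> p (Suc i)" using * by (simp add: simple_integrand_def)
    with Suc show ?case by simp
  qed
  then have "min (p i) 0 = 0" if "i \<le> m" for i using that by (simp add: min_absorb2)
  then show ?thesis unfolding simple_ito_integral_def by (intro sum.neutral) simp
qed

section \<open>Simple integrals as elementary pairs, and limits of their exponentials\<close>

context brownian_space
begin

text \<open>A weight that starts at or before the left end of the cell is already known there; one
  that starts later starts at or after the right end, and its indicator vanishes at that right
  end.\<close>

lemma simple_process_adapted:
  fixes q :: "nat \<Rightarrow> real"
  assumes si: "simple_integrand M F m p \<xi>"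
    and q: "\<forall>j<n. q j < q (Suc j)" and p: "p ` {..m} \<inter> {q 0..q n} \<subseteq> q ` {..n}"
    and j: "j < n"
  shows "simple_process m p \<xi> (q (Suc j)) \<in> borel_measurable (F (q j))"
  unfolding simple_process_def
proof (rule borel_measurable_sum)
  fix i assume "i \<in> {..<m}"
  then have i: "i < m" by simp
  have "p i \<le> q j \<or> q (Suc j) \<le> p i"
    by (rule grid_dichotomy[OF q _ j]) (use p i in auto)
  then show "(\<lambda>\<omega>. \<xi> i \<omega> * indicat_real {p i<..p (Suc i)} (q (Suc j))) \<in> borel_measurable (F (q j))"
  proof
    assume "p i \<le> q j"
    moreover have "\<xi> i \<in> borel_measurable (F (p i))" using si i unfolding simple_integrand_def by blast
    ultimately have "\<xi> i \<in> borel_measurable (F (q j))" by (rule F_mono)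
    then show ?thesis by simp
  qed simp
qed

text \<open>Two integrands are treated on a common refinement because the lemma has two uses: with
  \<open>c' = 0\<close> for a multiple of a single integral, and with coefficients 1 and -1 to
  compare two approximating sequences.\<close>

lemma simple_pair_elementary:
  assumes si: "simple_integrand M F m p \<xi>" and si': "simple_integrand M F m' p' \<xi>'"
    and st: "0 \<le> s" "s < t"
  shows "elementary s t
     (\<lambda>\<omega>. c * (simple_ito_integral Z m p \<xi> t \<omega> - simple_ito_integral Z m p \<xi> s \<omega>) +
          c' * (simple_ito_integral Z m' p' \<xi>' t \<omega> - simple_ito_integral Z m' p' \<xi>' s \<omega>))
     (\<lambda>\<omega>. LBINT u:{s..t}. (c * simple_process m p \<xi> u \<omega> + c' * simple_process m' p' \<xi>' u \<omega>)\<^sup>2)"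
proof -
  obtain n q where q0: "q 0 = s" "q n = t" and q: "\<forall>j<n. q j < q (Suc j)"
    and sub: "(p ` {..m} \<union> p' ` {..m'}) \<inter> {s..t} \<subseteq> q ` {..n}"
    using exists_grid[of "p ` {..m} \<union> p' ` {..m'}" s t] st by auto
  have p: "p ` {..m} \<inter> {q 0..q n} \<subseteq> q ` {..n}" and p': "p' ` {..m'} \<inter> {q 0..q n} \<subseteq> q ` {..n}"
    using sub q0 by auto
  define \<eta> where "\<eta> j \<omega> = c * simple_process m p \<xi> (q (Suc j)) \<omega> + c' * simple_process m' p' \<xi>' (q (Suc j)) \<omega>" for j \<omega>
  have "\<eta> j \<in> borel_measurable (F (q j))" if "j < n" for j
    using simple_process_adapted[OF si q p that] simple_process_adapted[OF si' q p' that]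
    unfolding \<eta>_def[abs_def] by simp
  moreover have "c * (simple_ito_integral Z m p \<xi> t \<omega> - simple_ito_integral Z m p \<xi> s \<omega>) +
          c' * (simple_ito_integral Z m' p' \<xi>' t \<omega> - simple_ito_integral Z m' p' \<xi>' s \<omega>) =
      (\<Sum>j<n. \<eta> j \<omega> * (Z (q (Suc j)) \<omega> - Z (q j) \<omega>))" for \<omega>
  proof -
    have mono: "\<forall>i<m. p i \<le> p (Suc i)" "\<forall>i<m'. p' i \<le> p' (Suc i)"
      using si si' unfolding simple_integrand_def by auto
    show ?thesis
      unfolding \<eta>_def simple_ito_integral_grid[OF q p mono(1), of Z \<xi> \<omega>, unfolded q0]
        simple_ito_integral_grid[OF q p' mono(2), of Z \<xi>' \<omega>, unfolded q0] sum_distrib_left sum.distrib[symmetric]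
      by (intro sum.cong refl) (simp add: algebra_simps)
  qed
  moreover have "(LBINT u:{s..t}. (c * simple_process m p \<xi> u \<omega> + c' * simple_process m' p' \<xi>' u \<omega>)\<^sup>2) =
      (\<Sum>j<n. (\<eta> j \<omega>)\<^sup>2 * (q (Suc j) - q j))" for \<omega>
    unfolding q0[symmetric] \<eta>_def
  proof (rule step_integral[OF q])
    fix j u assume "j < n" "q j < u" "u \<le> q (Suc j)"
    note simple_process_grid[OF q p this, of \<xi> \<omega>] simple_process_grid[OF q p' this, of \<xi>' \<omega>]
    then show "(c * simple_process m p \<xi> u \<omega> + c' * simple_process m' p' \<xi>' u \<omega>)\<^sup>2 =
      (c * simple_process m p \<xi> (q (Suc j)) \<omega> + c' * simple_process m' p' \<xi>' (q (Suc j)) \<omega>)\<^sup>2"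
      by (simp only:)
  qed simp
  ultimately show ?thesis
    unfolding elementary_def using st q q0
    by (intro conjI exI[of _ n] exI[of _ q] exI[of _ \<eta>]) auto
qed

text \<open>Only the limit \<open>V'\<close> has an exponential moment, not the approximating
  \<open>V k\<close>. Therefore each pair is stopped at a level j, and the index k is chosen so
  late, depending on j, that the stopped variations inherit the moment of \<open>V'\<close>. The
  stopped exponentials still have the right expectation, and their second moments are bounded, so
  \<open>nn_integral_lim_of_L2_bound\<close> applies.\<close>

lemma elementary_exp_limit:
  assumes el: "\<And>k. elementary s t (S k) (V k)"
    and limS: "AE \<omega> in M. (\<lambda>k. S k \<omega>) \<longlonglongrightarrow> S' \<omega>" and limV: "AE \<omega> in M. (\<lambda>k. V k \<omega>) \<longlonglongrightarrow> V' \<omega>"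
    and [measurable]: "S' \<in> borel_measurable M" "V' \<in> borel_measurable M"
    and B: "(\<integral>\<^sup>+\<omega>. ennreal (exp (6 * V' \<omega>)) \<partial>M) < \<top>"
    and Y: "Y \<in> borel_measurable (F s)" "\<And>\<omega>. 0 \<le> Y \<omega>" "\<And>\<omega>. Y \<omega> \<le> C"
  shows "(\<integral>\<^sup>+\<omega>. ennreal (Y \<omega> * exp (S' \<omega> - V' \<omega> / 2)) \<partial>M) = (\<integral>\<^sup>+\<omega>. ennreal (Y \<omega>) \<partial>M)"
proof -
  have C: "0 \<le> C" using Y(2,3) order_trans by blast
  obtain B where B: "(\<integral>\<^sup>+\<omega>. ennreal (exp (6 * V' \<omega>)) \<partial>M) = ennreal B" "0 \<le> B"
    using B by (auto simp: less_top_ennreal)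
  have [measurable]: "S k \<in> borel_measurable M" "V k \<in> borel_measurable M" for k
    using elementary_measurable[OF el] by auto
  have Y_meas [measurable]: "Y \<in> borel_measurable M" using Y(1) by (rule measurable_F)
  have "\<forall>j k. \<exists>S'' V''. elementary s t S'' V'' \<and> (\<forall>\<omega>. V'' \<omega> \<le> real j \<and> V'' \<omega> \<le> V k \<omega> \<and>
      (V k \<omega> \<le> real j \<longrightarrow> S'' \<omega> = S k \<omega> \<and> V'' \<omega> = V k \<omega>))"
    using elementary_truncate[OF el] by auto
  then obtain A D where AD: "\<And>j k. elementary s t (A j k) (D j k)" "\<And>j k \<omega>. D j k \<omega> \<le> real j"
    "\<And>j k \<omega>. D j k \<omega> \<le> V k \<omega>"
    "\<And>j k \<omega>. V k \<omega> \<le> real j \<Longrightarrow> A j k \<omega> = S k \<omega> \<and> D j k \<omega> = V k \<omega>"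
    by metis
  have [measurable]: "A j k \<in> borel_measurable M" "D j k \<in> borel_measurable M" for j k
    using elementary_measurable[OF AD(1)] by auto
  \<comment> \<open>At a fixed level j the capped exponentials are bounded, so their expectations
    converge to a limit of at most \<open>B\<close>; the extra 1 makes room for the inequality at a
    finite index. The demand \<open>k \<ge> j\<close> makes the diagonal choice \<open>r\<close>
    tend to infinity.\<close>
  have "\<exists>k\<ge>j. (\<integral>\<^sup>+\<omega>. ennreal (exp (6 * min (V k \<omega>) (real j))) \<partial>M) \<le> ennreal (B + 1)" for j
  proof -
    have "(\<lambda>k. \<integral>\<^sup>+\<omega>. ennreal (exp (6 * min (V k \<omega>) (real j))) \<partial>M)
      \<longlonglongrightarrow> (\<integral>\<^sup>+\<omega>. ennreal (exp (6 * min (V' \<omega>) (real j))) \<partial>M)"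
    proof (rule nn_integral_dominated_convergence[where w = "\<lambda>_. ennreal (exp (6 * real j))"])
      show "AE \<omega> in M. (\<lambda>k. ennreal (exp (6 * min (V k \<omega>) (real j)))) \<longlonglongrightarrow> ennreal (exp (6 * min (V' \<omega>) (real j)))"
        using limV by eventually_elim (intro tendsto_intros tendsto_ennrealI)
    qed (auto simp: emeasure_space_1 intro!: AE_I2 ennreal_leI)
    moreover have "(\<integral>\<^sup>+\<omega>. ennreal (exp (6 * min (V' \<omega>) (real j))) \<partial>M) < ennreal (B + 1)"
    proof -
      have "(\<integral>\<^sup>+\<omega>. ennreal (exp (6 * min (V' \<omega>) (real j))) \<partial>M) \<le> (\<integral>\<^sup>+\<omega>. ennreal (exp (6 * V' \<omega>)) \<partial>M)"
        by (intro nn_integral_mono ennreal_leI) auto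
      also have "\<dots> < ennreal (B + 1)" using B by (simp add: ennreal_lessI)
      finally show ?thesis .
    qed
    ultimately have "\<forall>\<^sub>F k in sequentially. (\<integral>\<^sup>+\<omega>. ennreal (exp (6 * min (V k \<omega>) (real j))) \<partial>M) < ennreal (B + 1)"
      by (rule order_tendstoD(2))
    then obtain N where "\<And>k. k \<ge> N \<Longrightarrow> (\<integral>\<^sup>+\<omega>. ennreal (exp (6 * min (V k \<omega>) (real j))) \<partial>M) < ennreal (B + 1)"
      unfolding eventually_sequentially by blast
    then show ?thesis by (intro exI[of _ "max N j"]) (auto intro: less_imp_le)
  qed
  then obtain r where r: "\<And>j. r j \<ge> j"
    "\<And>j. (\<integral>\<^sup>+\<omega>. ennreal (exp (6 * min (V (r j) \<omega>) (real j))) \<partial>M) \<le> ennreal (B + 1)"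
    by metis
  have r_lim: "filterlim r at_top sequentially"
    by (rule filterlim_at_top_mono[OF filterlim_ident]) (simp add: r)
  define X where "X j \<omega> = Y \<omega> * exp (A j (r j) \<omega> - D j (r j) \<omega> / 2)" for j \<omega>
  show ?thesis
  proof (rule nn_integral_lim_of_L2_bound[where X = X and B = "C\<^sup>2 * (1/2 + (B + 1)/2)"])
    show "AE \<omega> in M. (\<lambda>k. X k \<omega>) \<longlonglongrightarrow> Y \<omega> * exp (S' \<omega> - V' \<omega> / 2)"
      using limS limV
    proof eventually_elim
      case (elim \<omega>)
      have S: "(\<lambda>j. S (r j) \<omega>) \<longlonglongrightarrow> S' \<omega>" and V: "(\<lambda>j. V (r j) \<omega>) \<longlonglongrightarrow> V' \<omega>"
        using elim filterlim_compose[OF _ r_lim] by auto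
      \<comment> \<open>Pathwise the stopping becomes inactive: \<open>V (r j)\<close> stays below
        \<open>V' + 1\<close>, while the level j grows.\<close>
      have "\<forall>\<^sub>F j in sequentially. V (r j) \<omega> < V' \<omega> + 1" using V by (rule order_tendstoD(2)) simp
      moreover have "\<forall>\<^sub>F j in sequentially. V' \<omega> + 1 \<le> real j"
        using filterlim_real_sequentially unfolding filterlim_at_top by blast
      ultimately have "\<forall>\<^sub>F j in sequentially. Y \<omega> * exp (S (r j) \<omega> - V (r j) \<omega> / 2) = X j \<omega>"
        by eventually_elim (use AD(4) in \<open>auto simp: X_def\<close>)
      moreover have "(\<lambda>j. Y \<omega> * exp (S (r j) \<omega> - V (r j) \<omega> / 2)) \<longlonglongrightarrow> Y \<omega> * exp (S' \<omega> - V' \<omega> / 2)"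
        by (intro tendsto_intros S V) simp
      ultimately show ?case by (rule Lim_transform_eventually[rotated])
    qed
    show "(\<integral>\<^sup>+\<omega>. ennreal (X k \<omega>) \<partial>M) = (\<integral>\<^sup>+\<omega>. ennreal (Y \<omega>) \<partial>M)" for k
      unfolding X_def using Y by (simp add: ennreal_mult elementary_exp[OF AD(1)])
    show "(\<integral>\<^sup>+\<omega>. ennreal ((X k \<omega>)\<^sup>2) \<partial>M) \<le> ennreal (C\<^sup>2 * (1/2 + (B + 1)/2))" for k
    proof -
      let ?a = "A k (r k)" and ?d = "D k (r k)"
      have pt: "(X k \<omega>)\<^sup>2 \<le> C\<^sup>2 * (1/2 * exp (4 * ?a \<omega> - 4\<^sup>2 * ?d \<omega> / 2) + 1/2 * exp (6 * min (V (r k) \<omega>) (real k)))" for \<omega>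
      proof -
        \<comment> \<open>The split is chosen so that squaring the first factor gives the stochastic
          exponential of \<open>4 * ?a\<close>, whose expectation is 1. What is left over is
          \<open>exp (6 * ?d)\<close>, the reason for the 6 in the hypothesis.\<close>
        have "(exp (?a \<omega> - ?d \<omega> / 2))\<^sup>2 = exp (2 * ?a \<omega> - 4 * ?d \<omega>) * exp (3 * ?d \<omega>)"
          by (simp add: exp_double[symmetric] exp_add[symmetric])
        also have "\<dots> \<le> 1/2 * (exp (2 * ?a \<omega> - 4 * ?d \<omega>))\<^sup>2 + 1/2 * (exp (3 * ?d \<omega>))\<^sup>2"
          using sum_squares_bound[of "exp (2 * ?a \<omega> - 4 * ?d \<omega>)" "exp (3 * ?d \<omega>)"] by simp
        also have "\<dots> = 1/2 * exp (4 * ?a \<omega> - 4\<^sup>2 * ?d \<omega> / 2) + 1/2 * exp (6 * ?d \<omega>)"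
          by (simp add: exp_double[symmetric])
        also have "\<dots> \<le> 1/2 * exp (4 * ?a \<omega> - 4\<^sup>2 * ?d \<omega> / 2) + 1/2 * exp (6 * min (V (r k) \<omega>) (real k))"
          using AD(2)[of k "r k" \<omega>] AD(3)[of k "r k" \<omega>] by simp
        finally have "(exp (?a \<omega> - ?d \<omega> / 2))\<^sup>2 \<le> \<dots>" .
        moreover have "(Y \<omega>)\<^sup>2 \<le> C\<^sup>2" using Y(2,3) by (simp add: power_mono)
        ultimately show ?thesis unfolding X_def power_mult_distrib by (intro mult_mono) auto
      qed
      have sq: "ennreal (C\<^sup>2 * (1/2 * x + 1/2 * y)) = ennreal (C\<^sup>2) * (ennreal (1/2) * ennreal x + ennreal (1/2) * ennreal y)"
        if "0 \<le> x" "0 \<le> y" for x y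
      proof -
        have "ennreal (C\<^sup>2 * (1/2 * x + 1/2 * y)) = ennreal (C\<^sup>2) * ennreal (1/2 * x + 1/2 * y)"
          by (rule ennreal_mult) (use that in auto)
        also have "ennreal (1/2 * x + 1/2 * y) = ennreal (1/2 * x) + ennreal (1/2 * y)"
          by (rule ennreal_plus) (use that in auto)
        also have "ennreal (1/2 * x) = ennreal (1/2) * ennreal x" by (rule ennreal_mult) (use that in auto)
        also have "ennreal (1/2 * y) = ennreal (1/2) * ennreal y" by (rule ennreal_mult) (use that in auto)
        finally show ?thesis .
      qed
      have "(\<integral>\<^sup>+\<omega>. ennreal ((X k \<omega>)\<^sup>2) \<partial>M) \<le> (\<integral>\<^sup>+\<omega>. ennreal (C\<^sup>2) * (ennreal (1/2) * ennreal (exp (4 * ?a \<omega> - 4\<^sup>2 * ?d \<omega> / 2)) +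
          ennreal (1/2) * ennreal (exp (6 * min (V (r k) \<omega>) (real k)))) \<partial>M)"
        by (intro nn_integral_mono) (subst sq[symmetric], use pt in \<open>auto intro!: ennreal_leI simp del: ennreal_half\<close>)
      also have "\<dots> = ennreal (C\<^sup>2) * (ennreal (1/2) * (\<integral>\<^sup>+\<omega>. ennreal (exp (4 * ?a \<omega> - 4\<^sup>2 * ?d \<omega> / 2)) \<partial>M) +
          ennreal (1/2) * (\<integral>\<^sup>+\<omega>. ennreal (exp (6 * min (V (r k) \<omega>) (real k))) \<partial>M))"
        by (simp add: nn_integral_cmult nn_integral_add)
      also have "(\<integral>\<^sup>+\<omega>. ennreal (exp (4 * ?a \<omega> - 4\<^sup>2 * ?d \<omega> / 2)) \<partial>M) = 1"
        using elementary_exp[OF elementary_scale[OF AD(1), of 4 k "r k"], of "\<lambda>_. 1"] by (simp add: emeasure_space_1)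
      also have "ennreal (C\<^sup>2) * (ennreal (1/2) * 1 + ennreal (1/2) * (\<integral>\<^sup>+\<omega>. ennreal (exp (6 * min (V (r k) \<omega>) (real k))) \<partial>M))
          \<le> ennreal (C\<^sup>2) * (ennreal (1/2) * 1 + ennreal (1/2) * ennreal (B + 1))"
        by (intro mult_left_mono add_left_mono r) auto
      also have "\<dots> = ennreal (C\<^sup>2 * (1/2 + (B + 1)/2))"
        using sq[of 1 "B + 1"] B(2) by simp
      finally show ?thesis .
    qed
  qed (use Y in \<open>auto simp: X_def[abs_def]\<close>)
qed

text \<open>The one-sided Fatou version. It supplies the first exponential moments of R, from which
  the moment hypothesis of \<open>elementary_exp_limit\<close> is later verified.\<close>

lemma elementary_exp_limit_le:
  assumes el: "\<And>k. elementary s t (S k) (V k)"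
    and limS: "AE \<omega> in M. (\<lambda>k. S k \<omega>) \<longlonglongrightarrow> S' \<omega>" and limV: "AE \<omega> in M. (\<lambda>k. V k \<omega>) \<longlonglongrightarrow> V' \<omega>"
  shows "(\<integral>\<^sup>+\<omega>. ennreal (exp (S' \<omega> - V' \<omega> / 2)) \<partial>M) \<le> 1"
proof -
  have [measurable]: "S k \<in> borel_measurable M" "V k \<in> borel_measurable M" for k
    using elementary_measurable[OF el] by auto
  have "AE \<omega> in M. (\<lambda>k. ennreal (exp (S k \<omega> - V k \<omega> / 2))) \<longlonglongrightarrow> ennreal (exp (S' \<omega> - V' \<omega> / 2))"
    using limS limV by eventually_elim (intro tendsto_ennrealI tendsto_intros; simp)
  then have "(\<integral>\<^sup>+\<omega>. ennreal (exp (S' \<omega> - V' \<omega> / 2)) \<partial>M) = (\<integral>\<^sup>+\<omega>. liminf (\<lambda>k. ennreal (exp (S k \<omega> - V k \<omega> / 2))) \<partial>M)"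
    by (rule nn_integral_cong_AE[OF AE_mp]) (auto intro!: AE_I2 lim_imp_Liminf[symmetric] simp del: tendsto_ennreal_iff)
  also have "\<dots> \<le> liminf (\<lambda>k. \<integral>\<^sup>+\<omega>. ennreal (exp (S k \<omega> - V k \<omega> / 2)) \<partial>M)" by (rule nn_integral_liminf) simp
  also have "(\<lambda>k. \<integral>\<^sup>+\<omega>. ennreal (exp (S k \<omega> - V k \<omega> / 2)) \<partial>M) = (\<lambda>k. 1)"
    using elementary_exp[OF el, of "\<lambda>_. 1"] by (simp add: emeasure_space_1)
  finally show ?thesis by (simp add: Liminf_const)
qed

text \<open>An exponential Markov inequality for both signs. Where \<open>b\<^sup>2 * V < 1\<close>
  and S exceeds \<epsilon> in modulus, one of the stochastic exponentials of \<open>b * S\<close>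
  and \<open>- b * S\<close> is at least \<open>exp (b * \<epsilon> - 1/2)\<close>; both have
  expectation 1. First b is taken large, then k large enough for the remaining event to have small
  probability.\<close>

lemma elementary_null:
  assumes el: "\<And>k. elementary s t (S k) (V k)" and limV: "AE \<omega> in M. (\<lambda>k. V k \<omega>) \<longlonglongrightarrow> 0"
  shows "tendsto_in_prob M S (\<lambda>_. 0)"
  unfolding tendsto_in_prob_def
proof (intro conjI allI impI)
  have [measurable]: "S k \<in> borel_measurable M" "V k \<in> borel_measurable M" for k
    using elementary_measurable[OF el] by auto
  show "S k \<in> borel_measurable M" for k by simp
  fix \<epsilon> :: real assume \<epsilon>: "0 < \<epsilon>"
  show "(\<lambda>k. prob {\<omega> \<in> space M. \<epsilon> < \<bar>S k \<omega> - 0\<bar>}) \<longlonglongrightarrow> 0"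
  proof (rule LIMSEQ_I)
    fix e :: real assume e: "0 < e"
    have "((\<lambda>b. 2 * exp (1/2 - b * \<epsilon>)) \<longlongrightarrow> 0) at_top"
    proof -
      have "filterlim (\<lambda>b. - (1/2 - b * \<epsilon>)) at_top at_top"
        using \<epsilon> by (intro filterlim_at_top_mono[OF filterlim_tendsto_add_at_top[OF tendsto_const[of "-1/2"]
              filterlim_tendsto_pos_mult_at_top[OF tendsto_const[of \<epsilon>] _ filterlim_ident]]]) (auto simp: ac_simps)
      then have "((\<lambda>b. exp (1/2 - b * \<epsilon>)) \<longlongrightarrow> 0) at_top"
        by (intro filterlim_compose[OF exp_at_bot]) (simp add: filterlim_uminus_at_bot)
      from tendsto_mult_right_zero[OF this, of 2] show ?thesis by simp
    qed
    then have "\<forall>\<^sub>F b in at_top. 2 * exp (1/2 - b * \<epsilon>) < e / 2"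
      using e by (intro order_tendstoD(2)) auto
    then have "\<forall>\<^sub>F b in at_top. 2 * exp (1/2 - b * \<epsilon>) < e / 2 \<and> b > 0"
      by (intro eventually_conj eventually_gt_at_top)
    then obtain b where b: "2 * exp (1/2 - b * \<epsilon>) < e / 2" "b > 0"
      using eventually_happens'[OF trivial_limit_at_top_linorder] by blast
    have "(\<lambda>k. \<integral>\<^sup>+\<omega>. ennreal (min 1 (b\<^sup>2 * V k \<omega>)) \<partial>M) \<longlonglongrightarrow> (\<integral>\<^sup>+\<omega>. ennreal (min 1 (b\<^sup>2 * 0)) \<partial>M)"
    proof (rule nn_integral_dominated_convergence[where w = "\<lambda>_. 1"])
      show "AE \<omega> in M. (\<lambda>k. ennreal (min 1 (b\<^sup>2 * V k \<omega>))) \<longlonglongrightarrow> ennreal (min 1 (b\<^sup>2 * 0))"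
        using limV by eventually_elim (intro tendsto_intros tendsto_ennrealI)
    qed (auto simp: emeasure_space_1 intro!: AE_I2)
    then have "\<forall>\<^sub>F k in sequentially. (\<integral>\<^sup>+\<omega>. ennreal (min 1 (b\<^sup>2 * V k \<omega>)) \<partial>M) < ennreal (e/2)"
      using e by (intro order_tendstoD(2)) auto
    then obtain N where N: "\<And>k. k \<ge> N \<Longrightarrow> (\<integral>\<^sup>+\<omega>. ennreal (min 1 (b\<^sup>2 * V k \<omega>)) \<partial>M) < ennreal (e/2)"
      unfolding eventually_sequentially by blast
    have "prob {\<omega> \<in> space M. \<epsilon> < \<bar>S k \<omega> - 0\<bar>} < e" if k: "k \<ge> N" for k
    proof -
      let ?A = "{\<omega> \<in> space M. \<epsilon> < \<bar>S k \<omega> - 0\<bar>}"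
      let ?w = "exp (1/2 - b * \<epsilon>)"
      have one: "(\<integral>\<^sup>+\<omega>. ennreal (exp (c * S k \<omega> - c\<^sup>2 * V k \<omega> / 2)) \<partial>M) = 1" for c
        using elementary_exp[OF elementary_scale[OF el, of c k], of "\<lambda>_. 1"] by (simp add: emeasure_space_1)
      \<comment> \<open>The first summand handles the outcomes where \<open>b\<^sup>2 * V k\<close>
        reaches 1, the other two handle the two signs of \<open>S k\<close>.\<close>
      have pt: "indicator ?A \<omega> \<le> min 1 (b\<^sup>2 * V k \<omega>) + ?w * exp (b * S k \<omega> - b\<^sup>2 * V k \<omega> / 2)
          + ?w * exp ((-b) * S k \<omega> - (-b)\<^sup>2 * V k \<omega> / 2)" for \<omega>
      proof (cases "\<omega> \<in> ?A \<and> b\<^sup>2 * V k \<omega> < 1")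
        case True
        have "b * \<epsilon> \<le> \<bar>b * S k \<omega>\<bar>" using True b(2) by (simp add: abs_mult)
        then have "1 \<le> ?w * exp (b * S k \<omega> - b\<^sup>2 * V k \<omega> / 2) \<or> 1 \<le> ?w * exp ((-b) * S k \<omega> - (-b)\<^sup>2 * V k \<omega> / 2)"
          using True unfolding exp_add[symmetric] one_le_exp_iff by (auto simp: abs_if split: if_splits)
        moreover have "0 \<le> b\<^sup>2 * V k \<omega>" using elementary_nonneg[OF el] by simp
        moreover have "0 \<le> ?w * exp (b * S k \<omega> - b\<^sup>2 * V k \<omega> / 2)" "0 \<le> ?w * exp ((-b) * S k \<omega> - (-b)\<^sup>2 * V k \<omega> / 2)"
          by simp_all
        ultimately have "1 \<le> min 1 (b\<^sup>2 * V k \<omega>) + ?w * exp (b * S k \<omega> - b\<^sup>2 * V k \<omega> / 2)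
          + ?w * exp ((-b) * S k \<omega> - (-b)\<^sup>2 * V k \<omega> / 2)" by linarith
        then show ?thesis using True by simp
      next
        case False
        moreover have "0 \<le> b\<^sup>2 * V k \<omega>" using elementary_nonneg[OF el] by simp
        ultimately show ?thesis by (auto simp: indicator_def min_def intro!: add_nonneg_nonneg add_increasing2)
      qed
      have "ennreal (prob ?A) = (\<integral>\<^sup>+\<omega>. ennreal (indicator ?A \<omega>) \<partial>M)"
        by (simp add: ennreal_indicator emeasure_eq_measure)
      also have "\<dots> \<le> (\<integral>\<^sup>+\<omega>. ennreal (min 1 (b\<^sup>2 * V k \<omega>)) + ennreal ?w * ennreal (exp (b * S k \<omega> - b\<^sup>2 * V k \<omega> / 2))
          + ennreal ?w * ennreal (exp ((-b) * S k \<omega> - (-b)\<^sup>2 * V k \<omega> / 2)) \<partial>M)"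
        using elementary_nonneg[OF el]
        by (intro nn_integral_mono) (use pt in \<open>auto simp flip: ennreal_mult ennreal_plus intro!: ennreal_leI\<close>)
      also have "\<dots> = (\<integral>\<^sup>+\<omega>. ennreal (min 1 (b\<^sup>2 * V k \<omega>)) \<partial>M) + ennreal ?w + ennreal ?w"
        using one[of b] one[of "-b"] by (simp add: nn_integral_add nn_integral_cmult)
      also have "\<dots> = (\<integral>\<^sup>+\<omega>. ennreal (min 1 (b\<^sup>2 * V k \<omega>)) \<partial>M) + ennreal (2 * ?w)"
        by (simp add: add.assoc flip: ennreal_plus)
      also have "\<dots> < ennreal (e/2) + ennreal (e/2)"
        using N[OF k] b(1) by (intro add_strict_mono) (auto intro!: ennreal_lessI e)
      also have "\<dots> = ennreal e" using e by (simp flip: ennreal_plus)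
      finally show ?thesis using e by (simp add: ennreal_less_iff)
    qed
    then show "\<exists>N. \<forall>k\<ge>N. norm (prob {\<omega> \<in> space M. \<epsilon> < \<bar>S k \<omega> - 0\<bar>} - 0) < e"
      by (intro exI[of _ N]) auto
  qed
qed simp

end

subsection \<open>Pathwise limits\<close>

lemma LBINT_eq_integral:
  fixes f :: "real \<Rightarrow> real"
  assumes "continuous_on {a..b} f"
  shows "(LBINT u:{a..b}. f u) = integral {a..b} f"
  by (rule set_borel_integral_eq_integral)
    (use borel_integrable_compact[OF _ assms] in \<open>simp add: set_integrable_def\<close>)

text \<open>Young's inequality with parameter d gives \<open>\<bar>y\<^sup>2 - z\<^sup>2\<bar> \<le>
  (1 + 1/d) * (y - z)\<^sup>2 + d * z\<^sup>2\<close>; the first part vanishes in the limit, the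
  second is small by the choice of d.\<close>

lemma L2_norm_limit:
  fixes f :: "nat \<Rightarrow> 'b \<Rightarrow> real"
  assumes [measurable]: "\<And>k. f k \<in> borel_measurable N" "g \<in> borel_measurable N"
    and f: "\<And>k. integrable N (\<lambda>x. (f k x)\<^sup>2)" and g: "integrable N (\<lambda>x. (g x)\<^sup>2)"
    and lim: "(\<lambda>k. \<integral>x. (f k x - g x)\<^sup>2 \<partial>N) \<longlonglongrightarrow> 0"
  shows "(\<lambda>k. \<integral>x. (f k x)\<^sup>2 \<partial>N) \<longlonglongrightarrow> (\<integral>x. (g x)\<^sup>2 \<partial>N)"
proof (rule LIMSEQ_I)
  fix e :: real assume e: "0 < e"
  let ?G = "\<integral>x. (g x)\<^sup>2 \<partial>N" and ?D = "\<lambda>k. \<integral>x. (f k x - g x)\<^sup>2 \<partial>N"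
  have G: "0 \<le> ?G" by simp
  \<comment> \<open>The added 1 keeps the denominator positive when g vanishes almost
    everywhere.\<close>
  define d where "d = e / (2 * (?G + 1))"
  have d: "0 < d" "d * ?G < e / 2"
  proof -
    have "?G / (?G + 1) < 1" using divide_less_eq_1_pos[of "?G + 1" ?G] G by linarith
    then have "e / 2 * (?G / (?G + 1)) < e / 2 * 1" using e by (intro mult_strict_left_mono) auto
    then show "d * ?G < e / 2" by (simp add: d_def)
    show "0 < d" unfolding d_def using e G by (intro divide_pos_pos mult_pos_pos add_nonneg_pos) auto
  qed
  have D: "integrable N (\<lambda>x. (f k x - g x)\<^sup>2)" for k
  proof (rule Bochner_Integration.integrable_bound)
    show "integrable N (\<lambda>x. 2 * (f k x)\<^sup>2 + 2 * (g x)\<^sup>2)" using f g by auto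
    show "AE x in N. norm ((f k x - g x)\<^sup>2) \<le> norm (2 * (f k x)\<^sup>2 + 2 * (g x)\<^sup>2)"
    proof (rule AE_I2)
      fix x
      have "0 \<le> (f k x + g x)\<^sup>2" by simp
      then have "(f k x - g x)\<^sup>2 \<le> 2 * (f k x)\<^sup>2 + 2 * (g x)\<^sup>2"
        by (simp add: power2_eq_square algebra_simps)
      then show "norm ((f k x - g x)\<^sup>2) \<le> norm (2 * (f k x)\<^sup>2 + 2 * (g x)\<^sup>2)" by simp
    qed
  qed simp
  have bound: "\<bar>(\<integral>x. (f k x)\<^sup>2 \<partial>N) - ?G\<bar> \<le> (1 + 1/d) * ?D k + d * ?G" for k
  proof -
    have pt: "\<bar>y\<^sup>2 - z\<^sup>2\<bar> \<le> (1 + 1/d) * (y - z)\<^sup>2 + d * z\<^sup>2" for y z :: real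
    proof -
      have "2 * \<bar>(y - z) * z\<bar> \<le> (y - z)\<^sup>2 / d + d * z\<^sup>2"
      proof -
        have "0 \<le> (\<bar>y - z\<bar> - d * \<bar>z\<bar>)\<^sup>2" by simp
        also have "(\<bar>y - z\<bar> - d * \<bar>z\<bar>)\<^sup>2 = \<bar>y - z\<bar>\<^sup>2 + d\<^sup>2 * \<bar>z\<bar>\<^sup>2 - 2 * (\<bar>y - z\<bar> * \<bar>z\<bar>) * d"
          by (simp only: power2_eq_square algebra_simps)
        finally have "2 * \<bar>(y - z) * z\<bar> * d \<le> (y - z)\<^sup>2 + d\<^sup>2 * z\<^sup>2"
          unfolding abs_mult by simp
        then show ?thesis using d by (simp add: field_simps power2_eq_square)
      qed
      moreover have "\<bar>y\<^sup>2 - z\<^sup>2\<bar> \<le> (y - z)\<^sup>2 + 2 * \<bar>(y - z) * z\<bar>"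
      proof -
        have "y\<^sup>2 - z\<^sup>2 = (y - z)\<^sup>2 + 2 * ((y - z) * z)" by (simp add: power2_eq_square algebra_simps)
        then show ?thesis by (metis abs_ge_self abs_mult abs_numeral abs_power2 abs_triangle_ineq)
      qed
      ultimately show ?thesis by (simp add: algebra_simps)
    qed
    have "\<bar>(\<integral>x. (f k x)\<^sup>2 \<partial>N) - ?G\<bar> = \<bar>\<integral>x. (f k x)\<^sup>2 - (g x)\<^sup>2 \<partial>N\<bar>" using f g by simp
    also have "\<dots> \<le> (\<integral>x. \<bar>(f k x)\<^sup>2 - (g x)\<^sup>2\<bar> \<partial>N)" by (rule integral_abs_bound)
    also have "\<dots> \<le> (\<integral>x. (1 + 1/d) * (f k x - g x)\<^sup>2 + d * (g x)\<^sup>2 \<partial>N)"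
      using f g D pt by (intro integral_mono) auto
    also have "\<dots> = (1 + 1/d) * ?D k + d * ?G"
      using D g by (subst Bochner_Integration.integral_add) auto
    finally show ?thesis .
  qed
  have lim': "(\<lambda>k. (1 + 1/d) * ?D k + d * ?G) \<longlonglongrightarrow> (1 + 1/d) * 0 + d * ?G"
    by (intro tendsto_intros lim)
  have "\<forall>\<^sub>F k in sequentially. (1 + 1/d) * ?D k + d * ?G < e"
    using order_tendstoD(2)[OF lim', of e] d e by simp
  then show "\<exists>no. \<forall>k\<ge>no. norm ((\<integral>x. (f k x)\<^sup>2 \<partial>N) - ?G) < e"
    unfolding eventually_sequentially real_norm_def using bound by (meson order_le_less_trans)
qed

lemma simple_process_sq_integrable:
  "integrable lborel (\<lambda>u. (indicat_real {s..t} u * (c * simple_process m p \<xi> u \<omega> + c' * simple_process m' p' \<xi>' u \<omega>))\<^sup>2)"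
proof (rule Bochner_Integration.integrable_bound)
  have bd: "\<bar>simple_process m p \<xi> u \<omega>\<bar> \<le> (\<Sum>i<m. \<bar>\<xi> i \<omega>\<bar>)" for m p \<xi> u
    unfolding simple_process_def by (rule order_trans[OF sum_abs]) (auto intro!: sum_mono simp: indicator_def)
  let ?C = "\<bar>c\<bar> * (\<Sum>i<m. \<bar>\<xi> i \<omega>\<bar>) + \<bar>c'\<bar> * (\<Sum>i<m'. \<bar>\<xi>' i \<omega>\<bar>)"
  show "integrable lborel (\<lambda>u. indicat_real {s..t} u * ?C\<^sup>2)"
    by (intro integrable_mult_left integrable_real_indicator) (auto simp: emeasure_lborel_Icc_eq)
  have "\<bar>c * simple_process m p \<xi> u \<omega> + c' * simple_process m' p' \<xi>' u \<omega>\<bar> \<le> ?C" for u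
    by (rule order_trans[OF abs_triangle_ineq]) (auto simp: abs_mult intro!: add_mono mult_left_mono bd)
  then have "(c * simple_process m p \<xi> u \<omega> + c' * simple_process m' p' \<xi>' u \<omega>)\<^sup>2 \<le> ?C\<^sup>2" for u
    by (rule power2_le_iff_abs_le[THEN iffD2, rotated]) (auto intro!: add_nonneg_nonneg mult_nonneg_nonneg sum_nonneg)
  then show "AE u in lborel. norm ((indicat_real {s..t} u * (c * simple_process m p \<xi> u \<omega> + c' * simple_process m' p' \<xi>' u \<omega>))\<^sup>2)
      \<le> norm (indicat_real {s..t} u * ?C\<^sup>2)"
    by (intro AE_I2) (auto simp: indicator_def power_mult_distrib)
qed simp

text \<open>The squared error over [s,t] is at most that over [0,t], so a sequence approximating up
  to time t yields the quadratic variation over every later part of the interval.\<close>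

lemma simple_sq_limit:
  fixes G :: "real \<Rightarrow> real"
  assumes G: "continuous_on {0..t} G" and s: "0 \<le> s"
    and lim: "(\<lambda>k. LBINT u:{0..t}. (simple_process (n k) (p k) (\<xi> k) u \<omega> - G u)\<^sup>2) \<longlonglongrightarrow> 0"
  shows "(\<lambda>k. LBINT u:{s..t}. (simple_process (n k) (p k) (\<xi> k) u \<omega>)\<^sup>2) \<longlonglongrightarrow> (LBINT u:{s..t}. (G u)\<^sup>2)"
proof -
  let ?f = "\<lambda>k u. indicat_real {s..t} u * simple_process (n k) (p k) (\<xi> k) u \<omega>"
  let ?g = "\<lambda>u. indicat_real {s..t} u * G u"
  let ?ff = "\<lambda>k u. indicat_real {0..t} u * simple_process (n k) (p k) (\<xi> k) u \<omega>"
  let ?gg = "\<lambda>u. indicat_real {0..t} u * G u"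
  have G': "continuous_on {s..t} G" using G s by (rule_tac continuous_on_subset) auto
  have sq: "(indicat_real A u * x)\<^sup>2 = indicat_real A u *\<^sub>R x\<^sup>2" for A u x by (simp add: indicator_def)
  have [measurable]: "?g \<in> borel_measurable lborel" "?gg \<in> borel_measurable lborel"
    using borel_integrable_compact[OF _ G] borel_integrable_compact[OF _ G'] by auto
  have gi: "integrable lborel (\<lambda>u. (?g u)\<^sup>2)" "integrable lborel (\<lambda>u. (?gg u)\<^sup>2)"
    unfolding sq by (intro borel_integrable_compact continuous_intros G G'; simp)+
  have fi: "integrable lborel (\<lambda>u. (?f k u)\<^sup>2)" "integrable lborel (\<lambda>u. (?ff k u)\<^sup>2)" for k
    using simple_process_sq_integrable[of _ t 1 "n k" "p k" "\<xi> k" \<omega> 0] by simp_all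
  have D0: "integrable lborel (\<lambda>u. (?ff k u - ?gg u)\<^sup>2)" for k
  proof (rule Bochner_Integration.integrable_bound)
    show "integrable lborel (\<lambda>x. 2 * (?ff k x)\<^sup>2 + 2 * (?gg x)\<^sup>2)" using fi gi by auto
    show "AE x in lborel. norm ((?ff k x - ?gg x)\<^sup>2) \<le> norm (2 * (?ff k x)\<^sup>2 + 2 * (?gg x)\<^sup>2)"
    proof (rule AE_I2)
      fix x
      have "0 \<le> (?ff k x + ?gg x)\<^sup>2" by simp
      then have "(?ff k x - ?gg x)\<^sup>2 \<le> 2 * (?ff k x)\<^sup>2 + 2 * (?gg x)\<^sup>2"
        by (simp only: power2_eq_square algebra_simps)
      then show "norm ((?ff k x - ?gg x)\<^sup>2) \<le> norm (2 * (?ff k x)\<^sup>2 + 2 * (?gg x)\<^sup>2)" by simp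
    qed
  qed simp
  have lim0: "(\<lambda>k. \<integral>u. (?ff k u - ?gg u)\<^sup>2 \<partial>lborel) \<longlonglongrightarrow> 0"
    using lim unfolding set_lebesgue_integral_def sq[symmetric] by (simp add: right_diff_distrib)
  have lim1: "(\<lambda>k. \<integral>u. (?f k u - ?g u)\<^sup>2 \<partial>lborel) \<longlonglongrightarrow> 0"
  proof (rule tendsto_sandwich[OF _ _ tendsto_const lim0])
    show "\<forall>\<^sub>F k in sequentially. (\<integral>u. (?f k u - ?g u)\<^sup>2 \<partial>lborel) \<le> (\<integral>u. (?ff k u - ?gg u)\<^sup>2 \<partial>lborel)"
      using D0 s by (intro always_eventually allI integral_mono' D0) (auto simp: indicator_def)
  qed simp
  have "(\<lambda>k. \<integral>u. (?f k u)\<^sup>2 \<partial>lborel) \<longlonglongrightarrow> (\<integral>u. (?g u)\<^sup>2 \<partial>lborel)"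
    by (rule L2_norm_limit[OF _ _ fi(1) gi(1) lim1]) simp_all
  then show ?thesis
    unfolding set_lebesgue_integral_def sq[symmetric] by simp
qed

text \<open>Sequences obtained for the times t and s approximate the same G on [0,s], so their
  difference vanishes there by \<open>(x - y)\<^sup>2 \<le> 2 * (x - G)\<^sup>2 + 2 * (y -
  G)\<^sup>2\<close>. This is the input for \<open>elementary_null\<close>.\<close>

lemma simple_diff_limit:
  fixes G :: "real \<Rightarrow> real"
  assumes G: "continuous_on {0..t} G" and s: "0 \<le> s" "s \<le> t"
    and lim: "(\<lambda>k. LBINT u:{0..t}. (simple_process (n k) (p k) (\<xi> k) u \<omega> - G u)\<^sup>2) \<longlonglongrightarrow> 0"
    and lim': "(\<lambda>k. LBINT u:{0..s}. (simple_process (n' k) (p' k) (\<xi>' k) u \<omega> - G u)\<^sup>2) \<longlonglongrightarrow> 0"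
  shows "(\<lambda>k. LBINT u:{0..s}. (simple_process (n k) (p k) (\<xi> k) u \<omega> + (-1) * simple_process (n' k) (p' k) (\<xi>' k) u \<omega>)\<^sup>2) \<longlonglongrightarrow> 0"
proof -
  let ?h = "\<lambda>k u. simple_process (n k) (p k) (\<xi> k) u \<omega>" and ?h' = "\<lambda>k u. simple_process (n' k) (p' k) (\<xi>' k) u \<omega>"
  have G': "continuous_on {0..s} G" using G s by (rule_tac continuous_on_subset) auto
  have int: "integrable lborel (\<lambda>u. indicat_real {0..r} u * (simple_process m q \<zeta> u \<omega> - G u)\<^sup>2)"
    if r: "continuous_on {0..r} G" for r m q \<zeta>
  proof (rule Bochner_Integration.integrable_bound)
    have "integrable lborel (\<lambda>u. indicat_real {0..r} u *\<^sub>R (G u)\<^sup>2)"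
      by (intro borel_integrable_compact continuous_intros r) simp
    moreover have "integrable lborel (\<lambda>u. indicat_real {0..r} u * (simple_process m q \<zeta> u \<omega>)\<^sup>2)"
    proof -
      have "(indicat_real {0..r} u * y)\<^sup>2 = indicat_real {0..r} u * y\<^sup>2" for u y by (simp add: indicator_def)
      then show ?thesis using simple_process_sq_integrable[of 0 r 1 m q \<zeta> \<omega> 0] by simp
    qed
    ultimately show "integrable lborel (\<lambda>u. 2 * (indicat_real {0..r} u * (simple_process m q \<zeta> u \<omega>)\<^sup>2) + 2 * (indicat_real {0..r} u *\<^sub>R (G u)\<^sup>2))"
      by auto
    have [measurable]: "(\<lambda>u. indicat_real {0..r} u *\<^sub>R G u) \<in> borel_measurable lborel"
      using borel_integrable_compact[OF _ r] by auto
    \<comment> \<open>Measurability of G is available only after restriction to [0,r]; under the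
      outer indicator the restriction changes nothing.\<close>
    have "(\<lambda>u. indicat_real {0..r} u * (simple_process m q \<zeta> u \<omega> - indicat_real {0..r} u *\<^sub>R G u)\<^sup>2) \<in> borel_measurable lborel"
      by measurable
    also have "(\<lambda>u. indicat_real {0..r} u * (simple_process m q \<zeta> u \<omega> - indicat_real {0..r} u *\<^sub>R G u)\<^sup>2)
      = (\<lambda>u. indicat_real {0..r} u * (simple_process m q \<zeta> u \<omega> - G u)\<^sup>2)" by (auto simp: indicator_def)
    finally show "(\<lambda>u. indicat_real {0..r} u * (simple_process m q \<zeta> u \<omega> - G u)\<^sup>2) \<in> borel_measurable lborel" .
    show "AE u in lborel. norm (indicat_real {0..r} u * (simple_process m q \<zeta> u \<omega> - G u)\<^sup>2)
      \<le> norm (2 * (indicat_real {0..r} u * (simple_process m q \<zeta> u \<omega>)\<^sup>2) + 2 * (indicat_real {0..r} u *\<^sub>R (G u)\<^sup>2))"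
    proof (rule AE_I2)
      fix u
      have "0 \<le> (simple_process m q \<zeta> u \<omega> + G u)\<^sup>2" by simp
      then have "(simple_process m q \<zeta> u \<omega> - G u)\<^sup>2 \<le> 2 * (simple_process m q \<zeta> u \<omega>)\<^sup>2 + 2 * (G u)\<^sup>2"
        by (simp only: power2_eq_square algebra_simps)
      then show "norm (indicat_real {0..r} u * (simple_process m q \<zeta> u \<omega> - G u)\<^sup>2)
        \<le> norm (2 * (indicat_real {0..r} u * (simple_process m q \<zeta> u \<omega>)\<^sup>2) + 2 * (indicat_real {0..r} u *\<^sub>R (G u)\<^sup>2))"
        by (auto simp: indicator_def)
    qed
  qed
  let ?a = "\<lambda>k. LBINT u:{0..t}. (?h k u - G u)\<^sup>2" and ?b = "\<lambda>k. LBINT u:{0..s}. (?h' k u - G u)\<^sup>2"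
  have "(\<lambda>k. 2 * ?a k + 2 * ?b k) \<longlonglongrightarrow> 2 * 0 + 2 * 0" by (intro tendsto_intros lim lim')
  then have L: "(\<lambda>k. 2 * ?a k + 2 * ?b k) \<longlonglongrightarrow> 0" by simp
  show ?thesis
  proof (rule tendsto_sandwich[OF _ _ tendsto_const L])
    have "(LBINT u:{0..s}. (?h k u + (-1) * ?h' k u)\<^sup>2) \<le> 2 * ?a k + 2 * ?b k" for k
    proof -
      have "(LBINT u:{0..s}. (?h k u + (-1) * ?h' k u)\<^sup>2) \<le> (\<integral>u. 2 * (indicat_real {0..t} u * (?h k u - G u)\<^sup>2) + 2 * (indicat_real {0..s} u * (?h' k u - G u)\<^sup>2) \<partial>lborel)"
        unfolding set_lebesgue_integral_def
      proof (rule integral_mono')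
        show "integrable lborel (\<lambda>u. 2 * (indicat_real {0..t} u * (?h k u - G u)\<^sup>2) + 2 * (indicat_real {0..s} u * (?h' k u - G u)\<^sup>2))"
          using int[OF G] int[OF G'] by auto
        fix u
        have "0 \<le> ((?h k u - G u) + (?h' k u - G u))\<^sup>2" by simp
        then have "(?h k u + (-1) * ?h' k u)\<^sup>2 \<le> 2 * (?h k u - G u)\<^sup>2 + 2 * (?h' k u - G u)\<^sup>2"
          by (simp only: power2_eq_square algebra_simps)
        then show "indicat_real {0..s} u *\<^sub>R (?h k u + (-1) * ?h' k u)\<^sup>2
          \<le> 2 * (indicat_real {0..t} u * (?h k u - G u)\<^sup>2) + 2 * (indicat_real {0..s} u * (?h' k u - G u)\<^sup>2)"
          using s by (auto simp: indicator_def)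
      qed auto
      also have "\<dots> = 2 * ?a k + 2 * ?b k"
        unfolding set_lebesgue_integral_def using int[OF G] int[OF G'] by (subst Bochner_Integration.integral_add) auto
      finally show ?thesis .
    qed
    then show "\<forall>\<^sub>F k in sequentially. (LBINT u:{0..s}. (?h k u + (-1) * ?h' k u)\<^sup>2) \<le> 2 * ?a k + 2 * ?b k" by simp
  qed (auto simp: set_lebesgue_integral_def)
qed

text \<open>Jensen's inequality, from the tangent line of the exponential at the mean.\<close>

lemma exp_average_le:
  fixes x :: "nat \<Rightarrow> real"
  assumes "0 < n"
  shows "exp ((\<Sum>i<n. x i) / n) \<le> (\<Sum>i<n. exp (x i)) / n"
proof -
  define m where "m = (\<Sum>i<n. x i) / n"
  have "(\<Sum>i<n. exp m * (1 + (x i - m))) \<le> (\<Sum>i<n. exp (x i))"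
  proof (rule sum_mono)
    fix i
    have "exp m * (1 + (x i - m)) \<le> exp m * exp (x i - m)" by (intro mult_left_mono exp_ge_add_one_self) auto
    then show "exp m * (1 + (x i - m)) \<le> exp (x i)" by (simp add: exp_add[symmetric])
  qed
  also have "(\<Sum>i<n. exp m * (1 + (x i - m))) = exp m * n"
    unfolding sum_distrib_left[symmetric] using assms by (simp add: sum.distrib sum_subtractf m_def)
  finally show ?thesis using assms by (simp add: m_def field_simps)
qed

text \<open>The quadrature error below is summed before the limit, so that it also controls the
  stochastic exponents, where the paths enter through their values at the grid points.\<close>

lemma riemann_error_limit:
  fixes x :: "real \<Rightarrow> real"
  assumes x: "continuous_on {s..t} x" and st: "s < t"
  shows "(\<lambda>n. \<Sum>i<Suc n. integral {s + i * ((t - s) / Suc n)..s + Suc i * ((t - s) / Suc n)}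
      (\<lambda>v. \<bar>x v - x (s + Suc i * ((t - s) / Suc n))\<bar>)) \<longlonglongrightarrow> 0" (is "?e \<longlonglongrightarrow> 0")
proof (rule LIMSEQ_I)
  fix e :: real assume e: "0 < e"
  define d where "d = e / 2 / (t - s)"
  have d: "0 < d" using e st by (simp add: d_def)
  have "uniformly_continuous_on {s..t} x" using x by (intro compact_uniformly_continuous) auto
  then obtain \<delta> where \<delta>: "\<delta> > 0" "\<And>u v. u \<in> {s..t} \<Longrightarrow> v \<in> {s..t} \<Longrightarrow> dist v u < \<delta> \<Longrightarrow> dist (x v) (x u) < d"
    unfolding uniformly_continuous_on_def using d by blast
  obtain N :: nat where N: "(t - s) / \<delta> < N" using reals_Archimedean2 by blast
  have "\<bar>?e n\<bar> < e" if n: "n \<ge> N" for n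
  proof -
    define h where "h = (t - s) / Suc n"
    have h: "0 < h" "h * Suc n = t - s" using st by (auto simp: h_def)
    have "(t - s) / \<delta> < Suc n" using N n by linarith
    then have h\<delta>: "h < \<delta>" unfolding h_def using \<delta>(1) by (simp add: field_simps)
    have each: "0 \<le> integral {s + i * h..s + Suc i * h} (\<lambda>v. \<bar>x v - x (s + Suc i * h)\<bar>) \<and>
      integral {s + i * h..s + Suc i * h} (\<lambda>v. \<bar>x v - x (s + Suc i * h)\<bar>) \<le> d * h" if i: "i < Suc n" for i
    proof -
      have "Suc i * h \<le> Suc n * h" using i h by (intro mult_right_mono) auto
      then have sub: "{s + i * h..s + Suc i * h} \<subseteq> {s..t}" using h by (auto simp: algebra_simps intro: order_trans[rotated])
      have cont: "continuous_on {s + i * h..s + Suc i * h} (\<lambda>v. \<bar>x v - x (s + Suc i * h)\<bar>)"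
        by (intro continuous_intros continuous_on_subset[OF x sub])
      have "0 \<le> integral {s + i * h..s + Suc i * h} (\<lambda>v. \<bar>x v - x (s + Suc i * h)\<bar>)"
        by (intro integral_nonneg integrable_continuous_interval cont) auto
      moreover have "integral {s + i * h..s + Suc i * h} (\<lambda>v. \<bar>x v - x (s + Suc i * h)\<bar>)
        \<le> integral {s + i * h..s + Suc i * h} (\<lambda>v. d)"
      proof (rule integral_le[OF integrable_continuous_interval[OF cont]])
        fix v assume v: "v \<in> {s + i * h..s + Suc i * h}"
        have e: "s + Suc i * h \<in> {s + i * h..s + Suc i * h}" using h by auto
        have "dist v (s + Suc i * h) < \<delta>" using v h h\<delta> by (auto simp: dist_real_def algebra_simps)
        with \<delta>(2)[of "s + Suc i * h" v] v e sub show "\<bar>x v - x (s + Suc i * h)\<bar> \<le> d"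
          by (fastforce simp: dist_real_def)
      qed auto
      ultimately show ?thesis using h by (simp add: algebra_simps)
    qed
    have "0 \<le> ?e n" unfolding h_def[symmetric] using each by (intro sum_nonneg) auto
    moreover have "?e n \<le> (\<Sum>i<Suc n. d * h)" unfolding h_def[symmetric] using each by (intro sum_mono) auto
    moreover have "(\<Sum>i<Suc n. d * h) = d * (h * Suc n)" by simp
    moreover have "d * (h * Suc n) = e / 2"
    proof -
      have "d * (t - s) = e / 2" unfolding d_def using st by (intro nonzero_eq_divide_eq[THEN iffD1, OF _ refl]) auto
      then show ?thesis by (simp only: h(2))
    qed
    ultimately show ?thesis using e by linarith
  qed
  then show "\<exists>N. \<forall>n\<ge>N. norm (?e n - 0) < e" by auto
qed

subsection \<open>Exponential moments of extended CIR processes\<close>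

locale cir_process =
  fixes M :: "'a measure" and F :: "real \<Rightarrow> 'a measure" and Z R :: "real \<Rightarrow> 'a \<Rightarrow> real"
    and \<kappa> :: real and \<theta> :: "real \<Rightarrow> real" and R\<^sub>0 :: real
  assumes cir: "extended_CIR M F Z \<kappa> \<theta> R\<^sub>0 R"

sublocale cir_process \<subseteq> brownian_space M F Z
  using cir unfolding extended_CIR_def by unfold_locales auto

context cir_process
begin

lemma \<kappa>_pos: "0 < \<kappa>" and R\<^sub>0_nonneg: "0 \<le> R\<^sub>0" and \<theta>_nonneg: "0 \<le> t \<Longrightarrow> 0 \<le> \<theta> t"
  using cir unfolding extended_CIR_def by auto

lemma \<theta>_continuous: "0 \<le> s \<Longrightarrow> continuous_on {s..t} \<theta>"
  using cir unfolding extended_CIR_def by (auto elim: continuous_on_subset)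

lemma R_measurable: "0 \<le> t \<Longrightarrow> R t \<in> borel_measurable (F t)"
  using cir unfolding extended_CIR_def adapted_def by auto

lemma R_random [measurable]: "0 \<le> t \<Longrightarrow> R t \<in> borel_measurable M"
  using R_measurable measurable_F by blast

lemma R_continuous: "\<omega> \<in> space M \<Longrightarrow> 0 \<le> s \<Longrightarrow> continuous_on {s..t} (\<lambda>u. R u \<omega>)"
proof -
  assume "\<omega> \<in> space M" "0 \<le> s"
  moreover from this have "continuous_on {0..} (\<lambda>u. R u \<omega>)" using cir unfolding extended_CIR_def by blast
  ultimately show ?thesis by (auto elim: continuous_on_subset)
qed

lemma good_path: "AE \<omega> in M. \<omega> \<in> space M \<and> R 0 \<omega> = R\<^sub>0 \<and> (\<forall>t\<ge>0. 0 \<le> R t \<omega>)"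
  using cir unfolding extended_CIR_def by auto

definition IR :: "real \<Rightarrow> real \<Rightarrow> 'a \<Rightarrow> real" where
  "IR s t \<omega> = (LBINT u:{s..t}. R u \<omega>)"

text \<open>The stochastic integral part of R: by the defining equation a version of the integral of
  \<open>sqrt R\<close> against Z over [0,t], with quadratic variation
  \<open>IR 0 t\<close>.\<close>

definition mart :: "real \<Rightarrow> 'a \<Rightarrow> real" where
  "mart t \<omega> = R t \<omega> - R\<^sub>0 - (LBINT s:{0..t}. \<kappa> * (\<theta> s - R s \<omega>))"

lemma ito: "0 \<le> t \<Longrightarrow> has_ito_integral M F Z (\<lambda>s \<omega>. sqrt (R s \<omega>)) t (mart t)"
  using cir unfolding extended_CIR_def mart_def[abs_def] by auto

lemma IR_eq: "\<omega> \<in> space M \<Longrightarrow> 0 \<le> s \<Longrightarrow> IR s t \<omega> = integral {s..t} (\<lambda>u. R u \<omega>)"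
  unfolding IR_def by (rule LBINT_eq_integral[OF R_continuous])

lemma mart_eq:
  assumes "\<omega> \<in> space M" "0 \<le> t"
  shows "mart t \<omega> = R t \<omega> - R\<^sub>0 - \<kappa> * integral {0..t} \<theta> + \<kappa> * IR 0 t \<omega>"
proof -
  have "(LBINT s:{0..t}. \<kappa> * (\<theta> s - R s \<omega>)) = integral {0..t} (\<lambda>s. \<kappa> * (\<theta> s - R s \<omega>))"
    by (intro LBINT_eq_integral continuous_intros \<theta>_continuous R_continuous assms) auto
  also have "\<dots> = \<kappa> * (integral {0..t} \<theta> - integral {0..t} (\<lambda>s. R s \<omega>))"
    by (simp add: integral_diff[OF integrable_continuous_interval integrable_continuous_interval] \<theta>_continuous R_continuous assms)
  finally show ?thesis using assms by (simp add: mart_def IR_eq algebra_simps)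
qed

lemma IR_split:
  assumes "\<omega> \<in> space M" "0 \<le> s" "s \<le> t"
  shows "IR 0 t \<omega> = IR 0 s \<omega> + IR s t \<omega>"
  using assms Henstock_Kurzweil_Integration.integral_combine[of 0 s t "\<lambda>u. R u \<omega>"]
  by (simp add: IR_eq integrable_continuous_interval R_continuous)

lemma IR_nonneg: "(\<forall>t\<ge>0. 0 \<le> R t \<omega>) \<Longrightarrow> 0 \<le> s \<Longrightarrow> 0 \<le> IR s t \<omega>"
  unfolding IR_def set_lebesgue_integral_def by (rule Bochner_Integration.integral_nonneg) (auto simp: indicator_def)

text \<open>Measurability in \<open>F t\<close> of a time integral needs joint measurability in time
  and outcome. This is drawn from the progressive measurability of the integrand
  \<open>sqrt R\<close>, which is part of \<open>has_ito_integral\<close>.\<close>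

lemma IR_measurable:
  assumes "0 \<le> s" "s \<le> t"
  shows "IR s t \<in> borel_measurable (F t)"
proof -
  let ?N = "restrict_space lborel {0..t}"
  have "0 \<le> t" using assms by simp
  then have "(\<lambda>(u, \<omega>). sqrt (R u \<omega>)) \<in> borel_measurable (restrict_space borel {0..t} \<Otimes>\<^sub>M F t)"
    using ito[of t] unfolding has_ito_integral_def progressively_measurable_def by blast
  also have "sets (restrict_space borel {0..t} \<Otimes>\<^sub>M F t) = sets (?N \<Otimes>\<^sub>M F t)"
    by (intro sets_pair_measure_cong sets_restrict_space_cong) simp_all
  then have "borel_measurable (restrict_space borel {0..t} \<Otimes>\<^sub>M F t) = borel_measurable (?N \<Otimes>\<^sub>M F t)"
    by (intro measurable_cong_sets) auto
  finally have 1: "(\<lambda>(u, \<omega>). sqrt (R u \<omega>)) \<in> borel_measurable (?N \<Otimes>\<^sub>M F t)" .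
  have sqrt_R: "(\<lambda>z. sqrt (R (snd z) (fst z))) \<in> borel_measurable (F t \<Otimes>\<^sub>M ?N)"
    using measurable_pair_swap[OF 1] by (simp add: case_prod_beta)
  \<comment> \<open>The square root of a negative number is the negative of the square root of its modulus,
    so R is recovered from its square root without any sign condition.\<close>
  have "(\<lambda>z. indicat_real {s..t} (snd z) * (sqrt (R (snd z) (fst z)) * \<bar>sqrt (R (snd z) (fst z))\<bar>)) \<in> borel_measurable (F t \<Otimes>\<^sub>M ?N)"
  proof (intro borel_measurable_times borel_measurable_abs sqrt_R)
    show "(\<lambda>z. indicat_real {s..t} (snd z)) \<in> borel_measurable (F t \<Otimes>\<^sub>M ?N)"
      by (rule measurable_compose[OF measurable_snd]) (simp add: measurable_restrict_space1)
  qed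
  also have "(\<lambda>z. indicat_real {s..t} (snd z) * (sqrt (R (snd z) (fst z)) * \<bar>sqrt (R (snd z) (fst z))\<bar>)) = (\<lambda>(\<omega>, u). indicat_real {s..t} u * R u \<omega>)"
  proof -
    have "sqrt x * \<bar>sqrt x\<bar> = x" for x :: real
      by (cases "0 \<le> x") (auto simp: abs_of_nonpos)
    then show ?thesis by (auto simp: fun_eq_iff)
  qed
  finally have 2: "(\<lambda>(\<omega>, u). indicat_real {s..t} u * R u \<omega>) \<in> borel_measurable (F t \<Otimes>\<^sub>M ?N)" .
  interpret N: finite_measure ?N
    by (rule finite_measureI) (simp add: emeasure_restrict_space space_restrict_space emeasure_lborel_Icc_eq)
  have "(\<lambda>\<omega>. \<integral>u. indicat_real {s..t} u * R u \<omega> \<partial>?N) \<in> borel_measurable (F t)"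
    by (rule N.borel_measurable_lebesgue_integral) (use 2 in simp)
  also have "(\<lambda>\<omega>. \<integral>u. indicat_real {s..t} u * R u \<omega> \<partial>?N) = IR s t"
  proof
    fix \<omega>
    have "(\<integral>u. indicat_real {s..t} u * R u \<omega> \<partial>?N) = (\<integral>u. indicat_real {0..t} u *\<^sub>R (indicat_real {s..t} u * R u \<omega>) \<partial>lborel)"
      by (rule integral_restrict_space) simp
    also have "\<dots> = IR s t \<omega>"
      unfolding IR_def set_lebesgue_integral_def using assms by (intro Bochner_Integration.integral_cong) (auto simp: indicator_def)
    finally show "(\<integral>u. indicat_real {s..t} u * R u \<omega> \<partial>?N) = IR s t \<omega>" .
  qed
  finally show ?thesis .
qed

lemma IR_random [measurable]: "0 \<le> s \<Longrightarrow> s \<le> t \<Longrightarrow> IR s t \<in> borel_measurable M"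
  using IR_measurable measurable_F by blast

text \<open>Two successive extractions of subsequences make both limits in probability almost sure
  along the same sequence.\<close>

lemma ito_sequence:
  assumes "0 \<le> t"
  shows "\<exists>n p \<xi>. (\<forall>k::nat. simple_integrand M F (n k) (p k) (\<xi> k)) \<and>
    (AE \<omega> in M. (\<lambda>k. LBINT u:{0..t}. (simple_process (n k) (p k) (\<xi> k) u \<omega> - sqrt (R u \<omega>))\<^sup>2) \<longlonglongrightarrow> 0) \<and>
    (AE \<omega> in M. (\<lambda>k. simple_ito_integral Z (n k) (p k) (\<xi> k) t \<omega>) \<longlonglongrightarrow> mart t \<omega>)"
proof -
  obtain n p \<xi> where si: "\<And>k. simple_integrand M F (n k) (p k) (\<xi> k)"
    and D: "tendsto_in_prob M (\<lambda>k \<omega>. LBINT u:{0..t}. (simple_process (n k) (p k) (\<xi> k) u \<omega> - sqrt (R u \<omega>))\<^sup>2) (\<lambda>\<omega>. 0)"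
    and S: "tendsto_in_prob M (\<lambda>k. simple_ito_integral Z (n k) (p k) (\<xi> k) t) (mart t)"
    using ito[OF assms] unfolding has_ito_integral_def by auto
  obtain r :: "nat \<Rightarrow> nat" where r: "strict_mono r"
    "AE \<omega> in M. (\<lambda>k. LBINT u:{0..t}. (simple_process (n (r k)) (p (r k)) (\<xi> (r k)) u \<omega> - sqrt (R u \<omega>))\<^sup>2) \<longlonglongrightarrow> 0"
    using tendsto_in_prob_AE_subseq[OF D] by auto
  obtain q :: "nat \<Rightarrow> nat" where q: "strict_mono q"
    "AE \<omega> in M. (\<lambda>k. simple_ito_integral Z (n (r (q k))) (p (r (q k))) (\<xi> (r (q k))) t \<omega>) \<longlonglongrightarrow> mart t \<omega>"
    using tendsto_in_prob_AE_subseq[OF tendsto_in_prob_subseq[OF S r(1)]] by auto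
  show ?thesis
    by (intro exI[of _ "\<lambda>k. n (r (q k))"] exI[of _ "\<lambda>k. p (r (q k))"] exI[of _ "\<lambda>k. \<xi> (r (q k))"] conjI allI si q(2)
        AE_lim_subseq[OF r(2) q(1)])
qed

lemma sq_integral_eq:
  assumes "\<omega> \<in> space M" "\<forall>t\<ge>0. 0 \<le> R t \<omega>" "0 \<le> s"
  shows "(LBINT u:{s..t}. (sqrt (R u \<omega>))\<^sup>2) = IR s t \<omega>"
  unfolding IR_def set_lebesgue_integral_def using assms
  by (intro Bochner_Integration.integral_cong) (auto simp: indicator_def)

lemma LBINT_scale_sq: "(LBINT u:{s..t}. (c * x u + 0 * y u)\<^sup>2) = c\<^sup>2 * (LBINT u:{s..t}. (x u :: real)\<^sup>2)"
  by (simp add: power_mult_distrib)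

lemma exp_moment:
  assumes t: "0 \<le> t"
  shows "(\<integral>\<^sup>+\<omega>. ennreal (exp (2 * \<kappa> * R t \<omega>)) \<partial>M) \<le> ennreal (exp (2 * \<kappa> * R\<^sub>0 + 2 * \<kappa>\<^sup>2 * integral {0..t} \<theta>))"
proof (cases "t = 0")
  case True
  have "(\<integral>\<^sup>+\<omega>. ennreal (exp (2 * \<kappa> * R t \<omega>)) \<partial>M) = (\<integral>\<^sup>+\<omega>. ennreal (exp (2 * \<kappa> * R\<^sub>0)) \<partial>M)"
    by (rule nn_integral_cong_AE) (use good_path in eventually_elim, simp add: True)
  then show ?thesis using True by (simp add: emeasure_space_1)
next
  case False
  with t have t0: "0 < t" by simp
  from ito_sequence[OF t] obtain n p \<xi> where si: "\<And>k::nat. simple_integrand M F (n k) (p k) (\<xi> k)"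
    and D: "AE \<omega> in M. (\<lambda>k. LBINT u:{0..t}. (simple_process (n k) (p k) (\<xi> k) u \<omega> - sqrt (R u \<omega>))\<^sup>2) \<longlonglongrightarrow> 0"
    and S: "AE \<omega> in M. (\<lambda>k. simple_ito_integral Z (n k) (p k) (\<xi> k) t \<omega>) \<longlonglongrightarrow> mart t \<omega>"
    by blast
  let ?c = "2 * \<kappa>"
  have "(\<integral>\<^sup>+\<omega>. ennreal (exp (?c * mart t \<omega> - ?c\<^sup>2 * IR 0 t \<omega> / 2)) \<partial>M) \<le> 1"
  proof (rule elementary_exp_limit_le)
    show "elementary 0 t (\<lambda>\<omega>. ?c * (simple_ito_integral Z (n k) (p k) (\<xi> k) t \<omega> - simple_ito_integral Z (n k) (p k) (\<xi> k) 0 \<omega>) +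
         0 * (simple_ito_integral Z (n k) (p k) (\<xi> k) t \<omega> - simple_ito_integral Z (n k) (p k) (\<xi> k) 0 \<omega>))
      (\<lambda>\<omega>. LBINT u:{0..t}. (?c * simple_process (n k) (p k) (\<xi> k) u \<omega> + 0 * simple_process (n k) (p k) (\<xi> k) u \<omega>)\<^sup>2)" for k
      by (rule simple_pair_elementary[OF si si]) (use t0 in auto)
    show "AE \<omega> in M. (\<lambda>k. ?c * (simple_ito_integral Z (n k) (p k) (\<xi> k) t \<omega> - simple_ito_integral Z (n k) (p k) (\<xi> k) 0 \<omega>) +
         0 * (simple_ito_integral Z (n k) (p k) (\<xi> k) t \<omega> - simple_ito_integral Z (n k) (p k) (\<xi> k) 0 \<omega>)) \<longlonglongrightarrow> ?c * mart t \<omega>"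
      unfolding simple_ito_integral_0[OF si]
      using S by eventually_elim (simp, intro tendsto_intros, assumption)
    show "AE \<omega> in M. (\<lambda>k. LBINT u:{0..t}. (?c * simple_process (n k) (p k) (\<xi> k) u \<omega> + 0 * simple_process (n k) (p k) (\<xi> k) u \<omega>)\<^sup>2)
       \<longlonglongrightarrow> ?c\<^sup>2 * IR 0 t \<omega>"
      using D good_path
    proof eventually_elim
      case (elim \<omega>)
      have "continuous_on {0..t} (\<lambda>u. sqrt (R u \<omega>))"
        using elim by (intro continuous_intros R_continuous) auto
      from simple_sq_limit[OF this order_refl elim(1)]
      have "(\<lambda>k. LBINT u:{0..t}. (simple_process (n k) (p k) (\<xi> k) u \<omega>)\<^sup>2) \<longlonglongrightarrow> IR 0 t \<omega>"
        using elim by (simp add: sq_integral_eq)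
      then show ?case unfolding LBINT_scale_sq by (intro tendsto_intros)
    qed
  qed
  \<comment> \<open>For c = 2 \<kappa> the coefficient \<open>c * \<kappa>\<close> of
    \<open>IR 0 t\<close> in \<open>c * mart t\<close> equals \<open>c\<^sup>2 / 2\<close>, so the
    time integrals of R cancel and only \<open>R t\<close> and constants remain.\<close>
  moreover have "AE \<omega> in M. exp (?c * mart t \<omega> - ?c\<^sup>2 * IR 0 t \<omega> / 2) =
      exp (- (2 * \<kappa> * R\<^sub>0 + 2 * \<kappa>\<^sup>2 * integral {0..t} \<theta>)) * exp (2 * \<kappa> * R t \<omega>)"
    using good_path
    by eventually_elim (simp add: mart_eq t exp_add[symmetric] algebra_simps power2_eq_square)
  ultimately have "(\<integral>\<^sup>+\<omega>. ennreal (exp (- (2 * \<kappa> * R\<^sub>0 + 2 * \<kappa>\<^sup>2 * integral {0..t} \<theta>))) * ennreal (exp (2 * \<kappa> * R t \<omega>)) \<partial>M) \<le> 1"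
    by (subst (asm) nn_integral_cong_AE) (auto elim!: AE_mp simp: ennreal_mult)
  then have "ennreal (exp (- (2 * \<kappa> * R\<^sub>0 + 2 * \<kappa>\<^sup>2 * integral {0..t} \<theta>))) * (\<integral>\<^sup>+\<omega>. ennreal (exp (2 * \<kappa> * R t \<omega>)) \<partial>M) \<le> 1"
    using t by (subst (asm) nn_integral_cmult) auto
  then have "ennreal (exp (2 * \<kappa> * R\<^sub>0 + 2 * \<kappa>\<^sup>2 * integral {0..t} \<theta>)) *
      (ennreal (exp (- (2 * \<kappa> * R\<^sub>0 + 2 * \<kappa>\<^sup>2 * integral {0..t} \<theta>))) * (\<integral>\<^sup>+\<omega>. ennreal (exp (2 * \<kappa> * R t \<omega>)) \<partial>M))
      \<le> ennreal (exp (2 * \<kappa> * R\<^sub>0 + 2 * \<kappa>\<^sup>2 * integral {0..t} \<theta>)) * 1"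
    by (rule mult_left_mono) simp
  then show ?thesis
    by (simp add: mult.assoc[symmetric] ennreal_mult[symmetric] exp_add[symmetric])
qed

text \<open>One constant for all times up to T and all exponents up to 2 \<kappa>: the bound of
  \<open>exp_moment\<close> is monotone in time because \<theta> is nonnegative.\<close>

definition moment_bound :: "real \<Rightarrow> real" where
  "moment_bound T = exp (2 * \<kappa> * R\<^sub>0 + 2 * \<kappa>\<^sup>2 * integral {0..T} \<theta>)"

lemma exp_moment_le:
  assumes t: "0 \<le> t" "t \<le> T" and c: "c \<le> 2 * \<kappa>"
  shows "(\<integral>\<^sup>+\<omega>. ennreal (exp (c * R t \<omega>)) \<partial>M) \<le> ennreal (moment_bound T)"
proof -
  have "(\<integral>\<^sup>+\<omega>. ennreal (exp (c * R t \<omega>)) \<partial>M) \<le> (\<integral>\<^sup>+\<omega>. ennreal (exp (2 * \<kappa> * R t \<omega>)) \<partial>M)"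
    by (rule nn_integral_mono_AE) (use good_path in eventually_elim, use t c in \<open>auto intro!: ennreal_leI mult_right_mono\<close>)
  also have "\<dots> \<le> ennreal (exp (2 * \<kappa> * R\<^sub>0 + 2 * \<kappa>\<^sup>2 * integral {0..t} \<theta>))" by (rule exp_moment[OF t(1)])
  also have "\<dots> \<le> ennreal (moment_bound T)"
  proof -
    have "integral {0..t} \<theta> \<le> integral {0..T} \<theta>"
      using t by (intro integral_subset_le integrable_continuous_interval \<theta>_continuous) (auto intro: \<theta>_nonneg)
    then show ?thesis unfolding moment_bound_def by (intro ennreal_leI) (auto intro!: mult_left_mono)
  qed
  finally show ?thesis .
qed

text \<open>Jensen reduces the sum to moments at single times, so no joint law of R enters. The
  price is that each term carries the total coefficient \<open>c * n\<close>, which must stay below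
  2 \<kappa>.\<close>

lemma exp_moment_sum:
  fixes n :: nat and c :: real
  assumes u: "\<And>i. i < n \<Longrightarrow> 0 \<le> u i \<and> u i \<le> T" and c: "c * n \<le> 2 * \<kappa>"
  shows "(\<integral>\<^sup>+\<omega>. ennreal (exp (c * (\<Sum>i<n. R (u i) \<omega>))) \<partial>M) \<le> ennreal (moment_bound T)" (is "?L \<le> _")
proof (cases "n = 0")
  case True
  have "0 \<le> integral {0..T} \<theta>"
    by (intro integral_nonneg integrable_continuous_interval \<theta>_continuous) (auto intro: \<theta>_nonneg)
  then have "1 \<le> moment_bound T" unfolding moment_bound_def using \<kappa>_pos R\<^sub>0_nonneg by simp
  then have "1 \<le> ennreal (moment_bound T)" using ennreal_leI[of 1 "moment_bound T"] by simp
  moreover have "(\<Sum>i<n. R (u i) \<omega>) = 0" for \<omega> using True by simp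
  ultimately show ?thesis by (simp add: emeasure_space_1)
next
  case False
  then have n: "0 < n" by simp
  have [measurable]: "R (u i) \<in> borel_measurable M" if "i \<in> {..<n}" for i using u that by auto
  have "?L \<le> (\<integral>\<^sup>+\<omega>. (\<Sum>i<n. ennreal (1/n) * ennreal (exp (c * n * R (u i) \<omega>))) \<partial>M)"
  proof (rule nn_integral_mono)
    fix \<omega>
    have "c * (\<Sum>i<n. R (u i) \<omega>) = (\<Sum>i<n. c * n * R (u i) \<omega>) / n"
      using n by (simp add: sum_distrib_left[symmetric])
    then have "exp (c * (\<Sum>i<n. R (u i) \<omega>)) \<le> (\<Sum>i<n. exp (c * n * R (u i) \<omega>)) / n"
      using exp_average_le[OF n, of "\<lambda>i. c * n * R (u i) \<omega>"] by simp
    also have "\<dots> = (\<Sum>i<n. (1/n) * exp (c * n * R (u i) \<omega>))" by (simp add: sum_divide_distrib)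
    finally have "ennreal (exp (c * (\<Sum>i<n. R (u i) \<omega>))) \<le> ennreal (\<Sum>i<n. (1/n) * exp (c * n * R (u i) \<omega>))"
      by (rule ennreal_leI)
    also have "\<dots> = (\<Sum>i<n. ennreal ((1/n) * exp (c * n * R (u i) \<omega>)))" by (rule sum_ennreal[symmetric]) simp
    also have "\<dots> = (\<Sum>i<n. ennreal (1/n) * ennreal (exp (c * n * R (u i) \<omega>)))"
      by (intro sum.cong refl ennreal_mult) auto
    finally show "ennreal (exp (c * (\<Sum>i<n. R (u i) \<omega>))) \<le> (\<Sum>i<n. ennreal (1/n) * ennreal (exp (c * n * R (u i) \<omega>)))" .
  qed
  also have "\<dots> = (\<Sum>i<n. \<integral>\<^sup>+\<omega>. ennreal (1/n) * ennreal (exp (c * n * R (u i) \<omega>)) \<partial>M)"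
    by (intro nn_integral_sum) auto
  also have "\<dots> = (\<Sum>i<n. ennreal (1/n) * (\<integral>\<^sup>+\<omega>. ennreal (exp (c * n * R (u i) \<omega>)) \<partial>M))"
    by (intro sum.cong refl nn_integral_cmult) auto
  also have "\<dots> \<le> (\<Sum>i<n. ennreal (1/n) * ennreal (moment_bound T))"
    using u c by (intro sum_mono mult_left_mono exp_moment_le) auto
  also have "\<dots> = (\<Sum>i<n. ennreal (1/n * moment_bound T))"
    by (intro sum.cong refl ennreal_mult[symmetric]) (auto simp: moment_bound_def)
  also have "\<dots> = ennreal (\<Sum>i<n. 1/n * moment_bound T)" by (rule sum_ennreal) (auto simp: moment_bound_def)
  also have "(\<Sum>i<n. 1/n * moment_bound T) = moment_bound T" using n by simp
  finally show ?thesis .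
qed

text \<open>The error splits over the cells and is dominated by the sum in
  \<open>riemann_error_limit\<close>. Right endpoints are sampled because the one-step error
  \<open>defect\<close> below involves R at the right end of a step.\<close>

lemma IR_riemann:
  assumes \<omega>: "\<omega> \<in> space M" and st: "0 \<le> s" "s < t"
  shows "(\<lambda>n. (t - s) / Suc n * (\<Sum>i<Suc n. R (s + Suc i * ((t - s) / Suc n)) \<omega>)) \<longlonglongrightarrow> IR s t \<omega>"
proof -
  let ?x = "\<lambda>u. R u \<omega>"
  have x: "continuous_on {s..t} ?x" using \<omega> st by (intro R_continuous) auto
  have "(\<lambda>n. (t - s) / Suc n * (\<Sum>i<Suc n. ?x (s + Suc i * ((t - s) / Suc n))) - IR s t \<omega>) \<longlonglongrightarrow> 0"
  proof (rule Lim_null_comparison[OF always_eventually riemann_error_limit[OF x st(2)]], rule allI)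
    fix n
    define h where "h = (t - s) / Suc n"
    have h: "0 < h" "h * Suc n = t - s" using st by (auto simp: h_def)
    have le: "s + i * h \<le> t" if "i \<le> Suc n" for i :: nat
    proof -
      have "i * h \<le> Suc n * h" using that h by (intro mult_right_mono) auto
      then show ?thesis using h(2) by (simp only: mult.commute[of h])
    qed
    have cont: "continuous_on {s + i * h..s + Suc i * h} ?x" if "i < Suc n" for i :: nat
      using le[of "Suc i"] that h by (intro continuous_on_subset[OF x]) auto
    have split: "integral {s..s + m * h} ?x = (\<Sum>i<m. integral {s + i * h..s + Suc i * h} ?x)" if "m \<le> Suc n" for m :: nat
      using that
    proof (induction m)
      case (Suc m)
      have "integral {s..s + m * h} ?x + integral {s + m * h..s + Suc m * h} ?x = integral {s..s + Suc m * h} ?x"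
        using h Suc.prems le[of "Suc m"]
        by (intro Henstock_Kurzweil_Integration.integral_combine integrable_continuous_interval continuous_on_subset[OF x])
          (auto simp del: of_nat_Suc intro!: mult_right_mono)
      with Suc show ?case by simp
    qed simp
    have eq: "(t - s) / Suc n * (\<Sum>i<Suc n. ?x (s + Suc i * h)) - IR s t \<omega>
        = (\<Sum>i<Suc n. h * ?x (s + Suc i * h) - integral {s + i * h..s + Suc i * h} ?x)"
      using split[of "Suc n"] h(2) \<omega> st unfolding h_def[symmetric] sum_distrib_left sum_subtractf
      by (simp add: IR_eq mult.commute del: of_nat_Suc sum.lessThan_Suc)
    have "norm (\<Sum>i<Suc n. h * ?x (s + Suc i * h) - integral {s + i * h..s + Suc i * h} ?x) \<le> (\<Sum>i<Suc n. integral {s + i * h..s + Suc i * h} (\<lambda>v. \<bar>?x v - ?x (s + Suc i * h)\<bar>))"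
    proof (rule order_trans[OF norm_sum sum_mono])
      fix i assume "i \<in> {..<Suc n}"
      then have i: "i < Suc n" by simp
      let ?J = "{s + i * h..s + Suc i * h}"
      have "integral ?J (\<lambda>v. ?x v - ?x (s + Suc i * h)) = integral ?J ?x - h * ?x (s + Suc i * h)"
        using h integral_diff[OF integrable_continuous_interval[OF cont[OF i]] integrable_const_ivl, of "?x (s + Suc i * h)"]
        by (simp add: algebra_simps)
      moreover have "norm (integral ?J (\<lambda>v. ?x v - ?x (s + Suc i * h))) \<le> integral ?J (\<lambda>v. \<bar>?x v - ?x (s + Suc i * h)\<bar>)"
        by (intro integral_norm_bound_integral integrable_continuous_interval continuous_intros cont i) auto
      ultimately show "norm (h * ?x (s + Suc i * h) - integral ?J ?x) \<le> integral ?J (\<lambda>v. \<bar>?x v - ?x (s + Suc i * h)\<bar>)"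
        by simp
    qed
    then show "norm ((t - s) / Suc n * (\<Sum>i<Suc n. ?x (s + Suc i * ((t - s) / Suc n))) - IR s t \<omega>)
      \<le> (\<Sum>i<Suc n. integral {s + i * ((t - s) / Suc n)..s + Suc i * ((t - s) / Suc n)} (\<lambda>v. \<bar>?x v - ?x (s + Suc i * ((t - s) / Suc n))\<bar>))"
      unfolding eq[unfolded h_def] h_def .
  qed
  then show ?thesis by (simp add: LIM_zero_iff)
qed

lemma grid_point_le:
  fixes s t :: real
  assumes "s < t" "i \<le> Suc n"
  shows "s + i * ((t - s) / Suc n) \<le> t"
proof -
  have "i * ((t - s) / Suc n) \<le> Suc n * ((t - s) / Suc n)" using assms by (intro mult_right_mono) auto
  then show ?thesis by simp
qed

text \<open>A Riemann sum of \<open>c * IR s t\<close> has total coefficient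
  \<open>c * (t - s)\<close>, exactly the quantity that \<open>exp_moment_sum\<close> restricts;
  Fatou passes to the integral. All later restrictions to short intervals come from this condition
  and its discrete counterpart.\<close>

lemma exp_moment_integral:
  assumes st: "0 \<le> s" "s < t" "t \<le> T" and c: "c * (t - s) \<le> 2 * \<kappa>"
  shows "(\<integral>\<^sup>+\<omega>. ennreal (exp (c * IR s t \<omega>)) \<partial>M) \<le> ennreal (moment_bound T)"
proof -
  define X where "X n \<omega> = c * ((t - s) / Suc n * (\<Sum>i<Suc n. R (s + Suc i * ((t - s) / Suc n)) \<omega>))" for n \<omega>
  have pt: "0 \<le> s + Suc i * ((t - s) / Suc n)" "s + Suc i * ((t - s) / Suc n) \<le> t" if "i < Suc n" for i n
    using grid_point_le[of s t "Suc i" n] st that by (auto intro!: add_nonneg_nonneg)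
  have [measurable]: "X n \<in> borel_measurable M" for n
    unfolding X_def[abs_def] using pt by (intro borel_measurable_times borel_measurable_sum borel_measurable_const R_random) auto
  have "AE \<omega> in M. (\<lambda>n. ennreal (exp (X n \<omega>))) \<longlonglongrightarrow> ennreal (exp (c * IR s t \<omega>))"
    unfolding X_def by (rule AE_I2) (intro tendsto_ennrealI tendsto_intros IR_riemann st)
  then have "(\<integral>\<^sup>+\<omega>. ennreal (exp (c * IR s t \<omega>)) \<partial>M) = (\<integral>\<^sup>+\<omega>. liminf (\<lambda>n. ennreal (exp (X n \<omega>))) \<partial>M)"
    by (rule nn_integral_cong_AE[OF AE_mp]) (auto intro!: AE_I2 lim_imp_Liminf[symmetric] simp del: tendsto_ennreal_iff)
  also have "\<dots> \<le> liminf (\<lambda>n. \<integral>\<^sup>+\<omega>. ennreal (exp (X n \<omega>)) \<partial>M)" by (rule nn_integral_liminf) simp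
  also have "\<dots> \<le> ennreal (moment_bound T)"
  proof (rule order_trans[OF Liminf_le_Limsup Limsup_bounded], simp, intro always_eventually allI)
    fix n
    have "(\<integral>\<^sup>+\<omega>. ennreal (exp ((c * ((t - s) / Suc n)) * (\<Sum>i<Suc n. R (s + Suc i * ((t - s) / Suc n)) \<omega>))) \<partial>M) \<le> ennreal (moment_bound T)"
    proof (rule exp_moment_sum[where n = "Suc n" and u = "\<lambda>i. s + Suc i * ((t - s) / Suc n)"])
      show "0 \<le> s + Suc i * ((t - s) / Suc n) \<and> s + Suc i * ((t - s) / Suc n) \<le> T" if "i < Suc n" for i
        using pt[OF that] st by linarith
      show "c * ((t - s) / Suc n) * Suc n \<le> 2 * \<kappa>" using c by (simp del: of_nat_Suc)
    qed
    then show "(\<integral>\<^sup>+\<omega>. ennreal (exp (X n \<omega>)) \<partial>M) \<le> ennreal (moment_bound T)" by (simp only: mult.assoc X_def)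
  qed
  finally show ?thesis .
qed

end

section \<open>Stochastic exponentials of constant multiples of sqrt R\<close>

context cir_process
begin

text \<open>The stochastic exponential over [s,t] of the integrand \<open>- b * sqrt R\<close>, with
  the increment of \<open>mart\<close> expressed through R, \<theta> and \<open>IR\<close>. In this
  form it is visibly known at time t and combines algebraically with
  \<open>riccati_exp\<close>.\<close>

definition exp_step_factor :: "real \<Rightarrow> real \<Rightarrow> real \<Rightarrow> 'a \<Rightarrow> real" where
  "exp_step_factor s t b \<omega> =
     exp (- b * (R t \<omega> - R s \<omega> - \<kappa> * integral {s..t} \<theta> + \<kappa> * IR s t \<omega>) - b\<^sup>2 / 2 * IR s t \<omega>)"

lemma exp_step_factor_measurable:
  assumes "0 \<le> s" "s \<le> t"
  shows "exp_step_factor s t b \<in> borel_measurable (F t)"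
proof -
  have [measurable]: "R t \<in> borel_measurable (F t)" "R s \<in> borel_measurable (F t)" "IR s t \<in> borel_measurable (F t)"
    using assms by (auto intro: R_measurable IR_measurable F_mono[OF _ R_measurable])
  show ?thesis unfolding exp_step_factor_def[abs_def] by measurable
qed

lemma mart_0: "\<omega> \<in> space M \<Longrightarrow> R 0 \<omega> = R\<^sub>0 \<Longrightarrow> mart 0 \<omega> = 0"
  by (simp add: mart_eq IR_eq)

lemma exp_step_factor_eq:
  assumes "\<omega> \<in> space M" "0 \<le> s" "s \<le> t"
  shows "exp_step_factor s t b \<omega> = exp ((- b) * (mart t \<omega> - mart s \<omega>) - (- b)\<^sup>2 * IR s t \<omega> / 2)"
proof -
  have "integral {0..t} \<theta> = integral {0..s} \<theta> + integral {s..t} \<theta>"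
    using assms Henstock_Kurzweil_Integration.integral_combine[of 0 s t \<theta>]
    by (simp add: integrable_continuous_interval \<theta>_continuous)
  then have "mart t \<omega> - mart s \<omega> = R t \<omega> - R s \<omega> - \<kappa> * integral {s..t} \<theta> + \<kappa> * IR s t \<omega>"
    using assms by (simp add: mart_eq IR_split[of \<omega> s t] algebra_simps)
  then show ?thesis by (simp add: exp_step_factor_def)
qed

text \<open>An instance of \<open>elementary_exp_limit\<close>, with limits
  \<open>- b * (mart t - mart s)\<close> and \<open>b\<^sup>2 * IR s t\<close>. What has to be
  supplied is one sequence that works at both ends of the interval, and the exponential
  moment.\<close>

lemma exp_step_factor_bounded:
  assumes st: "0 \<le> s" "s < t" "t \<le> T" and b: "6 * b\<^sup>2 * (t - s) \<le> 2 * \<kappa>"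
    and Y: "Y \<in> borel_measurable (F s)" "\<And>\<omega>. 0 \<le> Y \<omega>" "\<And>\<omega>. Y \<omega> \<le> C"
  shows "(\<integral>\<^sup>+\<omega>. ennreal (Y \<omega> * exp_step_factor s t b \<omega>) \<partial>M) = (\<integral>\<^sup>+\<omega>. ennreal (Y \<omega>) \<partial>M)"
proof -
  have t0: "0 \<le> t" using st by simp
  from ito_sequence[OF t0] obtain n p \<xi> where si: "\<And>k::nat. simple_integrand M F (n k) (p k) (\<xi> k)"
    and D: "AE \<omega> in M. (\<lambda>k. LBINT u:{0..t}. (simple_process (n k) (p k) (\<xi> k) u \<omega> - sqrt (R u \<omega>))\<^sup>2) \<longlonglongrightarrow> 0"
    and S: "AE \<omega> in M. (\<lambda>k. simple_ito_integral Z (n k) (p k) (\<xi> k) t \<omega>) \<longlonglongrightarrow> mart t \<omega>"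
    by blast
  have G: "continuous_on {0..t} (\<lambda>u. sqrt (R u \<omega>))" if "\<omega> \<in> space M" for \<omega>
    using that by (intro continuous_intros R_continuous) auto
  \<comment> \<open>The sequences attached to the times t and s need not be related. On [0,s] their
    difference has vanishing quadratic variation, so its integral tends to 0 in probability, and a
    subsequence of the sequence for t converges to \<open>mart s\<close> at time s.\<close>
  have "\<exists>r::nat \<Rightarrow> nat. strict_mono r \<and> (AE \<omega> in M. (\<lambda>k. simple_ito_integral Z (n (r k)) (p (r k)) (\<xi> (r k)) s \<omega>) \<longlonglongrightarrow> mart s \<omega>)"
  proof (cases "s = 0")
    case True
    have "AE \<omega> in M. (\<lambda>k. simple_ito_integral Z (n k) (p k) (\<xi> k) s \<omega>) \<longlonglongrightarrow> mart s \<omega>"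
      using good_path by eventually_elim (simp add: True simple_ito_integral_0[OF si] mart_0)
    then show ?thesis by (intro exI[of _ id]) (auto simp: strict_mono_id)
  next
    case False
    with st have s0: "0 < s" by simp
    from ito_sequence[OF st(1)] obtain n' p' \<xi>' where si': "\<And>k::nat. simple_integrand M F (n' k) (p' k) (\<xi>' k)"
      and D': "AE \<omega> in M. (\<lambda>k. LBINT u:{0..s}. (simple_process (n' k) (p' k) (\<xi>' k) u \<omega> - sqrt (R u \<omega>))\<^sup>2) \<longlonglongrightarrow> 0"
      and S': "AE \<omega> in M. (\<lambda>k. simple_ito_integral Z (n' k) (p' k) (\<xi>' k) s \<omega>) \<longlonglongrightarrow> mart s \<omega>"
      by blast
    let ?\<Delta> = "\<lambda>k \<omega>. 1 * (simple_ito_integral Z (n k) (p k) (\<xi> k) s \<omega> - simple_ito_integral Z (n k) (p k) (\<xi> k) 0 \<omega>) +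
          (-1) * (simple_ito_integral Z (n' k) (p' k) (\<xi>' k) s \<omega> - simple_ito_integral Z (n' k) (p' k) (\<xi>' k) 0 \<omega>)"
    have "tendsto_in_prob M ?\<Delta> (\<lambda>_. 0)"
    proof (rule elementary_null)
      show "elementary 0 s (?\<Delta> k) (\<lambda>\<omega>. LBINT u:{0..s}. (1 * simple_process (n k) (p k) (\<xi> k) u \<omega> +
          (-1) * simple_process (n' k) (p' k) (\<xi>' k) u \<omega>)\<^sup>2)" for k
        by (rule simple_pair_elementary[OF si si' order_refl s0])
      show "AE \<omega> in M. (\<lambda>k. LBINT u:{0..s}. (1 * simple_process (n k) (p k) (\<xi> k) u \<omega> +
          (-1) * simple_process (n' k) (p' k) (\<xi>' k) u \<omega>)\<^sup>2) \<longlonglongrightarrow> 0"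
        using D D' good_path
      proof eventually_elim
        case (elim \<omega>)
        have "\<omega> \<in> space M" "s \<le> t" using elim st by auto
        from simple_diff_limit[OF G[OF this(1)] st(1) this(2) elim(1,2)] show ?case by (simp only: mult_1_left)
      qed
    qed
    from tendsto_in_prob_AE_subseq[OF this] obtain r where r: "strict_mono r"
      "AE \<omega> in M. (\<lambda>k. ?\<Delta> (r k) \<omega>) \<longlonglongrightarrow> 0" by blast
    have "AE \<omega> in M. (\<lambda>k. simple_ito_integral Z (n (r k)) (p (r k)) (\<xi> (r k)) s \<omega>) \<longlonglongrightarrow> mart s \<omega>"
      using r(2) AE_lim_subseq[OF S' r(1)]
    proof eventually_elim
      case (elim \<omega>)
      from tendsto_add[OF elim] show ?case by (simp add: simple_ito_integral_0[OF si] simple_ito_integral_0[OF si'])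
    qed
    with r(1) show ?thesis by blast
  qed
  then obtain r where r: "strict_mono r"
    and Ss: "AE \<omega> in M. (\<lambda>k. simple_ito_integral Z (n (r k)) (p (r k)) (\<xi> (r k)) s \<omega>) \<longlonglongrightarrow> mart s \<omega>"
    by blast
  have St: "AE \<omega> in M. (\<lambda>k. simple_ito_integral Z (n (r k)) (p (r k)) (\<xi> (r k)) t \<omega>) \<longlonglongrightarrow> mart t \<omega>"
    by (rule AE_lim_subseq[OF S r])
  have Dr: "AE \<omega> in M. (\<lambda>k. LBINT u:{0..t}. (simple_process (n (r k)) (p (r k)) (\<xi> (r k)) u \<omega> - sqrt (R u \<omega>))\<^sup>2) \<longlonglongrightarrow> 0"
    by (rule AE_lim_subseq[OF D r])
  have [measurable]: "mart t \<in> borel_measurable M" "mart s \<in> borel_measurable M"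
    using ito[of t] ito[of s] st unfolding has_ito_integral_def tendsto_in_prob_def by auto
  have [measurable]: "IR s t \<in> borel_measurable M" using st by auto
  let ?I = "\<lambda>k u \<omega>. simple_ito_integral Z (n (r k)) (p (r k)) (\<xi> (r k)) u \<omega>"
  let ?h = "\<lambda>k u \<omega>. simple_process (n (r k)) (p (r k)) (\<xi> (r k)) u \<omega>"
  have "(\<integral>\<^sup>+\<omega>. ennreal (Y \<omega> * exp ((- b) * (mart t \<omega> - mart s \<omega>) - (- b)\<^sup>2 * IR s t \<omega> / 2)) \<partial>M) = (\<integral>\<^sup>+\<omega>. ennreal (Y \<omega>) \<partial>M)"
  proof (rule elementary_exp_limit[OF _ _ _ _ _ _ Y])
    show "elementary s t (\<lambda>\<omega>. (- b) * (?I k t \<omega> - ?I k s \<omega>) + 0 * (?I k t \<omega> - ?I k s \<omega>))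
      (\<lambda>\<omega>. LBINT u:{s..t}. ((- b) * ?h k u \<omega> + 0 * ?h k u \<omega>)\<^sup>2)" for k
      by (rule simple_pair_elementary[OF si si st(1,2)])
    show "AE \<omega> in M. (\<lambda>k. (- b) * (?I k t \<omega> - ?I k s \<omega>) + 0 * (?I k t \<omega> - ?I k s \<omega>)) \<longlonglongrightarrow> (- b) * (mart t \<omega> - mart s \<omega>)"
      using Ss St
    proof eventually_elim
      case (elim \<omega>)
      have "(\<lambda>k. (- b) * (?I k t \<omega> - ?I k s \<omega>)) \<longlonglongrightarrow> (- b) * (mart t \<omega> - mart s \<omega>)"
        by (intro tendsto_intros elim)
      then show ?case by simp
    qed
    show "AE \<omega> in M. (\<lambda>k. LBINT u:{s..t}. ((- b) * ?h k u \<omega> + 0 * ?h k u \<omega>)\<^sup>2) \<longlonglongrightarrow> (- b)\<^sup>2 * IR s t \<omega>"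
      using Dr good_path
    proof eventually_elim
      case (elim \<omega>)
      from elim simple_sq_limit[OF G[of \<omega>] st(1) elim(1)]
      have "(\<lambda>k. LBINT u:{s..t}. (?h k u \<omega>)\<^sup>2) \<longlonglongrightarrow> IR s t \<omega>"
        using st by (simp add: sq_integral_eq)
      then show ?case unfolding LBINT_scale_sq by (intro tendsto_intros)
    qed
    \<comment> \<open>The moment demanded by \<open>elementary_exp_limit\<close> is that of 6 times
      the quadratic variation \<open>b\<^sup>2 * IR s t\<close>; hence the smallness condition on
      \<open>6 * b\<^sup>2 * (t - s)\<close>.\<close>
    have "(\<integral>\<^sup>+\<omega>. ennreal (exp (6 * ((- b)\<^sup>2 * IR s t \<omega>))) \<partial>M) \<le> ennreal (moment_bound T)"
      using exp_moment_integral[OF st, of "6 * b\<^sup>2"] b by (simp add: mult.assoc)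
    then show "(\<integral>\<^sup>+\<omega>. ennreal (exp (6 * ((- b)\<^sup>2 * IR s t \<omega>))) \<partial>M) < \<top>"
      by (rule order_le_less_trans) simp
  qed simp_all
  moreover have "(\<integral>\<^sup>+\<omega>. ennreal (Y \<omega> * exp_step_factor s t b \<omega>) \<partial>M) =
      (\<integral>\<^sup>+\<omega>. ennreal (Y \<omega> * exp ((- b) * (mart t \<omega> - mart s \<omega>) - (- b)\<^sup>2 * IR s t \<omega> / 2)) \<partial>M)"
    using st by (intro nn_integral_cong) (simp add: exp_step_factor_eq)
  ultimately show ?thesis by simp
qed

text \<open>Monotone convergence along \<open>min Y k\<close> removes the bound on Y. The unbounded
  case is the one used for chaining, where Y contains the product of the preceding factors.\<close>

lemma exp_step_factor_expectation:
  assumes st: "0 \<le> s" "s < t" "t \<le> T" and b: "6 * b\<^sup>2 * (t - s) \<le> 2 * \<kappa>"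
    and Y: "Y \<in> borel_measurable (F s)"
  shows "(\<integral>\<^sup>+\<omega>. Y \<omega> * ennreal (exp_step_factor s t b \<omega>) \<partial>M) = (\<integral>\<^sup>+\<omega>. Y \<omega> \<partial>M)"
proof -
  have [measurable]: "Y \<in> borel_measurable M" "exp_step_factor s t b \<in> borel_measurable M"
    using Y exp_step_factor_measurable[of s t b] st measurable_F by auto
  define y where "y k \<omega> = enn2real (min (Y \<omega>) (of_nat k))" for k :: nat and \<omega>
  have y: "ennreal (y k \<omega>) = min (Y \<omega>) (of_nat k)" for k \<omega>
    unfolding y_def by (rule ennreal_enn2real) (auto simp: min_def of_nat_less_top intro: le_less_trans)
  have yF: "y k \<in> borel_measurable (F s)" for k unfolding y_def[abs_def] using Y by measurable
  have y_le: "y k \<omega> \<le> real k" for k \<omega>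
    unfolding y_def by (rule enn2real_leI) (auto simp: ennreal_of_nat_eq_real_of_nat)
  have sup: "(SUP k. min (Y \<omega>) (of_nat k)) = Y \<omega>" for \<omega>
    using inf_SUP[of "Y \<omega>" "\<lambda>k::nat. of_nat k :: ennreal" UNIV] by (simp add: ennreal_SUP_of_nat_eq_top inf_min)
  have mono: "incseq (\<lambda>k \<omega>. min (Y \<omega>) (of_nat k))"
    by (auto simp: incseq_def le_fun_def intro: min.coboundedI2)
  have "(\<integral>\<^sup>+\<omega>. Y \<omega> * ennreal (exp_step_factor s t b \<omega>) \<partial>M)
      = (\<integral>\<^sup>+\<omega>. (SUP k. min (Y \<omega>) (of_nat k) * ennreal (exp_step_factor s t b \<omega>)) \<partial>M)"
    by (simp add: SUP_mult_right_ennreal[symmetric] sup)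
  also have "\<dots> = (SUP k. \<integral>\<^sup>+\<omega>. min (Y \<omega>) (of_nat k) * ennreal (exp_step_factor s t b \<omega>) \<partial>M)"
    using mono by (intro nn_integral_monotone_convergence_SUP) (auto simp: incseq_def le_fun_def intro!: mult_right_mono)
  also have "\<dots> = (SUP k. \<integral>\<^sup>+\<omega>. min (Y \<omega>) (of_nat k) \<partial>M)"
  proof (rule SUP_cong[OF refl])
    fix k
    have "(\<integral>\<^sup>+\<omega>. ennreal (y k \<omega> * exp_step_factor s t b \<omega>) \<partial>M) = (\<integral>\<^sup>+\<omega>. ennreal (y k \<omega>) \<partial>M)"
      by (rule exp_step_factor_bounded[OF st b yF _ y_le]) (simp add: y_def)
    moreover have "ennreal (y k \<omega> * exp_step_factor s t b \<omega>) = min (Y \<omega>) (of_nat k) * ennreal (exp_step_factor s t b \<omega>)" for \<omega>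
      unfolding y[symmetric] by (rule ennreal_mult) (simp_all add: y_def exp_step_factor_def)
    ultimately show "(\<integral>\<^sup>+\<omega>. min (Y \<omega>) (of_nat k) * ennreal (exp_step_factor s t b \<omega>) \<partial>M) = (\<integral>\<^sup>+\<omega>. min (Y \<omega>) (of_nat k) \<partial>M)"
      by (simp only: y)
  qed
  also have "\<dots> = (\<integral>\<^sup>+\<omega>. (SUP k. min (Y \<omega>) (of_nat k)) \<partial>M)"
    using mono by (intro nn_integral_monotone_convergence_SUP[symmetric]) auto
  finally show ?thesis by (simp add: sup)
qed

text \<open>Induction from the left: the factors of the earlier steps are known at the start of the
  next step and are absorbed into its weight.\<close>

lemma exp_step_factor_prod:
  fixes u b :: "nat \<Rightarrow> real"
  assumes u: "0 \<le> u 0" "\<forall>i<n. u i < u (Suc i)" "u n \<le> T"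
    and b: "\<And>i. i < n \<Longrightarrow> 6 * (b i)\<^sup>2 * (u (Suc i) - u i) \<le> 2 * \<kappa>"
    and Y: "Y \<in> borel_measurable (F (u 0))"
  shows "(\<integral>\<^sup>+\<omega>. Y \<omega> * ennreal (\<Prod>i<n. exp_step_factor (u i) (u (Suc i)) (b i) \<omega>) \<partial>M) = (\<integral>\<^sup>+\<omega>. Y \<omega> \<partial>M)"
proof -
  have "(\<integral>\<^sup>+\<omega>. Y \<omega> * ennreal (\<Prod>i<m. exp_step_factor (u i) (u (Suc i)) (b i) \<omega>) \<partial>M) = (\<integral>\<^sup>+\<omega>. Y \<omega> \<partial>M)"
    if "m \<le> n" for m
    using that
  proof (induction m)
    case (Suc m)
    have um: "0 \<le> u m" "u m < u (Suc m)" "u (Suc m) \<le> T"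
      using u Suc.prems grid_ge[OF u(2), of 0 m] grid_ge[OF u(2), of "Suc m" n] by auto
    have e: "exp_step_factor (u i) (u (Suc i)) (b i) \<in> borel_measurable (F (u m))" if "i < m" for i
      using that u Suc.prems grid_ge[OF u(2), of 0 i] grid_ge[OF u(2), of i "Suc i"] grid_ge[OF u(2), of "Suc i" m]
      by (intro F_mono[OF _ exp_step_factor_measurable]) auto
    have YF: "Y \<in> borel_measurable (F (u m))"
      using Suc.prems grid_ge[OF u(2), of 0 m] by (intro F_mono[OF _ Y]) auto
    have "(\<lambda>\<omega>. \<Prod>i<m. exp_step_factor (u i) (u (Suc i)) (b i) \<omega>) \<in> borel_measurable (F (u m))"
      by (intro borel_measurable_prod e) simp
    then have W: "(\<lambda>\<omega>. Y \<omega> * ennreal (\<Prod>i<m. exp_step_factor (u i) (u (Suc i)) (b i) \<omega>)) \<in> borel_measurable (F (u m))"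
      using YF by measurable
    have pos: "0 \<le> (\<Prod>i<m. exp_step_factor (u i) (u (Suc i)) (b i) \<omega>)" for \<omega>
      by (intro prod_nonneg) (simp add: exp_step_factor_def)
    have "(\<integral>\<^sup>+\<omega>. Y \<omega> * ennreal (\<Prod>i<Suc m. exp_step_factor (u i) (u (Suc i)) (b i) \<omega>) \<partial>M)
      = (\<integral>\<^sup>+\<omega>. (Y \<omega> * ennreal (\<Prod>i<m. exp_step_factor (u i) (u (Suc i)) (b i) \<omega>)) * ennreal (exp_step_factor (u m) (u (Suc m)) (b m) \<omega>) \<partial>M)"
      using pos by (intro nn_integral_cong) (simp add: ennreal_mult mult.assoc exp_step_factor_def)
    also have "\<dots> = (\<integral>\<^sup>+\<omega>. Y \<omega> * ennreal (\<Prod>i<m. exp_step_factor (u i) (u (Suc i)) (b i) \<omega>) \<partial>M)"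
      using Suc.prems by (intro exp_step_factor_expectation[OF um b W]) auto
    finally show ?case using Suc by simp
  qed simp
  then show ?thesis by simp
qed

end

subsection \<open>The Riccati weight\<close>

text \<open>The weight is kept abstract. Its differential equation, its sign and the bound
  \<open>A\<close> drive the whole argument; the closed formula for f enters only when the locale is
  interpreted.\<close>

locale cir_riccati = cir_process +
  fixes a :: "real \<Rightarrow> real" and \<gamma> T A :: real
  assumes T_nonneg: "0 \<le> T" and \<gamma>_nonneg: "0 \<le> \<gamma>"
    and riccati: "\<And>u. u \<in> {0..T} \<Longrightarrow> (a has_real_derivative \<kappa> * a u + (a u)\<^sup>2 / 2 - \<gamma>) (at u within {0..T})"
    and a_nonneg: "\<And>u. u \<in> {0..T} \<Longrightarrow> 0 \<le> a u" and a_le: "\<And>u. u \<in> {0..T} \<Longrightarrow> a u \<le> A"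
begin

definition slope :: "real \<Rightarrow> real" where
  "slope x = \<kappa> * x + x\<^sup>2 / 2 - \<gamma>"

definition slope_bound :: real where
  "slope_bound = \<kappa> * A + A\<^sup>2 / 2 + \<gamma>"

lemma A_nonneg: "0 \<le> A"
  using a_nonneg[of 0] a_le[of 0] T_nonneg by auto

lemma a_continuous: "0 \<le> u \<Longrightarrow> v \<le> T \<Longrightarrow> continuous_on {u..v} a"
  by (rule continuous_on_subset[OF DERIV_continuous_on[OF riccati]]) auto

lemma slope_bound_nonneg: "0 \<le> slope_bound"
  unfolding slope_bound_def using \<kappa>_pos A_nonneg \<gamma>_nonneg by simp

lemma slope_le: "u \<in> {0..T} \<Longrightarrow> \<bar>slope (a u)\<bar> \<le> slope_bound"
proof -
  assume u: "u \<in> {0..T}"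
  have "\<kappa> * a u \<le> \<kappa> * A" "(a u)\<^sup>2 \<le> A\<^sup>2" "0 \<le> \<kappa> * a u"
    using a_nonneg[OF u] a_le[OF u] \<kappa>_pos by (auto intro: mult_left_mono power_mono)
  then show ?thesis using \<gamma>_nonneg zero_le_power2[of "a u"] zero_le_power2[of A]
    unfolding slope_def slope_bound_def abs_le_iff by linarith
qed

lemma a_mvt:
  assumes "0 \<le> u" "u < v" "v \<le> T"
  shows "\<exists>w\<in>{u<..<v}. a v - a u = slope (a w) * (v - u)"
proof -
  have "\<exists>w\<in>{u<..<v}. a v - a u = (*) (slope (a w)) (v - u)"
  proof (rule mvt_simple[OF assms(2)])
    fix w assume "u \<le> w" "w \<le> v"
    then have "w \<in> {0..T}" "{u..v} \<subseteq> {0..T}" using assms by auto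
    then have "(a has_real_derivative slope (a w)) (at w within {u..v})"
      unfolding slope_def by (rule DERIV_subset[OF riccati])
    then show "(a has_derivative (*) (slope (a w))) (at w within {u..v})"
      by (simp add: has_field_derivative_def)
  qed
  then show ?thesis by simp
qed

lemma a_lipschitz:
  assumes "0 \<le> u" "u \<le> v" "v \<le> T"
  shows "\<bar>a v - a u\<bar> \<le> slope_bound * (v - u)"
proof (cases "u = v")
  case False
  then obtain w where "w \<in> {u<..<v}" "a v - a u = slope (a w) * (v - u)"
    using a_mvt[of u v] assms by auto
  then show ?thesis
    using slope_le[of w] assms by (simp add: abs_mult mult_right_mono)
qed simp

text \<open>On [0,A] the function \<open>slope\<close> is Lipschitz with constant
  \<open>\<kappa> + A\<close>, and \<open>a\<close> is Lipschitz with constant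
  \<open>slope_bound\<close>, so moving the slope from the mean value point to u costs a quadratic
  term. Summed over a grid, such terms are of the order of the mesh.\<close>

lemma a_second_order:
  assumes "0 \<le> u" "u < v" "v \<le> T"
  shows "\<bar>a v - a u - slope (a u) * (v - u)\<bar> \<le> (\<kappa> + A) * slope_bound * (v - u)\<^sup>2"
proof -
  obtain w where w: "w \<in> {u<..<v}" "a v - a u = slope (a w) * (v - u)"
    using a_mvt[OF assms] by auto
  have aw: "0 \<le> a w" "a w \<le> A" "0 \<le> a u" "a u \<le> A" using a_nonneg a_le assms w(1) by auto
  have "slope (a w) - slope (a u) = (\<kappa> + (a w + a u) / 2) * (a w - a u)"
    by (simp add: slope_def power2_eq_square field_simps)
  then have "\<bar>slope (a w) - slope (a u)\<bar> = (\<kappa> + (a w + a u) / 2) * \<bar>a w - a u\<bar>"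
    using aw \<kappa>_pos by (simp add: abs_mult)
  also have "\<dots> \<le> (\<kappa> + A) * (slope_bound * (v - u))"
  proof (rule mult_mono)
    have "\<bar>a w - a u\<bar> \<le> slope_bound * (w - u)" using a_lipschitz[of u w] assms w(1) by auto
    also have "\<dots> \<le> slope_bound * (v - u)" using w(1) slope_bound_nonneg by (intro mult_left_mono) auto
    finally show "\<bar>a w - a u\<bar> \<le> slope_bound * (v - u)" .
  qed (use aw \<kappa>_pos in auto)
  finally have "\<bar>slope (a w) - slope (a u)\<bar> * (v - u) \<le> (\<kappa> + A) * (slope_bound * (v - u)) * (v - u)"
    using assms by (intro mult_right_mono) auto
  moreover have "a v - a u - slope (a u) * (v - u) = (slope (a w) - slope (a u)) * (v - u)"
    using w(2) by (simp add: algebra_simps)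
  ultimately show ?thesis using assms by (simp add: abs_mult power2_eq_square mult.assoc)
qed

text \<open>The process W. At \<open>u = T\<close> the last integral is zero; at
  \<open>u = 0\<close> the exponent is almost surely deterministic. Equality of the expectations at
  these two times is therefore the transform.\<close>

definition riccati_exp :: "real \<Rightarrow> 'a \<Rightarrow> real" where
  "riccati_exp u \<omega> = exp (- a u * R u \<omega> - \<gamma> * IR 0 u \<omega> - \<kappa> * integral {u..T} (\<lambda>w. a w * \<theta> w))"

text \<open>The logarithm of W v / W u minus the logarithm of the stochastic exponential with the
  weight frozen at \<open>a u\<close>. Its first two terms cancel to first order, since
  \<open>a v - a u\<close> is close to \<open>slope (a u) * (v - u)\<close> and
  \<open>IR u v\<close> is close to \<open>(v - u) * R v\<close>.\<close>

definition defect :: "real \<Rightarrow> real \<Rightarrow> 'a \<Rightarrow> real" where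
  "defect u v \<omega> = - (a v - a u) * R v \<omega> + slope (a u) * IR u v \<omega> + \<kappa> * integral {u..v} (\<lambda>w. (a w - a u) * \<theta> w)"

lemma riccati_exp_measurable: "0 \<le> u \<Longrightarrow> riccati_exp u \<in> borel_measurable (F u)"
  unfolding riccati_exp_def[abs_def] using R_measurable[of u] IR_measurable[of 0 u] by measurable

lemma riccati_exp_le_1:
  assumes "\<forall>t\<ge>0. 0 \<le> R t \<omega>" "u \<in> {0..T}"
  shows "riccati_exp u \<omega> \<le> 1"
proof -
  have "0 \<le> integral {u..T} (\<lambda>w. a w * \<theta> w)"
    using assms(2) by (intro integral_nonneg integrable_continuous_interval continuous_intros a_continuous \<theta>_continuous)
      (auto intro!: mult_nonneg_nonneg a_nonneg \<theta>_nonneg)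
  then have "0 \<le> a u * R u \<omega> + \<gamma> * IR 0 u \<omega> + \<kappa> * integral {u..T} (\<lambda>w. a w * \<theta> w)"
    using assms \<kappa>_pos \<gamma>_nonneg by (intro add_nonneg_nonneg mult_nonneg_nonneg a_nonneg IR_nonneg) auto
  then show ?thesis by (simp add: riccati_exp_def)
qed

text \<open>An algebraic identity. The coefficient of \<open>IR u v\<close> collects \<kappa> a u
  from the drift, half the square of \<open>a u\<close> from the quadratic variation and - \<gamma>
  from W: this is the origin of the right-hand side of the Riccati equation.\<close>

lemma riccati_exp_step:
  assumes \<omega>: "\<omega> \<in> space M" and uv: "0 \<le> u" "u < v" "v \<le> T"
  shows "riccati_exp u \<omega> * exp_step_factor u v (a u) \<omega> = riccati_exp v \<omega> * exp (- defect u v \<omega>)"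
proof -
  have int: "(\<lambda>w. a w * \<theta> w) integrable_on {x..y}" if "0 \<le> x" "y \<le> T" for x y
    using that by (intro integrable_continuous_interval continuous_intros a_continuous \<theta>_continuous)
  have 1: "integral {u..T} (\<lambda>w. a w * \<theta> w) = integral {u..v} (\<lambda>w. a w * \<theta> w) + integral {v..T} (\<lambda>w. a w * \<theta> w)"
    using uv by (intro Henstock_Kurzweil_Integration.integral_combine[symmetric] int) auto
  have "integral {u..v} (\<lambda>w. (a w - a u) * \<theta> w) = integral {u..v} (\<lambda>w. a w * \<theta> w - a u * \<theta> w)"
    by (simp add: left_diff_distrib)
  also have "\<dots> = integral {u..v} (\<lambda>w. a w * \<theta> w) - a u * integral {u..v} \<theta>"
  proof -
    have "(\<lambda>w. a u * \<theta> w) integrable_on {u..v}"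
      by (intro integrable_continuous_interval continuous_intros \<theta>_continuous uv)
    from integral_diff[OF int[OF uv(1,3)] this] show ?thesis by simp
  qed
  finally have 2: "integral {u..v} (\<lambda>w. (a w - a u) * \<theta> w) = integral {u..v} (\<lambda>w. a w * \<theta> w) - a u * integral {u..v} \<theta>" .
  have 3: "IR 0 v \<omega> = IR 0 u \<omega> + IR u v \<omega>" using uv by (intro IR_split \<omega>) auto
  show ?thesis
    unfolding riccati_exp_def exp_step_factor_def defect_def exp_add[symmetric] 1 2 3 slope_def
    by (simp add: algebra_simps)
qed

lemma IR_approx:
  assumes \<omega>: "\<omega> \<in> space M" and uv: "0 \<le> u" "u < v"
  shows "\<bar>IR u v \<omega> - (v - u) * R v \<omega>\<bar> \<le> integral {u..v} (\<lambda>w. \<bar>R w \<omega> - R v \<omega>\<bar>)"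
proof -
  have R: "continuous_on {u..v} (\<lambda>w. R w \<omega>)" using \<omega> uv by (intro R_continuous)
  have "integral {u..v} (\<lambda>w. R w \<omega> - R v \<omega>) = IR u v \<omega> - (v - u) * R v \<omega>"
    using uv integral_diff[OF integrable_continuous_interval[OF R] integrable_const_ivl, of "R v \<omega>"]
    by (simp add: IR_eq \<omega>)
  moreover have "norm (integral {u..v} (\<lambda>w. R w \<omega> - R v \<omega>)) \<le> integral {u..v} (\<lambda>w. \<bar>R w \<omega> - R v \<omega>\<bar>)"
    by (intro integral_norm_bound_integral integrable_continuous_interval continuous_intros R) auto
  ultimately show ?thesis by simp
qed

text \<open>Each term of the bound must still be small after summation over a grid: the quadratic
  ones by the mesh, the oscillation integral by \<open>riemann_error_limit\<close>. The constant is
  the same for all outcomes; the path enters only through \<open>R v\<close> and its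
  oscillation.\<close>

lemma defect_bound:
  "\<exists>C\<ge>0. \<forall>u v \<omega>. 0 \<le> u \<longrightarrow> u < v \<longrightarrow> v \<le> T \<longrightarrow> \<omega> \<in> space M \<longrightarrow> (\<forall>t\<ge>0. 0 \<le> R t \<omega>) \<longrightarrow>
    \<bar>defect u v \<omega>\<bar> \<le> C * ((v - u)\<^sup>2 * R v \<omega> + (v - u)\<^sup>2 + integral {u..v} (\<lambda>w. \<bar>R w \<omega> - R v \<omega>\<bar>))"
proof -
  obtain m where m: "m \<in> {0..T}" "\<And>w. w \<in> {0..T} \<Longrightarrow> \<theta> w \<le> \<theta> m"
    using continuous_attains_sup[OF compact_Icc _ \<theta>_continuous[of 0 T]] T_nonneg by auto
  have m0: "0 \<le> \<theta> m" using m(1) by (auto intro: \<theta>_nonneg)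
  define C where "C = (\<kappa> + A) * slope_bound + slope_bound + \<kappa> * slope_bound * \<theta> m"
  have c: "0 \<le> (\<kappa> + A) * slope_bound" "0 \<le> \<kappa> * slope_bound * \<theta> m"
    using \<kappa>_pos A_nonneg slope_bound_nonneg m0 by auto
  have C: "0 \<le> C" unfolding C_def using c slope_bound_nonneg by linarith
  have "\<bar>defect u v \<omega>\<bar> \<le> C * ((v - u)\<^sup>2 * R v \<omega> + (v - u)\<^sup>2 + integral {u..v} (\<lambda>w. \<bar>R w \<omega> - R v \<omega>\<bar>))"
    if uv: "0 \<le> u" "u < v" "v \<le> T" and \<omega>: "\<omega> \<in> space M" and nn: "\<forall>t\<ge>0. 0 \<le> R t \<omega>" for u v \<omega>
  proof -
    let ?h = "v - u" and ?e = "integral {u..v} (\<lambda>w. \<bar>R w \<omega> - R v \<omega>\<bar>)"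
    have Rv: "0 \<le> R v \<omega>" using nn uv by auto
    have e: "0 \<le> ?e" using IR_approx[OF \<omega> uv(1,2)] by linarith
    have i1: "\<bar>(a v - a u - slope (a u) * ?h) * R v \<omega>\<bar> \<le> (\<kappa> + A) * slope_bound * (?h\<^sup>2 * R v \<omega>)"
      unfolding abs_mult using mult_right_mono[OF a_second_order[OF uv] Rv] Rv by (simp add: mult.assoc)
    have i2: "\<bar>slope (a u) * (IR u v \<omega> - ?h * R v \<omega>)\<bar> \<le> slope_bound * ?e"
      unfolding abs_mult using uv \<omega> slope_bound_nonneg by (intro mult_mono slope_le IR_approx) auto
    have i3: "\<bar>\<kappa> * integral {u..v} (\<lambda>w. (a w - a u) * \<theta> w)\<bar> \<le> \<kappa> * slope_bound * \<theta> m * ?h\<^sup>2"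
    proof -
      have "norm (integral {u..v} (\<lambda>w. (a w - a u) * \<theta> w)) \<le> slope_bound * ?h * \<theta> m * (v - u)"
      proof (rule integral_bound)
        fix w assume w: "w \<in> {u..v}"
        have "\<bar>a w - a u\<bar> \<le> slope_bound * (w - u)" using w uv by (intro a_lipschitz) auto
        also have "\<dots> \<le> slope_bound * ?h" using w slope_bound_nonneg by (intro mult_left_mono) auto
        finally have "\<bar>a w - a u\<bar> * \<bar>\<theta> w\<bar> \<le> slope_bound * ?h * \<theta> m"
          using m(2)[of w] \<theta>_nonneg[of w] w uv slope_bound_nonneg by (intro mult_mono) auto
        then show "norm ((a w - a u) * \<theta> w) \<le> slope_bound * ?h * \<theta> m" by (simp add: abs_mult)
      next
        show "continuous_on {u..v} (\<lambda>w. (a w - a u) * \<theta> w)"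
          using uv by (intro continuous_intros a_continuous \<theta>_continuous) auto
      qed (use uv in simp)
      from mult_left_mono[OF this, of \<kappa>] \<kappa>_pos show ?thesis
        by (simp add: abs_mult power2_eq_square mult.assoc mult.left_commute)
    qed
    \<comment> \<open>Adding and subtracting \<open>slope (a u) * (v - u) * R v\<close> separates
      the Taylor error of \<open>a\<close> from the quadrature error of
      \<open>IR u v\<close>.\<close>
    have "defect u v \<omega> = - ((a v - a u - slope (a u) * ?h) * R v \<omega>) + slope (a u) * (IR u v \<omega> - ?h * R v \<omega>) +
        \<kappa> * integral {u..v} (\<lambda>w. (a w - a u) * \<theta> w)"
      unfolding defect_def by (simp add: algebra_simps)
    then have "\<bar>defect u v \<omega>\<bar> \<le> (\<kappa> + A) * slope_bound * (?h\<^sup>2 * R v \<omega>) + slope_bound * ?e + \<kappa> * slope_bound * \<theta> m * ?h\<^sup>2"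
      using i1 i2 i3 by linarith
    also have "\<dots> \<le> C * (?h\<^sup>2 * R v \<omega>) + C * ?e + C * ?h\<^sup>2"
      using c slope_bound_nonneg Rv e by (intro add_mono mult_right_mono) (auto simp: C_def)
    finally show ?thesis by (simp add: algebra_simps)
  qed
  with C show ?thesis by blast
qed

text \<open>On each grid the product of frozen factors is an exact identity in expectation; the grid
  is then refined. The interval length is fixed in advance so that all exponential moments needed on
  the way exist uniformly in the mesh and in the position of the interval.\<close>

lemma riccati_exp_short_interval:
  "\<exists>\<delta>>0. \<forall>s t. 0 \<le> s \<longrightarrow> s \<le> t \<longrightarrow> t \<le> T \<longrightarrow> t - s \<le> \<delta> \<longrightarrow>
    (\<integral>\<^sup>+\<omega>. ennreal (riccati_exp t \<omega>) \<partial>M) = (\<integral>\<^sup>+\<omega>. ennreal (riccati_exp s \<omega>) \<partial>M)"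
proof -
  obtain C where C: "0 \<le> C" and defect: "\<And>u v \<omega>. 0 \<le> u \<Longrightarrow> u < v \<Longrightarrow> v \<le> T \<Longrightarrow> \<omega> \<in> space M \<Longrightarrow> (\<forall>t\<ge>0. 0 \<le> R t \<omega>) \<Longrightarrow>
    \<bar>defect u v \<omega>\<bar> \<le> C * ((v - u)\<^sup>2 * R v \<omega> + (v - u)\<^sup>2 + integral {u..v} (\<lambda>w. \<bar>R w \<omega> - R v \<omega>\<bar>))"
    using defect_bound by blast
  define D where "D = 6 * A\<^sup>2 + 4 * C * (T + 1) + 1"
  have CT: "0 \<le> C * T" using C T_nonneg by simp
  have A2: "0 \<le> A\<^sup>2" by simp
  have D: "0 < D" "6 * A\<^sup>2 \<le> D" "4 * C * (T + 1) \<le> D" "4 * C \<le> D"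
    unfolding D_def using A2 C CT by (simp_all add: distrib_left add_nonneg_pos add_pos_nonneg)
  define \<delta> where "\<delta> = 2 * \<kappa> / D"
  have \<delta>: "0 < \<delta>" using D \<kappa>_pos by (simp add: \<delta>_def)
  have small: "c * x \<le> 2 * \<kappa>" if "c \<le> D" "0 \<le> x" "x \<le> \<delta>" for c x
  proof -
    have "c * x \<le> D * \<delta>" using that D \<delta> by (intro mult_mono) auto
    then show ?thesis using D by (simp add: \<delta>_def)
  qed
  have "(\<integral>\<^sup>+\<omega>. ennreal (riccati_exp t \<omega>) \<partial>M) = (\<integral>\<^sup>+\<omega>. ennreal (riccati_exp s \<omega>) \<partial>M)"
    if st: "0 \<le> s" "s < t" "t \<le> T" "t - s \<le> \<delta>" for s t
  proof -
    define h where "h n = (t - s) / Suc n" for n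
    define u where "u n i = s + real i * h n" for n i
    have h: "0 < h n" "h n * Suc n = t - s" "h n \<le> t - s" for n
    proof -
      have "(t - s) / Suc n \<le> (t - s) / 1" using st by (intro divide_left_mono) auto
      then show "h n \<le> t - s" by (simp add: h_def)
    qed (use st in \<open>simp_all add: h_def del: of_nat_Suc\<close>)
    have u: "u n 0 = s" "u n (Suc n) = t" "u n (Suc i) - u n i = h n" for n i
      using h(2)[of n] by (auto simp: u_def algebra_simps)
    have u_less: "u n i < u n (Suc i)" for n i using u(3)[of n i] h(1)[of n] by linarith
    have u_bd: "0 \<le> u n i" "u n i \<le> t" "u n i \<le> T" if "i \<le> Suc n" for n i
      using grid_point_le[OF st(2) that] st h(1)[of n] unfolding u_def h_def[symmetric] by auto
    define X where "X n \<omega> = riccati_exp s \<omega> * (\<Prod>i<Suc n. exp_step_factor (u n i) (u n (Suc i)) (a (u n i)) \<omega>)" for n \<omega>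
    define E where "E n \<omega> = (\<Sum>i<Suc n. defect (u n i) (u n (Suc i)) \<omega>)" for n \<omega>
    define Q where "Q n \<omega> = h n * (\<Sum>i<Suc n. R (u n (Suc i)) \<omega>)" for n \<omega>
    define err where "err n \<omega> = (\<Sum>i<Suc n. integral {u n i..u n (Suc i)} (\<lambda>w. \<bar>R w \<omega> - R (u n (Suc i)) \<omega>\<bar>))" for n \<omega>
    \<comment> \<open>The one-step identities telescope, so \<open>X n\<close> is the target times
      the exponential of the accumulated defect. Since the target is at most 1 on nonnegative paths,
      the second moment of \<open>X n\<close> is governed by exponential moments of
      \<open>E n\<close> alone.\<close>
    have X_E: "X n \<omega> = riccati_exp t \<omega> * exp (- E n \<omega>)" if \<omega>: "\<omega> \<in> space M" for n \<omega>
    proof -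
      have "riccati_exp s \<omega> * (\<Prod>i<m. exp_step_factor (u n i) (u n (Suc i)) (a (u n i)) \<omega>)
          = riccati_exp (u n m) \<omega> * exp (- (\<Sum>i<m. defect (u n i) (u n (Suc i)) \<omega>))" if "m \<le> Suc n" for m
        using that
      proof (induction m)
        case 0 then show ?case by (simp add: u)
      next
        case (Suc m)
        have "riccati_exp s \<omega> * (\<Prod>i<Suc m. exp_step_factor (u n i) (u n (Suc i)) (a (u n i)) \<omega>)
          = (riccati_exp s \<omega> * (\<Prod>i<m. exp_step_factor (u n i) (u n (Suc i)) (a (u n i)) \<omega>)) * exp_step_factor (u n m) (u n (Suc m)) (a (u n m)) \<omega>"
          by simp
        also have "\<dots> = (riccati_exp (u n m) \<omega> * exp_step_factor (u n m) (u n (Suc m)) (a (u n m)) \<omega>) * exp (- (\<Sum>i<m. defect (u n i) (u n (Suc i)) \<omega>))"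
          using Suc by simp
        also have "riccati_exp (u n m) \<omega> * exp_step_factor (u n m) (u n (Suc m)) (a (u n m)) \<omega> = riccati_exp (u n (Suc m)) \<omega> * exp (- defect (u n m) (u n (Suc m)) \<omega>)"
          using Suc.prems u_bd[of m n] u_bd[of "Suc m" n] by (intro riccati_exp_step \<omega> u_less) auto
        also have "\<dots> * exp (- (\<Sum>i<m. defect (u n i) (u n (Suc i)) \<omega>)) = riccati_exp (u n (Suc m)) \<omega> * exp (- (\<Sum>i<Suc m. defect (u n i) (u n (Suc i)) \<omega>))"
          by (simp add: mult.assoc exp_add[symmetric])
        finally show ?case .
      qed
      from this[of "Suc n"] show ?thesis by (simp only: X_def E_def u(2) order_refl)
    qed
    have E_le: "\<bar>E n \<omega>\<bar> \<le> C * (h n * Q n \<omega> + h n * (t - s) + err n \<omega>)"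
      if \<omega>: "\<omega> \<in> space M" "\<forall>t\<ge>0. 0 \<le> R t \<omega>" for n \<omega>
    proof -
      have "\<bar>E n \<omega>\<bar> \<le> (\<Sum>i<Suc n. \<bar>defect (u n i) (u n (Suc i)) \<omega>\<bar>)" unfolding E_def by (rule sum_abs)
      also have "\<dots> \<le> (\<Sum>i<Suc n. C * ((h n)\<^sup>2 * R (u n (Suc i)) \<omega> + (h n)\<^sup>2 +
          integral {u n i..u n (Suc i)} (\<lambda>w. \<bar>R w \<omega> - R (u n (Suc i)) \<omega>\<bar>)))"
        using defect[OF u_bd(1) u_less u_bd(3) \<omega>] by (intro sum_mono) (simp add: u(3))
      also have "\<dots> = C * ((h n)\<^sup>2 * (\<Sum>i<Suc n. R (u n (Suc i)) \<omega>) + Suc n * (h n)\<^sup>2 + err n \<omega>)"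
        unfolding err_def sum_distrib_left[symmetric] sum.distrib by simp
      also have "Suc n * (h n)\<^sup>2 = h n * (t - s)" unfolding h(2)[of n, symmetric] by (simp add: power2_eq_square)
      finally show ?thesis by (simp only: Q_def power2_eq_square mult.assoc)
    qed
    have Q_lim: "(\<lambda>n. Q n \<omega>) \<longlonglongrightarrow> IR s t \<omega>" if "\<omega> \<in> space M" for \<omega>
      using IR_riemann[OF that st(1,2)] unfolding Q_def u_def h_def .
    have err_lim: "(\<lambda>n. err n \<omega>) \<longlonglongrightarrow> 0" if "\<omega> \<in> space M" for \<omega>
      using riemann_error_limit[OF R_continuous[OF that st(1)] st(2)] unfolding err_def u_def h_def .
    have h_lim: "h \<longlonglongrightarrow> 0"
      unfolding h_def[abs_def] by (intro LIMSEQ_Suc lim_const_over_n)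
    \<comment> \<open>The limit of \<open>err n\<close> is only pathwise. For the moments it is
      replaced by the crude bound of each oscillation by the sum of the two nonnegative values,
      which has exponential moments.\<close>
    have err_le: "err n \<omega> \<le> IR s t \<omega> + Q n \<omega>" if \<omega>: "\<omega> \<in> space M" "\<forall>t\<ge>0. 0 \<le> R t \<omega>" for n \<omega>
    proof -
      have "integral {u n i..u n (Suc i)} (\<lambda>w. \<bar>R w \<omega> - R (u n (Suc i)) \<omega>\<bar>)
          \<le> (IR 0 (u n (Suc i)) \<omega> - IR 0 (u n i) \<omega>) + h n * R (u n (Suc i)) \<omega>" if i: "i < Suc n" for i
      proof -
        have ui: "0 \<le> u n i" "u n i < u n (Suc i)" "0 \<le> u n (Suc i)"
          using i u_bd[of i n] u_bd[of "Suc i" n] u_less by auto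
        have Rc: "continuous_on {u n i..u n (Suc i)} (\<lambda>w. R w \<omega>)" by (rule R_continuous[OF \<omega>(1) ui(1)])
        have "integral {u n i..u n (Suc i)} (\<lambda>w. \<bar>R w \<omega> - R (u n (Suc i)) \<omega>\<bar>)
          \<le> integral {u n i..u n (Suc i)} (\<lambda>w. R w \<omega> + R (u n (Suc i)) \<omega>)"
        proof (intro integral_le integrable_continuous_interval continuous_intros Rc)
          fix w assume "w \<in> {u n i..u n (Suc i)}"
          then have "0 \<le> R w \<omega>" "0 \<le> R (u n (Suc i)) \<omega>" using \<omega>(2) ui by auto
          then show "\<bar>R w \<omega> - R (u n (Suc i)) \<omega>\<bar> \<le> R w \<omega> + R (u n (Suc i)) \<omega>" by linarith
        qed
        also have "\<dots> = IR (u n i) (u n (Suc i)) \<omega> + h n * R (u n (Suc i)) \<omega>"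
          using Henstock_Kurzweil_Integration.integral_add[OF integrable_continuous_interval[OF Rc] integrable_const_ivl, of "R (u n (Suc i)) \<omega>"] ui \<omega>
          by (simp add: IR_eq u(3))
        finally show ?thesis using IR_split[OF \<omega>(1) ui(1) less_imp_le[OF ui(2)]] by linarith
      qed
      then have "err n \<omega> \<le> (\<Sum>i<Suc n. (IR 0 (u n (Suc i)) \<omega> - IR 0 (u n i) \<omega>) + h n * R (u n (Suc i)) \<omega>)"
        unfolding err_def by (intro sum_mono) simp
      also have "\<dots> = (IR 0 t \<omega> - IR 0 s \<omega>) + Q n \<omega>"
        unfolding sum.distrib Q_def sum_distrib_left[symmetric] sum_lessThan_telescope[of "\<lambda>i. IR 0 (u n i) \<omega>" "Suc n"] u(1,2) ..
      finally show ?thesis using IR_split[OF \<omega>(1) st(1) less_imp_le[OF st(2)]] by linarith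
    qed
    have X_meas [measurable]: "X n \<in> borel_measurable M" for n
    proof -
      have "exp_step_factor (u n i) (u n (Suc i)) b \<in> borel_measurable M" if "i \<in> {..<Suc n}" for i b
        using u_bd[of i n] that u_less[of n i] by (intro measurable_F[OF exp_step_factor_measurable]) auto
      then show ?thesis unfolding X_def[abs_def] using measurable_F[OF riccati_exp_measurable[OF st(1)]]
        by (intro borel_measurable_times borel_measurable_prod) auto
    qed
    have [measurable]: "riccati_exp t \<in> borel_measurable M" using st by (intro measurable_F[OF riccati_exp_measurable]) auto
    have Q_meas [measurable]: "Q n \<in> borel_measurable M" for n
      unfolding Q_def[abs_def] using u_bd by (intro borel_measurable_times borel_measurable_sum borel_measurable_const R_random) auto
    have [measurable]: "IR s t \<in> borel_measurable M" using st by auto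
    show ?thesis
    proof (rule nn_integral_lim_of_L2_bound[where X = X and B = "exp (2 * C * T * T) * moment_bound T"])
      show "0 \<le> X n \<omega>" for n \<omega> unfolding X_def riccati_exp_def exp_step_factor_def by (intro mult_nonneg_nonneg prod_nonneg) auto
      show "AE \<omega> in M. (\<lambda>n. X n \<omega>) \<longlonglongrightarrow> riccati_exp t \<omega>"
        using good_path
      proof eventually_elim
        case (elim \<omega>)
        then have \<omega>: "\<omega> \<in> space M" "\<forall>t\<ge>0. 0 \<le> R t \<omega>" by auto
        have "(\<lambda>n. C * (h n * Q n \<omega> + h n * (t - s) + err n \<omega>)) \<longlonglongrightarrow> C * (0 * IR s t \<omega> + 0 * (t - s) + 0)"
          by (intro tendsto_intros h_lim Q_lim err_lim \<omega>)
        then have "(\<lambda>n. C * (h n * Q n \<omega> + h n * (t - s) + err n \<omega>)) \<longlonglongrightarrow> 0" by simp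
        then have "(\<lambda>n. E n \<omega>) \<longlonglongrightarrow> 0"
          by (rule Lim_null_comparison[rotated]) (use E_le[OF \<omega>] in auto)
        then have "(\<lambda>n. riccati_exp t \<omega> * exp (- E n \<omega>)) \<longlonglongrightarrow> riccati_exp t \<omega> * exp (- 0)" by (intro tendsto_intros)
        then show ?case by (simp add: X_E[OF \<omega>(1)])
      qed
      show "(\<integral>\<^sup>+\<omega>. ennreal (X n \<omega>) \<partial>M) = (\<integral>\<^sup>+\<omega>. ennreal (riccati_exp s \<omega>) \<partial>M)" for n
      proof -
        have "(\<integral>\<^sup>+\<omega>. ennreal (X n \<omega>) \<partial>M) = (\<integral>\<^sup>+\<omega>. ennreal (riccati_exp s \<omega>) * ennreal (\<Prod>i<Suc n. exp_step_factor (u n i) (u n (Suc i)) (a (u n i)) \<omega>) \<partial>M)"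
          unfolding X_def by (intro nn_integral_cong ennreal_mult) (auto simp: riccati_exp_def exp_step_factor_def intro!: prod_nonneg mult_nonneg_nonneg)
        also have "\<dots> = (\<integral>\<^sup>+\<omega>. ennreal (riccati_exp s \<omega>) \<partial>M)"
        proof (rule exp_step_factor_prod)
          show "0 \<le> u n 0" "\<forall>i<Suc n. u n i < u n (Suc i)" "u n (Suc n) \<le> T"
            using u st u_less by auto
          show "(\<lambda>\<omega>. ennreal (riccati_exp s \<omega>)) \<in> borel_measurable (F (u n 0))"
            unfolding u using riccati_exp_measurable[OF st(1)] by measurable
          show "6 * (a (u n i))\<^sup>2 * (u n (Suc i) - u n i) \<le> 2 * \<kappa>" if i: "i < Suc n" for i
          proof (rule small)
            have "a (u n i) \<in> {0..A}" using u_bd[of i n] i a_nonneg[of "u n i"] a_le[of "u n i"] by auto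
            then have "(a (u n i))\<^sup>2 \<le> A\<^sup>2" by (auto intro: power_mono)
            then show "6 * (a (u n i))\<^sup>2 \<le> D" using D(2) by linarith
            show "0 \<le> u n (Suc i) - u n i" "u n (Suc i) - u n i \<le> \<delta>"
              unfolding u(3) using h[of n] st(4) by linarith+
          qed
        qed
        finally show ?thesis .
      qed
      show "(\<integral>\<^sup>+\<omega>. ennreal ((X n \<omega>)\<^sup>2) \<partial>M) \<le> ennreal (exp (2 * C * T * T) * moment_bound T)" for n
      proof -
        let ?w = "exp (2 * C * T * T)" and ?c = "4 * C * (T + 1) * h n"
        let ?y = "\<lambda>\<omega>. exp (?c * (\<Sum>i<Suc n. R (u n (Suc i)) \<omega>))" and ?z = "\<lambda>\<omega>. exp (4 * C * IR s t \<omega>)"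
        have hT: "h n \<le> T" "t - s \<le> T" using h(3)[of n] st by linarith+
        \<comment> \<open>With \<open>h n\<close> and \<open>t - s\<close> bounded by T, the
          exponent is at most C times \<open>T * T + (T + 1) * Q n + IR s t\<close>. Squaring
          doubles it, and the arithmetic-geometric mean inequality that separates \<open>Q n\<close>
          from \<open>IR s t\<close> doubles their coefficients once more: hence the factors 4 in
          \<open>D\<close>.\<close>
        have pt: "(X n \<omega>)\<^sup>2 \<le> ?w * (1/2) * ?y \<omega> + ?w * (1/2) * ?z \<omega>"
          if \<omega>: "\<omega> \<in> space M" "\<forall>t\<ge>0. 0 \<le> R t \<omega>" for \<omega>
        proof -
          have Q: "0 \<le> Q n \<omega>" unfolding Q_def using h(1)[of n] \<omega>(2) u_bd(1)
            by (intro mult_nonneg_nonneg sum_nonneg) auto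
          have "h n * Q n \<omega> \<le> T * Q n \<omega>" using hT Q by (intro mult_right_mono)
          moreover have "h n * (t - s) \<le> T * T" using hT st T_nonneg h(1)[of n] by (intro mult_mono) auto
          ultimately have "h n * Q n \<omega> + h n * (t - s) + err n \<omega> \<le> T * Q n \<omega> + T * T + (IR s t \<omega> + Q n \<omega>)"
            using err_le[OF \<omega>, of n] by linarith
          from mult_left_mono[OF this C] have "- E n \<omega> \<le> C * (T * Q n \<omega> + T * T + (IR s t \<omega> + Q n \<omega>))"
            using E_le[OF \<omega>, of n] by linarith
          also have "\<dots> = C * T * T + (C * (T + 1) * Q n \<omega> + C * IR s t \<omega>)" by (simp add: algebra_simps)
          finally have "- E n \<omega> \<le> \<dots>" .
          moreover have "riccati_exp t \<omega> \<le> 1" using \<omega> st by (intro riccati_exp_le_1) auto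
          ultimately have "X n \<omega> \<le> 1 * exp (C * T * T + (C * (T + 1) * Q n \<omega> + C * IR s t \<omega>))"
            unfolding X_E[OF \<omega>(1)] by (intro mult_mono) auto
          then have "(X n \<omega>)\<^sup>2 \<le> (exp (C * T * T + (C * (T + 1) * Q n \<omega> + C * IR s t \<omega>)))\<^sup>2"
            unfolding X_E[OF \<omega>(1)] by (intro power_mono) (auto simp: riccati_exp_def)
          also have "\<dots> = ?w * (exp (2 * C * (T + 1) * Q n \<omega>) * exp (2 * C * IR s t \<omega>))"
            by (simp add: exp_double[symmetric] exp_add[symmetric] algebra_simps)
          also have "\<dots> \<le> ?w * (1/2 * (exp (2 * C * (T + 1) * Q n \<omega>))\<^sup>2 + 1/2 * (exp (2 * C * IR s t \<omega>))\<^sup>2)"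
            using sum_squares_bound[of "exp (2 * C * (T + 1) * Q n \<omega>)" "exp (2 * C * IR s t \<omega>)"]
            by (intro mult_left_mono) auto
          also have "\<dots> = ?w * (1/2) * ?y \<omega> + ?w * (1/2) * ?z \<omega>"
            by (simp add: exp_double[symmetric] Q_def distrib_left mult.assoc del: sum.lessThan_Suc)
          finally show ?thesis .
        qed
        have y: "(\<integral>\<^sup>+\<omega>. ennreal (?y \<omega>) \<partial>M) \<le> ennreal (moment_bound T)"
        proof (rule exp_moment_sum[where u = "\<lambda>i. u n (Suc i)"])
          show "0 \<le> u n (Suc i) \<and> u n (Suc i) \<le> T" if "i < Suc n" for i using u_bd[of "Suc i" n] that by auto
          have eq: "?c * Suc n = 4 * C * (T + 1) * (t - s)" unfolding h(2)[of n, symmetric] by (simp only: mult.assoc)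
          have "4 * C * (T + 1) * (t - s) \<le> 2 * \<kappa>" by (rule small[OF D(3)]) (use st in auto)
          then show "?c * Suc n \<le> 2 * \<kappa>" by (simp only: eq)
        qed
        have z: "(\<integral>\<^sup>+\<omega>. ennreal (?z \<omega>) \<partial>M) \<le> ennreal (moment_bound T)"
          using small[OF D(4), of "t - s"] st by (intro exp_moment_integral) auto
        have [measurable]: "?y \<in> borel_measurable M"
        proof -
          have "?y = (\<lambda>\<omega>. exp (4 * C * (T + 1) * Q n \<omega>))" by (simp only: Q_def mult.assoc)
          then show ?thesis by simp
        qed
        have "(\<integral>\<^sup>+\<omega>. ennreal ((X n \<omega>)\<^sup>2) \<partial>M) \<le> (\<integral>\<^sup>+\<omega>. ennreal (?w * (1/2)) * ennreal (?y \<omega>) + ennreal (?w * (1/2)) * ennreal (?z \<omega>) \<partial>M)"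
        proof (rule nn_integral_mono_AE)
          show "AE \<omega> in M. ennreal ((X n \<omega>)\<^sup>2) \<le> ennreal (?w * (1/2)) * ennreal (?y \<omega>) + ennreal (?w * (1/2)) * ennreal (?z \<omega>)"
            using good_path
          proof eventually_elim
            case (elim \<omega>)
            then have "ennreal ((X n \<omega>)\<^sup>2) \<le> ennreal (?w * (1/2) * ?y \<omega> + ?w * (1/2) * ?z \<omega>)"
              by (intro ennreal_leI pt) auto
            also have "\<dots> = ennreal (?w * (1/2) * ?y \<omega>) + ennreal (?w * (1/2) * ?z \<omega>)" by (rule ennreal_plus) auto
            also have "ennreal (?w * (1/2) * ?y \<omega>) = ennreal (?w * (1/2)) * ennreal (?y \<omega>)" by (rule ennreal_mult) auto
            also have "ennreal (?w * (1/2) * ?z \<omega>) = ennreal (?w * (1/2)) * ennreal (?z \<omega>)" by (rule ennreal_mult) auto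
            finally show ?case .
          qed
        qed
        also have "\<dots> = ennreal (?w * (1/2)) * (\<integral>\<^sup>+\<omega>. ennreal (?y \<omega>) \<partial>M) + ennreal (?w * (1/2)) * (\<integral>\<^sup>+\<omega>. ennreal (?z \<omega>) \<partial>M)"
        proof -
          have "(\<integral>\<^sup>+\<omega>. p * f \<omega> + p * f' \<omega> \<partial>M) = p * (\<integral>\<^sup>+\<omega>. f \<omega> \<partial>M) + p * (\<integral>\<^sup>+\<omega>. f' \<omega> \<partial>M)"
            if [measurable]: "f \<in> borel_measurable M" "f' \<in> borel_measurable M" for p :: ennreal and f f'
            by (simp add: nn_integral_add nn_integral_cmult)
          then show ?thesis
            by this (rule measurable_compose[OF _ measurable_ennreal], measurable)+
        qed
        also have "\<dots> \<le> ennreal (?w * (1/2)) * ennreal (moment_bound T) + ennreal (?w * (1/2)) * ennreal (moment_bound T)"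
          by (intro add_mono mult_left_mono y z) auto
        also have "\<dots> = ennreal (?w * (1/2) * moment_bound T) + ennreal (?w * (1/2) * moment_bound T)"
        proof -
          have "ennreal (?w * (1/2) * moment_bound T) = ennreal (?w * (1/2)) * ennreal (moment_bound T)"
            by (rule ennreal_mult) (auto simp: moment_bound_def)
          then show ?thesis by (simp only:)
        qed
        also have "\<dots> = ennreal (?w * (1/2) * moment_bound T + ?w * (1/2) * moment_bound T)"
          by (rule ennreal_plus[symmetric]) (auto simp: moment_bound_def)
        also have "?w * (1/2) * moment_bound T + ?w * (1/2) * moment_bound T = ?w * moment_bound T" by simp
        finally show ?thesis .
      qed
    qed simp_all
  qed
  then have "\<forall>s t. 0 \<le> s \<longrightarrow> s \<le> t \<longrightarrow> t \<le> T \<longrightarrow> t - s \<le> \<delta> \<longrightarrow>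
    (\<integral>\<^sup>+\<omega>. ennreal (riccati_exp t \<omega>) \<partial>M) = (\<integral>\<^sup>+\<omega>. ennreal (riccati_exp s \<omega>) \<partial>M)"
    by (metis order_le_less)
  with \<delta> show ?thesis by blast
qed

text \<open>The admissible length \<delta> is uniform in the position of the interval, so N equal
  pieces with \<open>T / N \<le> \<delta>\<close> cover [0,T].\<close>

lemma riccati_exp_expectation: "(\<integral>\<^sup>+\<omega>. ennreal (riccati_exp T \<omega>) \<partial>M) = (\<integral>\<^sup>+\<omega>. ennreal (riccati_exp 0 \<omega>) \<partial>M)"
proof -
  obtain \<delta> where \<delta>: "0 < \<delta>" and step: "\<And>s t. 0 \<le> s \<Longrightarrow> s \<le> t \<Longrightarrow> t \<le> T \<Longrightarrow> t - s \<le> \<delta> \<Longrightarrow>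
    (\<integral>\<^sup>+\<omega>. ennreal (riccati_exp t \<omega>) \<partial>M) = (\<integral>\<^sup>+\<omega>. ennreal (riccati_exp s \<omega>) \<partial>M)"
    using riccati_exp_short_interval by blast
  obtain N :: nat where N: "T / \<delta> < N" using reals_Archimedean2 by blast
  have "0 \<le> T / \<delta>" using \<delta> T_nonneg by simp
  with N have N0: "0 < N" by simp
  have TN: "T / N \<le> \<delta>" using N N0 \<delta> by (simp add: field_simps less_imp_le)
  have "(\<integral>\<^sup>+\<omega>. ennreal (riccati_exp (i * (T / N)) \<omega>) \<partial>M) = (\<integral>\<^sup>+\<omega>. ennreal (riccati_exp 0 \<omega>) \<partial>M)" if "i \<le> N" for i :: nat
    using that
  proof (induction i)
    case (Suc i)
    have "Suc i * (T / N) \<le> N * (T / N)" using Suc.prems T_nonneg by (intro mult_right_mono) auto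
    then have "Suc i * (T / N) \<le> T" using N0 by simp
    moreover have "Suc i * (T / N) - i * (T / N) = T / N" by (simp add: algebra_simps add_divide_distrib)
    moreover have "0 \<le> i * (T / N)" "0 \<le> T / N" using T_nonneg by simp_all
    ultimately have "(\<integral>\<^sup>+\<omega>. ennreal (riccati_exp (Suc i * (T / N)) \<omega>) \<partial>M) = (\<integral>\<^sup>+\<omega>. ennreal (riccati_exp (i * (T / N)) \<omega>) \<partial>M)"
      using TN by (intro step) linarith+
    with Suc show ?case by simp
  qed simp
  from this[of N] N0 show ?thesis by simp
qed

lemma laplace_transform:
  "expectation (\<lambda>\<omega>. exp (- a T * R T \<omega> - \<gamma> * IR 0 T \<omega>))
    = exp (- R\<^sub>0 * a 0 - \<kappa> * integral {0..T} (\<lambda>w. a w * \<theta> w))"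
proof -
  have [measurable]: "R T \<in> borel_measurable M" "IR 0 T \<in> borel_measurable M" using T_nonneg by auto
  have "(\<integral>\<^sup>+\<omega>. ennreal (exp (- a T * R T \<omega> - \<gamma> * IR 0 T \<omega>)) \<partial>M) = (\<integral>\<^sup>+\<omega>. ennreal (riccati_exp T \<omega>) \<partial>M)"
    by (simp add: riccati_exp_def)
  also have "\<dots> = (\<integral>\<^sup>+\<omega>. ennreal (riccati_exp 0 \<omega>) \<partial>M)" by (rule riccati_exp_expectation)
  also have "\<dots> = (\<integral>\<^sup>+\<omega>. ennreal (exp (- R\<^sub>0 * a 0 - \<kappa> * integral {0..T} (\<lambda>w. a w * \<theta> w))) \<partial>M)"
    by (rule nn_integral_cong_AE) (use good_path in eventually_elim, simp add: riccati_exp_def IR_eq mult.commute)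
  finally have "(\<integral>\<^sup>+\<omega>. ennreal (exp (- a T * R T \<omega> - \<gamma> * IR 0 T \<omega>)) \<partial>M) = ennreal (exp (- R\<^sub>0 * a 0 - \<kappa> * integral {0..T} (\<lambda>w. a w * \<theta> w)))"
    by (simp add: emeasure_space_1)
  then show ?thesis by (subst integral_eq_nn_integral) auto
qed

end

subsection \<open>The explicit transform\<close>

text \<open>Positivity of \<gamma> gives \<kappa> < d, so both parts of the numerator of f are
  positive, while \<open>c > 1\<close> keeps the denominator positive for all nonnegative
  times.\<close>

lemma
  fixes \<kappa> lam \<gamma> :: real
  assumes "0 < \<kappa>" "0 < \<gamma>" "sqrt (\<kappa>\<^sup>2 + 2 * \<gamma>) - \<kappa> < lam"
  shows CIR_c_gt_1: "1 < CIR_c \<kappa> lam \<gamma>"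
    and CIR_f_0: "CIR_f \<kappa> lam \<gamma> 0 = lam"
    and CIR_f_nonneg: "0 \<le> t \<Longrightarrow> 0 \<le> CIR_f \<kappa> lam \<gamma> t"
    and CIR_f_deriv: "0 \<le> t \<Longrightarrow> (CIR_f \<kappa> lam \<gamma> has_real_derivative
      \<gamma> - \<kappa> * CIR_f \<kappa> lam \<gamma> t - (CIR_f \<kappa> lam \<gamma> t)\<^sup>2 / 2) (at t)"
proof -
  define d where "d = sqrt (\<kappa>\<^sup>2 + 2 * \<gamma>)"
  define c where "c = CIR_c \<kappa> lam \<gamma>"
  have d2: "d\<^sup>2 = \<kappa>\<^sup>2 + 2 * \<gamma>" using assms unfolding d_def by (simp add: add_nonneg_nonneg)
  have d\<kappa>: "\<kappa> < d" unfolding d_def using assms by (intro real_less_rsqrt) simp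
  have den: "0 < lam + \<kappa> - d" using assms by (simp add: d_def)
  have c_eq: "c = (lam + \<kappa> + d) / (lam + \<kappa> - d)" by (simp add: c_def CIR_c_def d_def)
  show c1: "1 < CIR_c \<kappa> lam \<gamma>"
    unfolding c_def[symmetric] c_eq using den d\<kappa> assms by (simp add: less_divide_eq)
  have f_eq: "CIR_f \<kappa> lam \<gamma> t = (\<kappa> + d + c * exp (d * t) * (d - \<kappa>)) / (c * exp (d * t) - 1)" for t
    by (simp add: CIR_f_def Let_def d_def c_def)
  have pos: "1 < c * exp (d * t)" if "0 \<le> t" for t
  proof -
    have "c * 1 \<le> c * exp (d * t)" using c1 d\<kappa> assms that unfolding c_def by (intro mult_left_mono) auto
    then show ?thesis using c1 unfolding c_def by linarith
  qed
  \<comment> \<open>At time 0 the denominator and the numerator of f contain the same factor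
    \<open>2 * d / (lam + \<kappa> - d)\<close>, which cancels and leaves
    \<open>lam\<close>.\<close>
  have "c - 1 = 2 * d / (lam + \<kappa> - d)" "\<kappa> + d + c * (d - \<kappa>) = lam * (2 * d / (lam + \<kappa> - d))"
    unfolding c_eq using den by (simp_all add: field_simps)
  then show "CIR_f \<kappa> lam \<gamma> 0 = lam" using den d\<kappa> assms by (simp add: f_eq)
  show "0 \<le> CIR_f \<kappa> lam \<gamma> t" if "0 \<le> t" for t
    unfolding f_eq using pos[OF that] d\<kappa> assms c1[folded c_def] by (intro divide_nonneg_pos add_nonneg_nonneg mult_nonneg_nonneg) auto
  show "(CIR_f \<kappa> lam \<gamma> has_real_derivative
      \<gamma> - \<kappa> * CIR_f \<kappa> lam \<gamma> t - (CIR_f \<kappa> lam \<gamma> t)\<^sup>2 / 2) (at t)" if t: "0 \<le> t" for t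
  proof -
    let ?x = "c * exp (d * t)"
    have x: "?x - 1 \<noteq> 0" using pos[OF t] by simp
    have "((\<lambda>t. (\<kappa> + d + c * exp (d * t) * (d - \<kappa>)) / (c * exp (d * t) - 1)) has_real_derivative
        (?x * d * (d - \<kappa>) * (?x - 1) - (\<kappa> + d + ?x * (d - \<kappa>)) * (?x * d)) / ((?x - 1) * (?x - 1))) (at t)"
      using x by (auto intro!: derivative_eq_intros)
    also have "(?x * d * (d - \<kappa>) * (?x - 1) - (\<kappa> + d + ?x * (d - \<kappa>)) * (?x * d)) / ((?x - 1) * (?x - 1))
        = \<gamma> - \<kappa> * CIR_f \<kappa> lam \<gamma> t - (CIR_f \<kappa> lam \<gamma> t)\<^sup>2 / 2"
    proof -
      have \<gamma>: "\<gamma> = (d\<^sup>2 - \<kappa>\<^sup>2) / 2" using d2 by simp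
      \<comment> \<open>With \<gamma> expressed through d and \<kappa>, the Riccati equation becomes
        a rational identity in the single variable \<open>y = c * exp (d * t)\<close>.\<close>
      have key: "(y * d * (d - \<kappa>) * (y - 1) - (\<kappa> + d + y * (d - \<kappa>)) * (y * d)) / ((y - 1) * (y - 1))
          = (d\<^sup>2 - \<kappa>\<^sup>2) / 2 - \<kappa> * ((\<kappa> + d + y * (d - \<kappa>)) / (y - 1)) - ((\<kappa> + d + y * (d - \<kappa>)) / (y - 1))\<^sup>2 / 2"
        if "y - 1 \<noteq> 0" for y
        using that by (simp add: divide_simps power2_eq_square) (simp add: algebra_simps)
      show ?thesis unfolding f_eq using key[OF x] \<gamma> by simp
    qed
    finally show ?thesis by (simp add: f_eq[abs_def])
  qed
qed

theorem theorem6p5: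
  fixes M :: "'a measure" and F :: "real \<Rightarrow> 'a measure" and Z R :: "real \<Rightarrow> 'a \<Rightarrow> real"
    and \<theta> :: "real \<Rightarrow> real" and \<kappa> R\<^sub>0 lam \<gamma> t :: real
  assumes "extended_CIR M F Z \<kappa> \<theta> R\<^sub>0 R"
    and "0 \<le> lam" and "0 < \<gamma>" and "0 \<le> t"
    and "sqrt (\<kappa>\<^sup>2 + 2 * \<gamma>) - \<kappa> < lam"
  shows "1 < CIR_c \<kappa> lam \<gamma> \<and>
    prob_space.expectation M (\<lambda>\<omega>. exp (- lam * R t \<omega> - \<gamma> * (LBINT u:{0..t}. R u \<omega>)))
      = exp (- R\<^sub>0 * CIR_f \<kappa> lam \<gamma> t - \<kappa> * (LBINT s:{0..t}. \<theta> s * CIR_f \<kappa> lam \<gamma> (t - s)))"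
proof
  interpret cir_process M F Z R \<kappa> \<theta> R\<^sub>0 by unfold_locales (rule assms(1))
  note par = \<kappa>_pos assms(3,5)
  show "1 < CIR_c \<kappa> lam \<gamma>" by (rule CIR_c_gt_1[OF par])
  \<comment> \<open>Time reversal flips the sign of the Riccati equation and exchanges the ends:
    \<open>a t = lam\<close> is the coefficient of \<open>R t\<close> in the transform, and
    \<open>a 0\<close> is the value of f at t, the coefficient of the initial value.\<close>
  define a where "a u = CIR_f \<kappa> lam \<gamma> (t - u)" for u
  have deriv: "(a has_real_derivative \<kappa> * a u + (a u)\<^sup>2 / 2 - \<gamma>) (at u within {0..t})" if "u \<in> {0..t}" for u
  proof -
    have "((\<lambda>u. CIR_f \<kappa> lam \<gamma> (t - u)) has_real_derivative
        (\<gamma> - \<kappa> * CIR_f \<kappa> lam \<gamma> (t - u) - (CIR_f \<kappa> lam \<gamma> (t - u))\<^sup>2 / 2) * (0 - 1)) (at u within {0..t})"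
      by (rule DERIV_chain2[OF CIR_f_deriv[OF par]]) (use that in \<open>auto intro!: derivative_eq_intros\<close>)
    then show ?thesis by (simp add: a_def[abs_def] algebra_simps)
  qed
  have cont: "continuous_on {0..t} a" by (rule DERIV_continuous_on[OF deriv])
  have "{0..t} \<noteq> {}" using assms(4) by simp
  from continuous_attains_sup[OF compact_Icc this cont]
  obtain m where m: "\<And>u. u \<in> {0..t} \<Longrightarrow> a u \<le> a m" by blast
  interpret cir_riccati M F Z R \<kappa> \<theta> R\<^sub>0 a \<gamma> t "a m"
    by unfold_locales (use assms deriv m CIR_f_nonneg[OF par] in \<open>auto simp: a_def\<close>)
  have "(LBINT s:{0..t}. \<theta> s * CIR_f \<kappa> lam \<gamma> (t - s)) = integral {0..t} (\<lambda>w. a w * \<theta> w)"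
    unfolding a_def[symmetric] using cont
    by (subst LBINT_eq_integral) (auto intro!: continuous_intros \<theta>_continuous simp: mult.commute)
  then show "expectation (\<lambda>\<omega>. exp (- lam * R t \<omega> - \<gamma> * (LBINT u:{0..t}. R u \<omega>)))
      = exp (- R\<^sub>0 * CIR_f \<kappa> lam \<gamma> t - \<kappa> * (LBINT s:{0..t}. \<theta> s * CIR_f \<kappa> lam \<gamma> (t - s)))"
    using laplace_transform by (simp add: a_def CIR_f_0[OF par] IR_def)
qed

end
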